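(* Let $V$ be a finite-dimensional Euclidean Jordan algebra (over $\mathbb{R}$, with identity $e$) of rank $d$, with cone of squares $\mathcal{Q}$. Let $$\mathcal{K}_{\mathrm{rtdet}} = \{ (u, w) \in \mathbb{R} \times \mathcal{Q} : u \leq \det(w)^{1/d} \}.$$ Then the function $\Gamma : \operatorname{int}(\mathcal{K}_{\mathrm{rtdet}}) \to \mathbb{R}$ given by $$\Gamma(u,w) = -\log\bigl( \det(w)^{1/d} - u \bigr) - \log(\det(w))$$ is a logarithmically homogeneous self-concordant barrier with parameter $1 + d$ (a $(1+d)$-LHSCB) for the proper cone $\mathcal{K}_{\mathrm{rtdet}}$.
   Context: $\operatorname{int}$ denotes interior. Jordan algebra conventions: the product is $\circ$; a Jordan algebra is Euclidean if $\langle w_a \circ w_b, w_c\rangle = \langle w_b, w_a \circ w_c\rangle$ for an inner product. The rank $d$ of $V$ is the number of elements in any Jordan frame (complete system of pairwise orthogonal primitive idempotents, summing to $e$). Every $w \in V$ has a spectral decomposition $w = \sum_{i=1}^d w_i c_i$ with real eigenvalues $w_1,\dots,w_d$ and a Jordan frame $c_1,\dots,c_d$. One sets $\operatorname{tr}(w) = \sum_i w_i$ and $\det(w) = \prod_i w_i$. The inner product on $V$ is $\langle w_a, w_b \rangle = \operatorname{tr}(w_a \circ w_b)$. The cone of squares is $\mathcal{Q} = \{ w \circ w : w \in V\}$; $w \in \operatorname{int}(\mathcal{Q})$ iff all eigenvalues of $w$ are positive. A cone is proper if it is a closed, convex, pointed, full-dimensional conic set. A $\nu$-LHSCB for a proper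 cone $\mathcal{K} \subset \tilde V$ is a $C^3$-smooth convex function $\Gamma : \operatorname{int}(\mathcal{K}) \to \mathbb{R}$ such that: (i) $\Gamma(\tilde u_i) \to \infty$ along every sequence $\tilde u_i \in \operatorname{int}(\mathcal{K})$ converging to a boundary point of $\mathcal{K}$; (ii) $\Gamma(\theta \tilde u) = \Gamma(\tilde u) - \nu \log(\theta)$ for all $\tilde u \in \operatorname{int}(\mathcal{K})$ and $\theta > 0$; (iii) $\lvert \nabla^3 \Gamma(\tilde u)[\tilde p,\tilde p,\tilde p] \rvert \leq 2 (\nabla^2 \Gamma(\tilde u)[\tilde p,\tilde p])^{3/2}$ for all $\tilde u \in \operatorname{int}(\mathcal{K})$ and $\tilde p \in \tilde V$. *)

theory Defs
  imports "HOL-Analysis.Analysis"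
begin

section \<open>Euclidean Jordan algebras\<close>

text \<open>
  The class \<^class>\<open>euclidean_space\<close> only supplies a nonzero finite-dimensional real vector
  space with its topology; its inner product is not assumed to be related to the Jordan product.
  In particular the trace form is one possible choice for the inner product in
  \<open>euclidean\<close>.
\<close>

locale euclidean_jordan_algebra =
  fixes jprod :: "'v::euclidean_space \<Rightarrow> 'v \<Rightarrow> 'v" (infixl "\<odot>" 70)
    and e :: 'v
  assumes bilinear: "bilinear (\<odot>)"
    and commute: "x \<odot> y = y \<odot> x"
    and jordan: "(x \<odot> x) \<odot> (x \<odot> y) = x \<odot> ((x \<odot> x) \<odot> y)"
    and unit: "e \<odot> x = x"
    and euclidean: "\<exists>ip :: 'v \<Rightarrow> 'v \<Rightarrow> real.
      bilinear ip \<and> (\<forall>a b. ip a b = ip b a) \<and> (\<forall>a. a \<noteq> 0 \<longrightarrow> ip a a > 0) \<and>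
      (\<forall>a b c. ip (a \<odot> b) c = ip b (a \<odot> c))"
begin

definition idempotent :: "'v \<Rightarrow> bool" where
  "idempotent c \<longleftrightarrow> c \<odot> c = c"

text \<open>
  If a sum of two idempotents is idempotent, the summands are automatically orthogonal.
\<close>

definition primitive_idempotent :: "'v \<Rightarrow> bool" where
  "primitive_idempotent c \<longleftrightarrow> idempotent c \<and> c \<noteq> 0 \<and>
     \<not> (\<exists>a b. idempotent a \<and> idempotent b \<and> a \<noteq> 0 \<and> b \<noteq> 0 \<and> c = a + b)"

text \<open>
  Frames can be sets rather than families: two orthogonal nonzero idempotents are distinct, so a
  frame has no repeated members.
\<close>

definition jordan_frame :: "'v set \<Rightarrow> bool" where
  "jordan_frame C \<longleftrightarrow> finite C \<and> (\<forall>c\<in>C. primitive_idempotent c) \<and>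
     (\<forall>a\<in>C. \<forall>b\<in>C. a \<noteq> b \<longrightarrow> a \<odot> b = 0) \<and> (\<Sum>c\<in>C. c) = e"

definition jrank :: nat where
  "jrank = (THE d. \<exists>C. jordan_frame C \<and> card C = d)"

definition spectral_decomposition :: "'v \<Rightarrow> 'v set \<Rightarrow> ('v \<Rightarrow> real) \<Rightarrow> bool" where
  "spectral_decomposition w C l \<longleftrightarrow> jordan_frame C \<and> w = (\<Sum>c\<in>C. l c *\<^sub>R c)"

definition jdet :: "'v \<Rightarrow> real" where
  "jdet w = (THE r. \<exists>C l. spectral_decomposition w C l \<and> r = (\<Prod>c\<in>C. l c))"

definition cone_of_squares :: "'v set" where
  "cone_of_squares = {w \<odot> w | w. True}"

definition rtdet_cone :: "(real \<times> 'v) set" where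
  "rtdet_cone = {(u, w). w \<in> cone_of_squares \<and> u \<le> jdet w powr (1 / real jrank)}"

definition rtdet_barrier :: "real \<times> 'v \<Rightarrow> real" where
  "rtdet_barrier = (\<lambda>(u, w). - ln (jdet w powr (1 / real jrank) - u) - ln (jdet w))"

end

section \<open>Logarithmically homogeneous self-concordant barriers\<close>

definition proper_cone :: "'a::euclidean_space set \<Rightarrow> bool" where
  "proper_cone K \<longleftrightarrow> cone K \<and> closed K \<and> convex K \<and> K \<inter> uminus ` K = {0} \<and>
     aff_dim K = int DIM('a)"

text \<open>
  Continuous differentiability of order \<open>n\<close> on an open set. As the domain is
  finite-dimensional, continuity of the derivative may be tested on each fixed direction \<open>v\<close>.
\<close>

primrec C_smooth_on :: "nat \<Rightarrow> 'a::euclidean_space set \<Rightarrow> ('a \<Rightarrow> real) \<Rightarrow> bool" where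
  "C_smooth_on 0 S f \<longleftrightarrow> continuous_on S f"
| "C_smooth_on (Suc n) S f \<longleftrightarrow> (\<forall>x\<in>S. f differentiable (at x)) \<and>
     (\<forall>v. C_smooth_on n S (\<lambda>x. frechet_derivative f (at x) v))"

text \<open>
  \<open>nabla k f x p\<close> is \<open>\<nabla>\<^sup>k f(x)[p, \<dots>, p]\<close>, the \<open>k\<close>-th derivative of \<open>f\<close> at \<open>x\<close> evaluated at
  \<open>k\<close> copies of the direction \<open>p\<close>.
\<close>

primrec nabla :: "nat \<Rightarrow> ('a::euclidean_space \<Rightarrow> real) \<Rightarrow> 'a \<Rightarrow> 'a \<Rightarrow> real" where
  "nabla 0 f x p = f x"
| "nabla (Suc k) f x p = frechet_derivative (\<lambda>y. nabla k f y p) (at x) p"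

text \<open>Only the values of \<open>\<Gamma>\<close> on the interior of \<open>K\<close> matter.\<close>

definition LHSCB :: "real \<Rightarrow> 'a::euclidean_space set \<Rightarrow> ('a \<Rightarrow> real) \<Rightarrow> bool" where
  "LHSCB \<nu> K \<Gamma> \<longleftrightarrow>
     C_smooth_on 3 (interior K) \<Gamma> \<and>
     convex_on (interior K) \<Gamma> \<and>
     (\<forall>X b. (\<forall>i::nat. X i \<in> interior K) \<and> X \<longlonglongrightarrow> b \<and> b \<in> frontier K \<longrightarrow>
        filterlim (\<lambda>i. \<Gamma> (X i)) at_top sequentially) \<and>
     (\<forall>x\<in>interior K. \<forall>\<theta>>0. \<Gamma> (\<theta> *\<^sub>R x) = \<Gamma> x - \<nu> * ln \<theta>) \<and>
     (\<forall>x\<in>interior K. \<forall>p. \<bar>nabla 3 \<Gamma> x p\<bar> \<le> 2 * nabla 2 \<Gamma> x p powr (3 / 2))"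

end

theory Submission
  imports Defs
begin

text \<open>
Exponentials of multiplication operators carry the identity element to any point \<open>x\<close> of the open cone
and change \<open>log det\<close> only by a constant. On a line through \<open>x\<close> the determinant is therefore a product of \<open>d\<close> real
affine factors, and self-concordance becomes an inequality about \<open>d\<close> real numbers. The rest of the
argument builds the trace form and the determinant that this requires.

\<^bold>\<open>Spectral theory.\<close> Multiplication by \<open>x\<close> is self-adjoint for an associative inner product
\<open>T\<close>. If \<open>\<kappa>\<close> is the maximal Rayleigh quotient of \<open>x\<close> on a unital subalgebra with unit \<open>f\<close>, then
\<open>y = \<kappa> f - x\<close> acts as a positive operator, and the Jordan identity makes its kernel closed under
squaring; a maximizer of the cubic form \<open>T (u \<odot> u) u\<close> on the unit sphere of that kernel is, up to
scaling, an idempotent (\<open>eigen_idempotent\<close>). Splitting off such idempotents gives Jordan frames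
(\<open>spectral_decomposition_exists\<close>). Two primitive idempotents that are not orthogonal have the same
norm (\<open>nonorthogonal_primitives\<close>). Hence the vector \<open>\<Sum> c / T c c\<close>, summed over a frame, has inner
product \<open>1\<close> with every primitive idempotent and is central, so that it rescales \<open>T\<close> to an associative form in which all primitive idempotents
have norm \<open>1\<close>: the trace form (\<open>trace_form_exists\<close>).

\<^bold>\<open>Determinant and cone.\<close> In the trace form two frames \<open>C\<close>, \<open>D\<close> give a doubly stochastic matrix
\<open>T c d\<close>. This matrix shows that rank and determinant are well defined, and together with the
concavity of the logarithm it yields the key inequality \<open>logdet_le\<close>,
\[ \log\det y \le \log\det x + d \log (\langle x^{-1}, y\rangle / d). \]
Exchanging \<open>x\<close> and \<open>y\<close> identifies \<open>x\<^sup>-\<^sup>1\<close> as the gradient of \<open>log det\<close>; as \<open>x\<^sup>-\<^sup>1\<close> solves the linear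
equation \<open>x \<odot> u = e\<close>, smoothness follows. Taking exponentials shows that the cone is an intersection
of closed half-spaces (\<open>rtdet_cone_half_spaces\<close>), so it is closed and convex, and that the barrier
is convex.

\<^bold>\<open>Self-concordance.\<close> For a primitive idempotent \<open>c\<close>, the operator \<open>exp (\<theta> L(c))\<close>, where \<open>L(c)\<close> is
multiplication by \<open>c\<close>, preserves the open cone and adds \<open>\<theta>\<close> to \<open>log det\<close>, because along this flow
the derivative of \<open>log det\<close> is \<open>\<langle>y\<^sup>-\<^sup>1, c \<odot> y\<rangle> = tr c = 1\<close>. Products of such operators carry
\<open>e\<close> to any \<open>x\<close> of the open cone (\<open>transport_from_unit\<close>), so for small \<open>t\<close>
\[ \det (x + t p) = \det x \cdot \prod_i (1 + t \mu_i) \]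
with \<open>d\<close> real numbers \<open>\<mu>\<^sub>i\<close> (\<open>logdet_along_line\<close>): the determinant is hyperbolic. The barrier on a
line is then an explicit function of \<open>t\<close>. If \<open>a\<close> is the absolute logarithmic derivative of the gap
\<open>det\<^sup>1\<^sup>/\<^sup>d - u\<close>, if \<open>D\<^sup>2 = \<Sum> \<mu>\<^sub>i\<^sup>2\<close>, and if \<open>K\<close> is the contribution of the second derivative of
\<open>det\<^sup>1\<^sup>/\<^sup>d\<close>, then the second derivative of the barrier is \<open>N\<^sup>2 = a\<^sup>2 + D\<^sup>2 + K\<close> and the third is at most
\<open>2 a\<^sup>3 + 3 K (a + D) + 2 D\<^sup>3\<close>. With \<open>s = a + D\<close>, twice \<open>N\<^sup>3\<close> exceeds this bound by
\<open>(N - s)\<^sup>2 (2 N + s) \<ge> 0\<close> (\<open>compatible_sum_bound\<close>).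
\<close>

section \<open>Preliminaries\<close>

text \<open>
A nonnegative quadratic polynomial without constant term has no linear term: the first-order condition
at a minimum, used below in place of differentiation.
\<close>

lemma linear_coefficient_zero:
  fixes a b :: real
  assumes "\<And>t. 0 \<le> 2 * t * b + t^2 * a"
  shows "b = 0"
proof (rule ccontr)
  assume b: "b \<noteq> 0"
  define A where "A = 1 + \<bar>a\<bar>"
  have A: "A > 0" "a < A" by (auto simp: A_def)
  \<comment> \<open>The denominator \<open>1 + \<bar>a\<bar>\<close> makes the step so short that the linear term dominates.\<close>
  have "0 \<le> 2 * (- b / A) * b + (- b / A)^2 * a" by (rule assms)
  also have "\<dots> = (b^2 / A) * (a / A - 2)"
    using A by (simp add: field_simps power2_eq_square)
  finally have "0 \<le> (b^2 / A) * (a / A - 2)" .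
  moreover have "(b^2 / A) * (a / A - 2) < 0"
  proof (rule mult_pos_neg)
    show "b^2 / A > 0" using A b by simp
    have "a / A < 1" using A by (simp add: divide_less_eq)
    then show "a / A - 2 < 0" by simp
  qed
  ultimately show False by simp
qed

lemma subspace_sphere_compact:
  fixes U :: "'a::euclidean_space set"
  assumes "subspace U"
  shows "compact (U \<inter> sphere 0 1)"
  using closed_Int_compact[OF closed_subspace[OF assms] compact_sphere] .

lemma normalize_in_sphere:
  fixes U :: "'a::euclidean_space set"
  assumes "subspace U" "v \<in> U" "v \<noteq> 0"
  shows "(1 / norm v) *\<^sub>R v \<in> U \<inter> sphere 0 1"
  using assms by (auto intro: subspace_scale)

lemma filterlim_at_top_add_bounded_below:
  fixes f g :: "'b \<Rightarrow> real"
  assumes "filterlim f at_top F" "\<forall>\<^sub>F x in F. g x \<ge> M"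
  shows "filterlim (\<lambda>x. f x + g x) at_top F"
proof (rule filterlim_at_top_mono)
  show "filterlim (\<lambda>x. M + f x) at_top F"
    by (rule filterlim_tendsto_add_at_top[OF tendsto_const assms(1)])
  show "\<forall>\<^sub>F x in F. M + f x \<le> f x + g x" using assms(2) by eventually_elim simp
qed

section \<open>Peirce calculus for an idempotent\<close>

text \<open>
The inner product on a Euclidean Jordan algebra is only assumed to exist and need not be the trace form.
It is fixed here as \<open>T\<close>; the locale for the trace form adds its normalization later.
\<close>

locale associative_form = euclidean_jordan_algebra jprod e
  for jprod :: "'v::euclidean_space \<Rightarrow> 'v \<Rightarrow> 'v" (infixl "\<odot>" 70) and e :: 'v +
  fixes T :: "'v \<Rightarrow> 'v \<Rightarrow> real"
  assumes T_bilinear: "bilinear T"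
    and T_sym: "T a b = T b a"
    and T_pos: "a \<noteq> 0 \<Longrightarrow> T a a > 0"
    and T_assoc: "T (a \<odot> b) c = T b (a \<odot> c)"
begin

sublocale J: bounded_bilinear "(\<odot>)"
  using bilinear bilinear_conv_bounded_bilinear by blast

sublocale T: bounded_bilinear T
  using T_bilinear bilinear_conv_bounded_bilinear by blast

lemmas J_simps = J.add_left J.add_right J.diff_left J.diff_right J.minus_left J.minus_right
  J.scaleR_left J.scaleR_right J.zero_left J.zero_right
lemmas T_simps = T.add_left T.add_right T.diff_left T.diff_right T.minus_left T.minus_right
  T.scaleR_left T.scaleR_right T.zero_left T.zero_right

lemma unit_right: "x \<odot> e = x"
  using commute unit by metis

lemma T_nonneg: "T a a \<ge> 0"
  using T_pos[of a] by (cases "a = 0") (auto simp: T_simps)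

lemma T_eq_0_iff: "T a a = 0 \<longleftrightarrow> a = 0"
  using T_pos[of a] by (cases "a = 0") (auto simp: T_simps)

text \<open>
Polarization of the Jordan identity: the part of \<open>((x + t z) \<odot> (x + t z)) \<odot> ((x + t z) \<odot> y)\<close> that is linear in
\<open>t\<close> is half the difference of the values at \<open>t = 1\<close> and \<open>t = -1\<close>, minus the cubic part, which is the
Jordan identity for \<open>z\<close> itself.
\<close>

lemma jordan_linearized:
  "2 *\<^sub>R ((x \<odot> z) \<odot> (x \<odot> y)) + (x \<odot> x) \<odot> (z \<odot> y)
    = z \<odot> ((x \<odot> x) \<odot> y) + 2 *\<^sub>R (x \<odot> ((x \<odot> z) \<odot> y))"
proof (rule euclidean_eqI)
  fix b :: 'v
  note s = J_simps inner_simps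
  have c: "z \<odot> x = x \<odot> z" by (rule commute)
  have "(((x + z) \<odot> (x + z)) \<odot> ((x + z) \<odot> y)) \<bullet> b = ((x + z) \<odot> (((x + z) \<odot> (x + z)) \<odot> y)) \<bullet> b"
    "(((x - z) \<odot> (x - z)) \<odot> ((x - z) \<odot> y)) \<bullet> b = ((x - z) \<odot> (((x - z) \<odot> (x - z)) \<odot> y)) \<bullet> b"
    "((z \<odot> z) \<odot> (z \<odot> y)) \<bullet> b = (z \<odot> ((z \<odot> z) \<odot> y)) \<bullet> b"
    by (simp_all only: jordan)
  then show "(2 *\<^sub>R ((x \<odot> z) \<odot> (x \<odot> y)) + (x \<odot> x) \<odot> (z \<odot> y)) \<bullet> b
    = (z \<odot> ((x \<odot> x) \<odot> y) + 2 *\<^sub>R (x \<odot> ((x \<odot> z) \<odot> y))) \<bullet> b"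
    by (simp add: s c)
qed

lemma idempotent_linearized:
  assumes "c \<odot> c = c"
  shows "2 *\<^sub>R ((c \<odot> z) \<odot> (c \<odot> y)) + c \<odot> (z \<odot> y) = z \<odot> (c \<odot> y) + 2 *\<^sub>R (c \<odot> ((c \<odot> z) \<odot> y))"
  using jordan_linearized[of c z y] assms by simp

text \<open>
Multiplication by an idempotent is annihilated by \<open>X (2 X - 1) (X - 1)\<close>, so its eigenvalues are among
\<open>0\<close>, \<open>1/2\<close>, \<open>1\<close>. The identity is the linearized Jordan identity with \<open>y = c\<close>.
\<close>

lemma peirce_cubic:
  assumes "c \<odot> c = c"
  shows "2 *\<^sub>R (c \<odot> (c \<odot> (c \<odot> z))) = 3 *\<^sub>R (c \<odot> (c \<odot> z)) - c \<odot> z"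
proof (rule euclidean_eqI)
  fix b :: 'v
  have c: "v \<odot> c = c \<odot> v" for v by (rule commute)
  have "(2 *\<^sub>R ((c \<odot> z) \<odot> (c \<odot> c)) + c \<odot> (z \<odot> c)) \<bullet> b
    = (z \<odot> (c \<odot> c) + 2 *\<^sub>R (c \<odot> ((c \<odot> z) \<odot> c))) \<bullet> b"
    using idempotent_linearized[OF assms, of z c] by simp
  then show "2 *\<^sub>R (c \<odot> (c \<odot> (c \<odot> z))) \<bullet> b = (3 *\<^sub>R (c \<odot> (c \<odot> z)) - c \<odot> z) \<bullet> b"
    unfolding assms by (simp add: c inner_simps)
qed

text \<open>
The linearized Jordan identity becomes \<open>(1 - 2 \<alpha>) (c \<odot> (z \<odot> y) - \<beta> (z \<odot> y)) = 0\<close> on eigenvectors, so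
multiplication by an eigenvector for \<open>0\<close> or \<open>1\<close> preserves all eigenspaces of \<open>c\<close>. This single rule covers
every Peirce multiplication rule that the development uses.
\<close>

lemma peirce_mult:
  assumes c: "c \<odot> c = c" and z: "c \<odot> z = \<alpha> *\<^sub>R z" and y: "c \<odot> y = \<beta> *\<^sub>R y" and \<alpha>: "\<alpha> \<noteq> 1/2"
  shows "c \<odot> (z \<odot> y) = \<beta> *\<^sub>R (z \<odot> y)"
proof (rule euclidean_eqI)
  fix b :: 'v
  have "(2 *\<^sub>R ((c \<odot> z) \<odot> (c \<odot> y)) + c \<odot> (z \<odot> y)) \<bullet> b
    = (z \<odot> (c \<odot> y) + 2 *\<^sub>R (c \<odot> ((c \<odot> z) \<odot> y))) \<bullet> b"
    using idempotent_linearized[OF c, of z y] by simp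
  then have "(1 - 2 * \<alpha>) * ((c \<odot> (z \<odot> y)) \<bullet> b - \<beta> * ((z \<odot> y) \<bullet> b)) = 0"
    unfolding z y by (simp add: J_simps inner_simps algebra_simps)
  then show "(c \<odot> (z \<odot> y)) \<bullet> b = (\<beta> *\<^sub>R (z \<odot> y)) \<bullet> b"
    using \<alpha> by simp
qed

lemma peirce_orthogonal:
  assumes c: "c \<odot> c = c" and z: "c \<odot> z = z" and y: "c \<odot> y = 0"
  shows "z \<odot> y = 0"
proof -
  have "c \<odot> (z \<odot> y) = 0 *\<^sub>R (z \<odot> y)" "c \<odot> (y \<odot> z) = 1 *\<^sub>R (y \<odot> z)"
    using peirce_mult[OF c, of z 1 y 0] peirce_mult[OF c, of y 0 z 1] z y by auto
  then show ?thesis by (simp add: commute)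
qed

lemma orthogonal_idempotents_commute:
  assumes "c \<odot> c = c" "c \<odot> c' = 0"
  shows "c \<odot> (c' \<odot> y) = c' \<odot> (c \<odot> y)"
  using idempotent_linearized[OF assms(1), of c' y] assms(2) by (simp add: J_simps)

text \<open>
Modulo the cubic relation, multiplication \<open>L\<close> by an idempotent equals the sum of squares
\<open>L\<^sup>2 + 4 (L - L\<^sup>2)\<^sup>2\<close> of self-adjoint operators: both sides agree at \<open>0\<close>, \<open>1/2\<close> and \<open>1\<close>.
\<close>

lemma idempotent_operator_nonneg:
  assumes c: "c \<odot> c = c"
  shows "T (c \<odot> v) v \<ge> 0"
proof -
  let ?a = "c \<odot> v" let ?b = "c \<odot> ?a" let ?c = "c \<odot> ?b"
  have "T (2 *\<^sub>R ?c) w = T (3 *\<^sub>R ?b - ?a) w" for w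
    using peirce_cubic[OF c, of v] by simp
  then have cub: "2 * T ?c w = 3 * T ?b w - T ?a w" for w
    by (simp add: T_simps)
  have m: "T (c \<odot> x) y = T x (c \<odot> y)" for x y by (rule T_assoc)
  have 1: "T ?a ?a = T ?b v" "T ?a ?b = T ?c v" "T ?b ?a = T ?c v" "T ?b ?b = T ?c ?a"
    using m T_sym by metis+
  have "T ?a v = T ?a ?a + 4 * T (?a - ?b) (?a - ?b)"
    using cub[of v] cub[of ?a] unfolding T_simps 1 by (simp add: 1)
  then show ?thesis using T_nonneg[of ?a] T_nonneg[of "?a - ?b"] by simp
qed

section \<open>Spectral decompositions\<close>

text \<open>
The unit \<open>f\<close> is that of the subalgebra and usually differs from \<open>e\<close>: the Peirce eigenspaces of an
idempotent for \<open>1\<close> and \<open>0\<close> are the instances.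
\<close>

definition unital_subalgebra :: "'v set \<Rightarrow> 'v \<Rightarrow> bool" where
  "unital_subalgebra W f \<longleftrightarrow> subspace W \<and> (\<forall>a\<in>W. \<forall>b\<in>W. a \<odot> b \<in> W) \<and> f \<in> W \<and> (\<forall>a\<in>W. f \<odot> a = a)"

lemma peirce_subalgebra_1:
  assumes "c \<odot> c = c"
  shows "unital_subalgebra {v. c \<odot> v = v} c"
  unfolding unital_subalgebra_def
proof (intro conjI)
  show "subspace {v. c \<odot> v = v}"
    by (auto simp: subspace_def J_simps)
  show "\<forall>a\<in>{v. c \<odot> v = v}. \<forall>b\<in>{v. c \<odot> v = v}. a \<odot> b \<in> {v. c \<odot> v = v}"
    using peirce_mult[OF assms, of _ 1 _ 1] by auto
qed (use assms in auto)

lemma peirce_subalgebra_0: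
  assumes "c \<odot> c = c"
  shows "unital_subalgebra {v. c \<odot> v = 0} (e - c)"
  unfolding unital_subalgebra_def
proof (intro conjI)
  show "subspace {v. c \<odot> v = 0}"
    by (auto simp: subspace_def J_simps)
  show "\<forall>a\<in>{v. c \<odot> v = 0}. \<forall>b\<in>{v. c \<odot> v = 0}. a \<odot> b \<in> {v. c \<odot> v = 0}"
    using peirce_mult[OF assms, of _ 0 _ 0] by auto
qed (use assms in \<open>auto simp: J_simps unit unit_right\<close>)

text \<open>
For a positive self-adjoint operator the vanishing of the quadratic form at \<open>v\<close> makes \<open>v\<close> a minimizer of
the form, and the first-order condition there says that \<open>y \<odot> v\<close> is orthogonal to the subspace containing it.
\<close>

lemma positive_operator_kernel:
  assumes W: "subspace W" "\<And>v. v \<in> W \<Longrightarrow> y \<odot> v \<in> W"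
    and pos: "\<And>v. v \<in> W \<Longrightarrow> T (y \<odot> v) v \<ge> 0"
    and v: "v \<in> W" "T (y \<odot> v) v = 0"
  shows "y \<odot> v = 0"
proof -
  have "T (y \<odot> v) w = 0" if w: "w \<in> W" for w
  proof (rule linear_coefficient_zero[of _ "T (y \<odot> w) w"])
    fix t :: real
    have "T (y \<odot> w) v = T (y \<odot> v) w" using T_assoc T_sym by metis
    moreover have "0 \<le> T (y \<odot> (v + t *\<^sub>R w)) (v + t *\<^sub>R w)"
      by (intro pos subspace_add subspace_scale W v w)
    ultimately show "0 \<le> 2 * t * T (y \<odot> v) w + t^2 * T (y \<odot> w) w"
      using v by (simp add: J_simps T_simps algebra_simps power2_eq_square)
  qed
  from this[OF W(2)[OF v(1)]] show ?thesis by (simp add: T_eq_0_iff)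
qed

lemma rayleigh_maximum:
  assumes W: "subspace W" and u: "u \<in> W" "u \<noteq> 0"
  obtains \<kappa> v where "v \<in> W" "v \<noteq> 0" "T (x \<odot> v) v = \<kappa> * T v v"
    "\<And>w. w \<in> W \<Longrightarrow> T (x \<odot> w) w \<le> \<kappa> * T w w"
proof -
  let ?S = "W \<inter> sphere 0 1"
  let ?r = "\<lambda>v. T (x \<odot> v) v / T v v"
  have "continuous_on ?S ?r"
    by (intro continuous_intros J.continuous_on T.continuous_on)
      (auto simp: T_eq_0_iff)
  moreover have "?S \<noteq> {}" using normalize_in_sphere[OF W u] by auto
  ultimately obtain v where v: "v \<in> ?S" "\<And>w. w \<in> ?S \<Longrightarrow> ?r w \<le> ?r v"
    using continuous_attains_sup[OF subspace_sphere_compact[OF W]] by blast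
  have v0: "v \<noteq> 0" using v by auto
  show ?thesis
  proof (rule that[of v "?r v"])
    show "T (x \<odot> v) v = ?r v * T v v" using v0 by (simp add: T_eq_0_iff)
    show "T (x \<odot> w) w \<le> ?r v * T w w" if w: "w \<in> W" for w
    proof (cases "w = 0")
      case False
      have "?r ((1 / norm w) *\<^sub>R w) \<le> ?r v"
        by (rule v(2)[OF normalize_in_sphere[OF W w False]])
      then have "?r w \<le> ?r v" using False by (simp add: J_simps T_simps)
      then show ?thesis using T_pos[OF False] by (simp add: divide_le_eq)
    qed (simp add: T_simps)
  qed (use v v0 in auto)
qed

text \<open>
At a maximizer \<open>u\<close> of \<open>T (v \<odot> v) v\<close> on the unit sphere of \<open>T\<close>, the Lagrange condition says that \<open>u \<odot> u\<close> is a multiple of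
\<open>u\<close>, since the gradient of the cubic form is \<open>3 (u \<odot> u)\<close> and lies in the subspace. The factor is
nonzero because \<open>T (u \<odot> u) e = T u u\<close>, so dividing by it gives an idempotent.
\<close>

lemma idempotent_in_square_closed_subspace:
  assumes U: "subspace U" and sq: "\<And>u. u \<in> U \<Longrightarrow> u \<odot> u \<in> U" and u0: "u0 \<in> U" "u0 \<noteq> 0"
  obtains c where "c \<in> U" "c \<noteq> 0" "c \<odot> c = c"
proof -
  let ?S = "U \<inter> sphere 0 1"
  let ?n = "\<lambda>v. sqrt (T v v)"
  let ?r = "\<lambda>v. T (v \<odot> v) v / ?n v ^ 3"
  have "continuous_on ?S ?r"
    by (intro continuous_intros J.continuous_on T.continuous_on)
      (auto simp: T_eq_0_iff)
  moreover have "?S \<noteq> {}" using normalize_in_sphere[OF U u0] by auto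
  ultimately obtain u where u: "u \<in> ?S" "\<And>w. w \<in> ?S \<Longrightarrow> ?r w \<le> ?r u"
    using continuous_attains_sup[OF subspace_sphere_compact[OF U]] by blast
  have uU: "u \<in> U" "u \<noteq> 0" using u by auto
  define \<mu> where "\<mu> = ?r u"
  have le: "T (w \<odot> w) w \<le> \<mu> * ?n w ^ 3" if w: "w \<in> U" for w
  proof (cases "w = 0")
    case False
    have "?r ((1 / norm w) *\<^sub>R w) \<le> \<mu>"
      unfolding \<mu>_def by (rule u(2)[OF normalize_in_sphere[OF U w False]])
    moreover have "?r ((1 / norm w) *\<^sub>R w) = ?r w"
      using False by (simp add: J_simps T_simps real_sqrt_mult real_sqrt_divide field_simps power3_eq_cube)
    ultimately show ?thesis using T_pos[OF False] by (simp add: divide_le_eq)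
  qed (simp add: T_simps)
  have crit: "T (u \<odot> u) v = \<mu> * ?n u * T u v" if v: "v \<in> U" for v
  proof -
    define h where "h t = \<mu> * ?n (u + t *\<^sub>R v) ^ 3 - T ((u + t *\<^sub>R v) \<odot> (u + t *\<^sub>R v)) (u + t *\<^sub>R v)" for t
    have n0: "T u u > 0" using T_pos uU by auto
    have uv: "T (u \<odot> v) u = T (u \<odot> u) v" "T (v \<odot> u) u = T (u \<odot> u) v" "T v u = T u v"
      "v \<odot> u = u \<odot> v"
      using T_assoc T_sym commute by metis+
    have h_eq: "h = (\<lambda>t. \<mu> * sqrt (T u u + 2 * t * T u v + t^2 * T v v) ^ 3
        - (T (u \<odot> u) u + 3 * t * T (u \<odot> u) v + t^2 * (2 * T (u \<odot> v) v + T (v \<odot> v) u) + t^3 * T (v \<odot> v) v))"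
      unfolding h_def
      by (rule ext) (simp add: J_simps T_simps uv algebra_simps power2_eq_square power3_eq_cube)
    have der: "(h has_real_derivative (\<mu> * (3 * (sqrt (T u u))\<^sup>2 * (2 * T u v * (inverse (sqrt (T u u)) / 2)))
        - 3 * T (u \<odot> u) v)) (at 0)"
      unfolding h_eq
      by (rule derivative_eq_intros refl | use n0 in simp)+
    have min: "h 0 \<le> h t" for t
    proof -
      have "h 0 = 0" using n0 by (simp add: h_def \<mu>_def)
      moreover have "h t \<ge> 0"
        unfolding h_def using le[of "u + t *\<^sub>R v"] by (simp add: U subspace_add subspace_scale uU v)
      ultimately show ?thesis by simp
    qed
    have "\<mu> * (3 * (sqrt (T u u))\<^sup>2 * (2 * T u v * (inverse (sqrt (T u u)) / 2))) - 3 * T (u \<odot> u) v = 0"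
      by (rule DERIV_local_min[OF der zero_less_one]) (use min in blast)
    moreover have "(sqrt (T u u))\<^sup>2 * inverse (sqrt (T u u)) = ?n u"
      using n0 unfolding power2_eq_square mult.assoc by (subst right_inverse) auto
    ultimately show ?thesis by (simp add: algebra_simps)
  qed
  define k where "k = \<mu> * ?n u"
  have "u \<odot> u - k *\<^sub>R u \<in> U" by (simp add: U subspace_diff subspace_scale sq uU)
  from crit[OF this] have "T (u \<odot> u - k *\<^sub>R u) (u \<odot> u - k *\<^sub>R u) = 0"
    by (simp add: T.diff_left T.scaleR_left k_def)
  then have uu: "u \<odot> u = k *\<^sub>R u" by (simp add: T_eq_0_iff)
  have "T (u \<odot> u) e = T u u" using T_assoc unit_right by metis
  then have "k \<noteq> 0" using uu T_pos[of u] uU by (auto simp: T_simps)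
  then show ?thesis
    using uu uU by (intro that[of "(1 / k) *\<^sub>R u"]) (auto simp: J_simps U subspace_scale)
qed

text \<open>
The spectral theorem needs only one idempotent on which \<open>x\<close> acts as a scalar. It is found in the
eigenspace of the largest eigenvalue \<open>\<kappa>\<close> of multiplication by \<open>x\<close>, that is in the kernel of
multiplication by \<open>y = \<kappa> f - x\<close>; smaller eigenspaces of this operator need not be closed under squaring.
\<close>

lemma eigen_idempotent:
  assumes W: "unital_subalgebra W f" and f: "f \<noteq> 0" and x: "x \<in> W"
  obtains \<kappa> c where "c \<in> W" "c \<noteq> 0" "c \<odot> c = c" "x \<odot> c = \<kappa> *\<^sub>R c"
proof -
  have W': "subspace W" "\<And>a b. a \<in> W \<Longrightarrow> b \<in> W \<Longrightarrow> a \<odot> b \<in> W" "f \<in> W" "\<And>a. a \<in> W \<Longrightarrow> f \<odot> a = a"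
    using W by (auto simp: unital_subalgebra_def)
  obtain \<kappa> v where v: "v \<in> W" "v \<noteq> 0" "T (x \<odot> v) v = \<kappa> * T v v"
    "\<And>w. w \<in> W \<Longrightarrow> T (x \<odot> w) w \<le> \<kappa> * T w w"
    using rayleigh_maximum[OF W'(1) W'(3) f] by metis
  define y where "y = \<kappa> *\<^sub>R f - x"
  have yW: "y \<in> W" by (simp add: y_def W' subspace_diff subspace_scale x)
  have y_mult: "y \<odot> w = \<kappa> *\<^sub>R w - x \<odot> w" if "w \<in> W" for w
    using that by (simp add: y_def J_simps W')
  have ker: "y \<odot> w = 0" if "w \<in> W" "T (y \<odot> w) w = 0" for w
  proof (rule positive_operator_kernel[OF W'(1) _ _ that])
    show "y \<odot> v \<in> W" if "v \<in> W" for v using W'(2) yW that by blast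
    show "T (y \<odot> v) v \<ge> 0" if "v \<in> W" for v using v(4)[OF that] by (simp add: y_mult that T_simps)
  qed
  define U where "U = {u \<in> W. y \<odot> u = 0}"
  have "subspace U"
    using W'(1) by (auto simp: U_def subspace_def J_simps)
  moreover have "u \<odot> u \<in> U" if u: "u \<in> U" for u
  proof -
    \<comment> \<open>The Jordan identity gives \<open>u\<^sup>2 \<odot> u\<^sup>2 = u \<odot> (u\<^sup>2 \<odot> u)\<close>, so a factor \<open>u\<close> can be moved onto \<open>y\<close>.\<close>
    have "T (y \<odot> (u \<odot> u)) (u \<odot> u) = T y ((u \<odot> u) \<odot> (u \<odot> u))"
      using T_assoc commute by metis
    also have "\<dots> = T y (u \<odot> ((u \<odot> u) \<odot> u))" by (simp add: jordan)
    also have "\<dots> = T (y \<odot> u) ((u \<odot> u) \<odot> u)" using T_assoc commute by metis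
    finally have "T (y \<odot> (u \<odot> u)) (u \<odot> u) = 0" using u by (simp add: U_def T_simps)
    then show ?thesis using ker[of "u \<odot> u"] u W'(2) by (auto simp: U_def)
  qed
  moreover have "v \<in> U"
    using v ker[of v] by (auto simp: U_def y_mult T_simps)
  ultimately obtain c where c: "c \<in> U" "c \<noteq> 0" "c \<odot> c = c"
    using idempotent_in_square_closed_subspace v(2) by metis
  then show ?thesis using y_mult[of c] by (intro that[of c \<kappa>]) (auto simp: U_def)
qed

text \<open>
A frame under construction: the sum of the members need not be \<open>e\<close> and the members need not be
primitive. Both follow once the number of members is maximal.
\<close>

definition eigen_system :: "'v \<Rightarrow> 'v set \<Rightarrow> bool" where
  "eigen_system x C \<longleftrightarrow> finite C \<and> (\<forall>c\<in>C. c \<noteq> 0 \<and> c \<odot> c = c \<and> (\<exists>l. x \<odot> c = l *\<^sub>R c)) \<and>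
     (\<forall>a\<in>C. \<forall>b\<in>C. a \<noteq> b \<longrightarrow> a \<odot> b = 0)"

lemma orthogonal_sum_mult:
  assumes "finite C" "\<And>a. a \<in> C \<Longrightarrow> a \<odot> a = a" "\<And>a b. a \<in> C \<Longrightarrow> b \<in> C \<Longrightarrow> a \<noteq> b \<Longrightarrow> a \<odot> b = 0"
    and "c \<in> C"
  shows "(\<Sum>a\<in>C. l a *\<^sub>R a) \<odot> c = l c *\<^sub>R c"
proof -
  have "(\<Sum>a\<in>C. l a *\<^sub>R a) \<odot> c = (\<Sum>a\<in>C. if a = c then l c *\<^sub>R c else 0)"
    unfolding J.sum_left by (intro sum.cong) (auto simp: J_simps assms)
  then show ?thesis using assms by simp
qed

text \<open>
Multiplying a linear relation by one member kills all other terms, so the members are linearly independent.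
\<close>

lemma eigen_system_card: "eigen_system x C \<Longrightarrow> card C \<le> DIM('v)"
proof -
  assume C: "eigen_system x C"
  have "independent C"
    unfolding dependent_finite[OF C[unfolded eigen_system_def, THEN conjunct1]]
  proof clarify
    fix u v assume u: "v \<in> C" "u v \<noteq> 0" "(\<Sum>v\<in>C. u v *\<^sub>R v) = 0"
    have "(\<Sum>v\<in>C. u v *\<^sub>R v) \<odot> v = u v *\<^sub>R v"
      using C u by (intro orthogonal_sum_mult) (auto simp: eigen_system_def)
    then show False using u C by (auto simp: eigen_system_def J_simps)
  qed
  then show ?thesis using independent_bound by blast
qed

text \<open>
Take an eigen-system of maximal size. If its sum \<open>s\<close> were not \<open>e\<close>, then \<open>eigen_idempotent\<close>, applied in the
subalgebra annihilated by \<open>s\<close>, would yield a further member; if some member were a sum of two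
idempotents, it could be replaced by these two.
\<close>

lemma spectral_decomposition_exists:
  obtains C l where "spectral_decomposition x C l"
proof -
  have "eigen_system x {}" by (simp add: eigen_system_def)
  then obtain C where C: "eigen_system x C" and max: "\<And>C'. eigen_system x C' \<Longrightarrow> card C' \<le> card C"
    using ex_has_greatest_nat[of "eigen_system x" "{}" card "Suc DIM('v)"]
      eigen_system_card by (metis less_Suc_eq_le)
  have fin: "finite C" and idem: "\<And>c. c \<in> C \<Longrightarrow> c \<odot> c = c" and nz: "\<And>c. c \<in> C \<Longrightarrow> c \<noteq> 0"
    and orth: "\<And>a b. a \<in> C \<Longrightarrow> b \<in> C \<Longrightarrow> a \<noteq> b \<Longrightarrow> a \<odot> b = 0"
    using C by (auto simp: eigen_system_def)
  obtain l where l: "\<And>c. c \<in> C \<Longrightarrow> x \<odot> c = l c *\<^sub>R c"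
    using C unfolding eigen_system_def by metis
  define s where "s = \<Sum>C"
  have s1: "s \<odot> c = c" if "c \<in> C" for c
    using orthogonal_sum_mult[OF fin idem orth that, of "\<lambda>_. 1"] by (simp add: s_def)
  have ss: "s \<odot> s = s"
  proof -
    have "s \<odot> \<Sum>C = \<Sum>C" by (simp add: J.sum_right s1)
    then show ?thesis by (simp add: s_def)
  qed
  have s_e: "s = e"
  proof (rule ccontr)
    assume ne: "s \<noteq> e"
    let ?y = "\<Sum>c\<in>C. l c *\<^sub>R c"
    have sx: "s \<odot> x = ?y"
      unfolding s_def J.sum_left by (intro sum.cong) (auto simp: commute[of _ x] l)
    have "s \<odot> ?y = ?y"
      by (simp add: J.sum_right J_simps s1)
    then have xW: "x - ?y \<in> {v. s \<odot> v = 0}"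
      by (simp add: J_simps sx)
    have es: "e - s \<noteq> 0" using ne by simp
    obtain \<kappa> d where d: "s \<odot> d = 0" "d \<noteq> 0" "d \<odot> d = d" "(x - ?y) \<odot> d = \<kappa> *\<^sub>R d"
      by (rule eigen_idempotent[OF peirce_subalgebra_0[OF ss] es xW]) blast
    have cd: "c \<odot> d = 0" if "c \<in> C" for c
      using peirce_orthogonal[OF ss s1[OF that] d(1)] .
    then have dc: "d \<odot> c = 0" if "c \<in> C" for c
      using that by (simp only: commute[of d])
    have "?y \<odot> d = 0" by (simp add: J.sum_left J_simps cd)
    then have xd: "x \<odot> d = \<kappa> *\<^sub>R d" using d(4) by (simp add: J_simps)
    have "d \<notin> C" using cd d by auto
    moreover have "eigen_system x (insert d C)"
      using C d xd cd dc by (auto simp: eigen_system_def)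
    ultimately show False using max[of "insert d C"] fin by simp
  qed
  have x_eq: "x = (\<Sum>c\<in>C. l c *\<^sub>R c)"
  proof -
    have "x \<odot> s = (\<Sum>c\<in>C. l c *\<^sub>R c)" by (simp add: s_def J.sum_right l)
    then show ?thesis by (simp add: s_e unit_right)
  qed
  have prim: "primitive_idempotent c" if c: "c \<in> C" for c
  proof (rule ccontr)
    assume "\<not> primitive_idempotent c"
    then obtain a b where ab: "a \<odot> a = a" "b \<odot> b = b" "a \<noteq> 0" "b \<noteq> 0" "c = a + b"
      using idem[OF c] nz[OF c] by (auto simp: primitive_idempotent_def idempotent_def)
    have "(a + b) \<odot> (a + b) = a + b" using idem[OF c] ab by simp
    then have "2 *\<^sub>R (a \<odot> b) = 0"
      using ab by (simp add: J_simps commute[of b a] scaleR_2)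
    \<comment> \<open>Idempotency of the sum forces the two summands to be orthogonal.\<close>
    then have ab0: "a \<odot> b = 0" "b \<odot> a = 0" by (simp_all add: commute[of b a])
    have ca: "c \<odot> a = a" "c \<odot> b = b" using ab ab0 by (simp_all add: J_simps)
    have o: "a \<odot> c' = 0" "b \<odot> c' = 0" "c' \<odot> a = 0" "c' \<odot> b = 0" if "c' \<in> C" "c' \<noteq> c" for c'
    proof -
      have "c \<odot> c' = 0" using orth[OF c that(1)] that(2) by simp
      then show "a \<odot> c' = 0" "b \<odot> c' = 0"
        using peirce_orthogonal[OF idem[OF c]] ca by blast+
      then show "c' \<odot> a = 0" "c' \<odot> b = 0" by (simp_all only: commute[of c'])
    qed
    have xa: "x \<odot> w = l c *\<^sub>R w" if w: "w = a \<or> w = b" for w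
    proof -
      have "x \<odot> w = (\<Sum>c'\<in>C. if c' = c then l c *\<^sub>R w else 0)"
        by (subst x_eq, unfold J.sum_left, intro sum.cong)
          (use w ca o in \<open>auto simp: J_simps\<close>)
      then show ?thesis using c fin by simp
    qed
    let ?C = "insert a (insert b (C - {c}))"
    have "eigen_system x ?C"
      unfolding eigen_system_def
    proof (intro conjI ballI impI)
      show "finite ?C" using fin by simp
      fix p assume p: "p \<in> ?C"
      show "p \<noteq> 0" using p ab nz by auto
      show "p \<odot> p = p" using p ab idem by auto
      show "\<exists>l. x \<odot> p = l *\<^sub>R p" using p xa l by auto
      fix q assume q: "q \<in> ?C" "p \<noteq> q"
      show "p \<odot> q = 0" using p q orth o ab0 by auto
    qed
    moreover have "a \<noteq> b" using ab ab0 by auto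
    moreover have "a \<notin> C - {c}" "b \<notin> C - {c}" using ab o by force+
    ultimately have "card ?C = Suc (Suc (card C - 1))" using fin c by simp
    moreover have "card C > 0" using c fin by (auto simp: card_gt_0_iff)
    ultimately show False using max[OF \<open>eigen_system x ?C\<close>] by simp
  qed
  show ?thesis
    using that[of C l] prim fin orth s_e x_eq
    by (auto simp: spectral_decomposition_def jordan_frame_def s_def)
qed

section \<open>The trace form\<close>

text \<open>
The Peirce \<open>1\<close>-space of a primitive idempotent is a line: an idempotent in this subalgebra on which \<open>v\<close>
acts as a scalar must be \<open>c\<close> itself.
\<close>

lemma primitive_line:
  assumes c: "primitive_idempotent c" and v: "c \<odot> v = v"
  obtains r where "v = r *\<^sub>R c"
proof -
  have cc: "c \<odot> c = c" "c \<noteq> 0" using c by (auto simp: primitive_idempotent_def idempotent_def)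
  obtain \<kappa> d where d: "c \<odot> d = d" "d \<noteq> 0" "d \<odot> d = d" "v \<odot> d = \<kappa> *\<^sub>R d"
    by (rule eigen_idempotent[OF peirce_subalgebra_1[OF cc(1)] cc(2), of v]) (use v in auto)
  have "(c - d) \<odot> (c - d) = c - d" using d cc by (simp add: J_simps commute[of d c])
  then have "c - d = 0"
    using c d unfolding primitive_idempotent_def idempotent_def
    by (metis add.commute diff_add_cancel)
  then have "c = d" by simp
  then have "v = \<kappa> *\<^sub>R c" using d(4) v commute[of c v] by simp
  then show ?thesis by (rule that)
qed

text \<open>
\<open>2 L(c)\<^sup>2 - L(c)\<close> takes the values \<open>0\<close>, \<open>0\<close>, \<open>1\<close> at the eigenvalues \<open>0\<close>, \<open>1/2\<close>, \<open>1\<close> of \<open>L(c)\<close>, so it is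
the projection onto the Peirce \<open>1\<close>-space.
\<close>

definition peirce_projection :: "'v \<Rightarrow> 'v \<Rightarrow> 'v" where
  "peirce_projection c v = 2 *\<^sub>R (c \<odot> (c \<odot> v)) - c \<odot> v"

text \<open>
Let \<open>P\<^sub>b\<close>, \<open>P\<^sub>c\<close> be the projections onto the lines through \<open>b\<close> and \<open>c\<close>, with \<open>P\<^sub>c b = \<alpha> c\<close> and
\<open>P\<^sub>b c = \<beta> b\<close>. Since \<open>\<alpha> T c c = T b c = \<beta> T b b\<close>, it suffices that \<open>\<alpha> = \<beta>\<close>. This follows from
\<open>P\<^sub>c P\<^sub>b c = \<alpha>\<^sup>2 c\<close>, an instance of \<open>(P(c) b)\<^sup>2 = P(c) P(b) c\<^sup>2\<close>, proved here by comparing Peirce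
components of \<open>b \<odot> b = b\<close>.
\<close>

lemma nonorthogonal_primitives:
  assumes b: "primitive_idempotent b" and c: "primitive_idempotent c" and bc: "T b c \<noteq> 0"
  shows "T b b = T c c"
proof -
  let ?P = peirce_projection
  have bb: "b \<odot> b = b" and cc: "c \<odot> c = c" "c \<noteq> 0"
    using b c by (auto simp: primitive_idempotent_def idempotent_def)
  have line: "\<exists>r. ?P p v = r *\<^sub>R p \<and> r * T p p = T v p" if p: "primitive_idempotent p" for p v
  proof -
    have pp: "p \<odot> p = p" using p by (auto simp: primitive_idempotent_def idempotent_def)
    have "p \<odot> ?P p v = ?P p v"
      by (rule euclidean_eqI)
        (simp add: peirce_projection_def J_simps peirce_cubic[OF pp, of v] inner_simps)
    then obtain r where r: "?P p v = r *\<^sub>R p" using primitive_line[OF p] by metis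
    have "T (?P p v) p = T v p"
      by (simp add: peirce_projection_def T_simps T_assoc pp)
    then show ?thesis using r by (auto simp: T_simps)
  qed
  obtain \<alpha> where \<alpha>: "?P c b = \<alpha> *\<^sub>R c" "\<alpha> * T c c = T b c" using line[OF c] by blast
  obtain \<beta> where \<beta>: "?P b c = \<beta> *\<^sub>R b" "\<beta> * T b b = T b c" using line[OF b] T_sym by metis
  \<comment> \<open>The Peirce components of \<open>b\<close> with respect to \<open>c\<close>, for the eigenvalues \<open>1\<close>, \<open>1/2\<close>, \<open>0\<close>.\<close>
  define b1 where "b1 = \<alpha> *\<^sub>R c"
  define bh where "bh = 4 *\<^sub>R (c \<odot> b - c \<odot> (c \<odot> b))"
  define b0 where "b0 = b - b1 - bh"
  have b1': "b1 = 2 *\<^sub>R (c \<odot> (c \<odot> b)) - c \<odot> b" using \<alpha> by (simp add: b1_def peirce_projection_def)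
  have P1: "?P c v = v" if "c \<odot> v = v" for v
    using that by (simp add: peirce_projection_def scaleR_2)
  have Ph: "?P c v = 0" if "c \<odot> v = (1/2) *\<^sub>R v" for v
    using that by (simp add: peirce_projection_def J_simps)
  have P0: "?P c v = 0" if "c \<odot> v = 0" for v
    using that by (simp add: peirce_projection_def J_simps)
  have Padd: "?P c (v + w) = ?P c v + ?P c w" for v w
    by (simp add: peirce_projection_def J_simps algebra_simps)
  have Pscale: "?P c (r *\<^sub>R v) = r *\<^sub>R ?P c v" for r v
    by (simp add: peirce_projection_def J_simps algebra_simps)
  have c1: "c \<odot> b1 = 1 *\<^sub>R b1" by (simp add: b1_def J_simps cc)
  have cub: "c \<odot> (c \<odot> (c \<odot> b)) = (3/2) *\<^sub>R (c \<odot> (c \<odot> b)) - (1/2) *\<^sub>R (c \<odot> b)"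
    using arg_cong[OF peirce_cubic[OF cc(1), of b], of "\<lambda>v. (1/2) *\<^sub>R v"]
    by (simp add: algebra_simps)
  have ch: "c \<odot> bh = (1/2) *\<^sub>R bh"
    by (rule euclidean_eqI) (simp add: bh_def J_simps cub inner_simps algebra_simps)
  have "c \<odot> b0 = c \<odot> b - b1 - (1/2) *\<^sub>R bh"
    using c1 ch by (simp add: b0_def J_simps)
  also have "\<dots> = 0"
    by (rule euclidean_eqI) (simp add: bh_def b1' inner_simps algebra_simps)
  finally have c0: "c \<odot> b0 = 0 *\<^sub>R b0" by simp
  have b_eq: "b = b1 + bh + b0" by (simp add: b0_def)
  define w where "w = ?P c (bh \<odot> bh)"
  have p11: "?P c (b1 \<odot> b1) = \<alpha> *\<^sub>R b1"
    by (simp add: b1_def J_simps cc Pscale P1)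
  have p1: "?P c b1 = b1" using c1 by (intro P1) simp
  have ph: "?P c bh = 0" using ch by (rule Ph)
  have p0: "?P c b0 = 0" using c0 by (intro P0) simp
  have p1h: "?P c (b1 \<odot> bh) = 0" "?P c (bh \<odot> b1) = 0"
    using Ph[OF peirce_mult[OF cc(1) c1 ch]] by (simp_all add: commute[of bh b1])
  have p10: "?P c (b1 \<odot> b0) = 0" "?P c (b0 \<odot> b1) = 0"
    using P0 peirce_mult[OF cc(1) c1 c0] by (simp_all add: commute[of b0 b1])
  have p0h: "?P c (b0 \<odot> bh) = 0" "?P c (bh \<odot> b0) = 0"
    using Ph[OF peirce_mult[OF cc(1) c0 ch]] by (simp_all add: commute[of bh b0])
  have p00: "?P c (b0 \<odot> b0) = 0"
    using P0 peirce_mult[OF cc(1) c0 c0] by simp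
  \<comment> \<open>The unknown contribution \<open>w\<close> of \<open>bh \<odot> bh\<close> is determined by idempotency of \<open>b\<close>.\<close>
  have "?P c b = ?P c (b \<odot> b)" by (simp add: bb)
  also have "\<dots> = \<alpha> *\<^sub>R b1 + w"
    unfolding w_def by (subst (1 2) b_eq) (simp add: J_simps Padd p11 p1h p10 p0h p00)
  finally have "?P c b = \<alpha> *\<^sub>R b1 + w" .
  moreover have "?P c b = b1" by (simp only: \<alpha>(1) b1_def)
  ultimately have w: "w = b1 - \<alpha> *\<^sub>R b1" by (metis add_diff_cancel_left')
  have cb: "c \<odot> b = b1 + (1/2) *\<^sub>R bh"
    by (subst b_eq) (use c1 ch c0 in \<open>simp add: J_simps\<close>)
  have half: "?P c (b \<odot> (b1 + (1/2) *\<^sub>R bh)) = \<alpha> *\<^sub>R b1 + (1/2) *\<^sub>R w"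
    unfolding w_def by (subst b_eq) (simp add: J_simps Padd Pscale p11 p1h p10 p0h p00)
  have "?P c (?P b c) = 2 *\<^sub>R ?P c (b \<odot> (b1 + (1/2) *\<^sub>R bh)) - ?P c (b1 + (1/2) *\<^sub>R bh)"
    unfolding peirce_projection_def[of b] commute[of b c] cb
    by (simp add: peirce_projection_def J_simps algebra_simps)
  also have "\<dots> = 2 *\<^sub>R (\<alpha> *\<^sub>R b1 + (1/2) *\<^sub>R (b1 - \<alpha> *\<^sub>R b1)) - b1"
    unfolding half w by (simp add: Padd Pscale p1 ph)
  also have "\<dots> = \<alpha> *\<^sub>R b1"
    by (rule euclidean_eqI) (simp add: inner_simps algebra_simps)
  finally have "?P c (?P b c) = \<alpha> *\<^sub>R b1" .
  moreover have "?P c (?P b c) = \<beta> *\<^sub>R b1" by (simp add: \<beta> Pscale \<alpha> b1_def)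
  ultimately have "\<alpha> = \<beta>" using \<alpha>(2) bc cc(2) by (auto simp: b1_def)
  then show ?thesis using \<alpha> \<beta> bc by (metis mult_cancel_left mult_zero_left)
qed

lemma frame_facts:
  assumes "jordan_frame C"
  shows "finite C" "\<And>c. c \<in> C \<Longrightarrow> primitive_idempotent c" "\<And>c. c \<in> C \<Longrightarrow> c \<odot> c = c"
    "\<And>c. c \<in> C \<Longrightarrow> c \<noteq> 0" "\<And>a b. a \<in> C \<Longrightarrow> b \<in> C \<Longrightarrow> a \<noteq> b \<Longrightarrow> a \<odot> b = 0" "\<Sum>C = e"
  using assms by (auto simp: jordan_frame_def primitive_idempotent_def idempotent_def)

lemma spectral_eigen:
  assumes "spectral_decomposition x C l" "c \<in> C"
  shows "x \<odot> c = l c *\<^sub>R c"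
proof -
  have C: "jordan_frame C" and x: "x = (\<Sum>c\<in>C. l c *\<^sub>R c)"
    using assms by (auto simp: spectral_decomposition_def)
  show ?thesis
    unfolding x by (rule orthogonal_sum_mult) (use frame_facts[OF C] assms in auto)
qed

text \<open>
In \<open>\<Sum>\<^sub>c T b c / T c c\<close> only terms with \<open>T b c \<noteq> 0\<close> count, and for these \<open>T c c = T b b\<close>; hence
\<open>z = \<Sum> c / T c c\<close> has inner product \<open>1\<close> with every primitive \<open>b\<close>. As primitive idempotents span the
algebra, \<open>z\<close> is the same for all frames. Computing \<open>z\<close> in a frame of \<open>x\<close> then shows that
multiplications by \<open>x\<close> and \<open>z\<close> commute.
\<close>

lemma trace_vector:
  obtains z where "\<And>b. primitive_idempotent b \<Longrightarrow> T b z = 1" "\<And>x y. x \<odot> (z \<odot> y) = z \<odot> (x \<odot> y)"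
proof -
  define Z where "Z C = (\<Sum>c\<in>C. (1 / T c c) *\<^sub>R c)" for C
  have prim: "T b (Z C) = 1" if C: "jordan_frame C" and b: "primitive_idempotent b" for b C
  proof -
    have bb: "b \<odot> b = b" "b \<noteq> 0" using b by (auto simp: primitive_idempotent_def idempotent_def)
    have "T b (Z C) = (\<Sum>c\<in>C. T b c / T c c)"
      by (simp add: Z_def T.sum_right T_simps)
    also have "\<dots> = (\<Sum>c\<in>C. T b c / T b b)"
    proof (intro sum.cong refl)
      fix c assume "c \<in> C"
      then show "T b c / T c c = T b c / T b b"
        using nonorthogonal_primitives[OF b, of c] frame_facts[OF C] by (cases "T b c = 0") auto
    qed
    also have "\<dots> = T b e / T b b"
      by (simp add: frame_facts(6)[OF C, symmetric] T.sum_right sum_divide_distrib)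
    also have "T b e = T b b" using T_assoc[of b b e] bb by (simp add: unit_right)
    finally show ?thesis using bb T_pos[of b] by simp
  qed
  obtain C l where "spectral_decomposition e C l" by (rule spectral_decomposition_exists)
  then have C: "jordan_frame C" unfolding spectral_decomposition_def by blast
  have Z_unique: "Z D = Z C" if D: "jordan_frame D" for D
  proof -
    let ?u = "Z D - Z C"
    obtain B l where B: "spectral_decomposition ?u B l" by (rule spectral_decomposition_exists)
    then have u: "?u = (\<Sum>b\<in>B. l b *\<^sub>R b)" and "jordan_frame B"
      by (auto simp: spectral_decomposition_def)
    then have "T b ?u = 0" if "b \<in> B" for b
      using prim[OF C] prim[OF D] frame_facts(2) that unfolding T.diff_right by simp
    then have "T (\<Sum>b\<in>B. l b *\<^sub>R b) ?u = 0"
      unfolding T.sum_left by (intro sum.neutral) (simp add: T.scaleR_left)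
    then have "T ?u ?u = 0" by (simp flip: u)
    then show ?thesis by (simp add: T_eq_0_iff)
  qed
  show ?thesis
  proof (rule that[of "Z C"])
    fix x y
    obtain D l where D: "spectral_decomposition x D l" by (rule spectral_decomposition_exists)
    then have x: "x = (\<Sum>d\<in>D. l d *\<^sub>R d)" and DF: "jordan_frame D"
      by (auto simp: spectral_decomposition_def)
    note f = frame_facts[OF DF]
    have com: "d \<odot> (d' \<odot> y) = d' \<odot> (d \<odot> y)" if "d \<in> D" "d' \<in> D" for d d'
      using orthogonal_idempotents_commute[of d d' y] f that by (cases "d = d'") auto
    have "x \<odot> (Z D \<odot> y) = (\<Sum>d\<in>D. \<Sum>d'\<in>D. (l d / T d' d') *\<^sub>R (d \<odot> (d' \<odot> y)))"
      unfolding x Z_def J.sum_left J.sum_right J_simps scaleR_sum_right by (subst sum.swap) simp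
    also have "\<dots> = (\<Sum>d'\<in>D. \<Sum>d\<in>D. (l d / T d' d') *\<^sub>R (d' \<odot> (d \<odot> y)))"
      by (subst sum.swap) (intro sum.cong refl, simp only: com)
    also have "\<dots> = Z D \<odot> (x \<odot> y)"
      unfolding x Z_def J.sum_left J.sum_right J_simps scaleR_sum_right by (subst sum.swap) simp
    finally show "x \<odot> (Z C \<odot> y) = Z C \<odot> (x \<odot> y)"
      unfolding Z_unique[OF DF] .
  qed (rule prim[OF C])
qed

end

locale trace_form = associative_form jprod e T
  for jprod :: "'v::euclidean_space \<Rightarrow> 'v \<Rightarrow> 'v" (infixl "\<odot>" 70)
    and e :: 'v and T :: "'v \<Rightarrow> 'v \<Rightarrow> real" +
  assumes T_primitive: "primitive_idempotent c \<Longrightarrow> T c c = 1"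

text \<open>
Multiplying one argument of \<open>T\<close> by the central vector \<open>z\<close> keeps the form symmetric and associative, and
it takes the value \<open>\<Sum> (l d)\<^sup>2\<close> at \<open>(a, a)\<close> if \<open>l\<close> are the eigenvalues of \<open>a\<close>.
\<close>

lemma (in associative_form) trace_form_exists: "\<exists>T'. trace_form (\<odot>) e T'"
proof -
  obtain z where z: "\<And>b. primitive_idempotent b \<Longrightarrow> T b z = 1" "\<And>x y. x \<odot> (z \<odot> y) = z \<odot> (x \<odot> y)"
    using trace_vector by blast
  have "trace_form (\<odot>) e (\<lambda>a b. T a (z \<odot> b))"
  proof unfold_locales
    show "bilinear (\<lambda>a b. T a (z \<odot> b))"
      unfolding bilinear_def by (auto intro!: linearI simp: T_simps J_simps)
    show "T a (z \<odot> b) = T b (z \<odot> a)" for a b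
      by (simp only: T_assoc[of z a b, symmetric] T_sym[of b])
    show "T (a \<odot> b) (z \<odot> c) = T b (z \<odot> (a \<odot> c))" for a b c by (simp add: T_assoc z)
    show "T c (z \<odot> c) = 1" if "primitive_idempotent c" for c
    proof -
      have "T c (z \<odot> c) = T (c \<odot> c) z" by (simp only: T_assoc commute[of z])
      then show ?thesis using z(1)[OF that] that by (simp add: primitive_idempotent_def idempotent_def)
    qed
    show "T a (z \<odot> a) > 0" if a: "a \<noteq> 0" for a
    proof -
      obtain D l where D: "spectral_decomposition a D l" by (rule spectral_decomposition_exists)
      then have x: "a = (\<Sum>d\<in>D. l d *\<^sub>R d)" and DF: "jordan_frame D"
        by (auto simp: spectral_decomposition_def)
      have "a \<odot> a = (\<Sum>d\<in>D. (l d)^2 *\<^sub>R d)"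
        by (subst (2) x) (simp add: J.sum_right J_simps spectral_eigen[OF D] power2_eq_square)
      moreover have "T a (z \<odot> a) = T (a \<odot> a) z" by (simp only: T_assoc commute[of z])
      ultimately have "T a (z \<odot> a) = (\<Sum>d\<in>D. (l d)^2)"
        using z(1) frame_facts[OF DF] by (simp add: T.sum_left T_simps)
      moreover obtain d where "d \<in> D" "l d \<noteq> 0"
      proof (rule ccontr)
        assume "\<not> thesis"
        then have "\<And>d. d \<in> D \<Longrightarrow> l d = 0" using that by blast
        then have "a = 0" by (subst x) simp
        then show False using a by simp
      qed
      then have "(\<Sum>d\<in>D. (l d)^2) > 0"
        using frame_facts(1)[OF DF] by (intro sum_pos2[of D d]) auto
      ultimately show ?thesis by simp
    qed
  qed
  then show ?thesis by blast
qed

section \<open>Rank, determinant and the cone of squares\<close>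

context trace_form
begin

lemma trace_primitive: "primitive_idempotent c \<Longrightarrow> T c e = 1"
  using T_assoc[of c c e] T_primitive[of c]
  by (simp add: unit_right primitive_idempotent_def idempotent_def)

lemma frame_card:
  assumes "jordan_frame C"
  shows "real (card C) = T e e"
proof -
  have "T (\<Sum>C) e = (\<Sum>c\<in>C. 1)"
    unfolding T.sum_left using frame_facts(2)[OF assms] by (intro sum.cong) (auto simp: trace_primitive)
  then show ?thesis by (simp add: frame_facts(6)[OF assms])
qed

lemma frame_exists: obtains C where "jordan_frame C"
  using spectral_decomposition_exists[of e] unfolding spectral_decomposition_def by blast

lemma jrank_eq_card:
  assumes "jordan_frame C"
  shows "jrank = card C"
  unfolding jrank_def
proof (rule the_equality)
  show "\<exists>C'. jordan_frame C' \<and> card C' = card C" using assms by blast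
  show "d = card C" if "\<exists>C'. jordan_frame C' \<and> card C' = d" for d
    using that frame_card assms of_nat_eq_iff by metis
qed

lemma unit_nonzero: "e \<noteq> 0"
proof
  assume "e = 0"
  then have "v = 0" for v :: 'v using unit[of v] by (simp add: J_simps)
  then have "(SOME b. b \<in> Basis) = (0::'v)" by blast
  then show False using SOME_Basis nonzero_Basis by metis
qed

lemma trace_unit: "T e e = real jrank"
  using frame_exists jrank_eq_card frame_card by metis

lemma jrank_pos: "jrank > 0"
  using T_pos[OF unit_nonzero] trace_unit by simp

lemma trace_frame_right:
  assumes "jordan_frame D" "primitive_idempotent c"
  shows "(\<Sum>d\<in>D. T c d) = 1" "(\<Sum>d\<in>D. T d c) = 1"
  using trace_primitive[OF assms(2)] frame_facts(6)[OF assms(1)] T.sum_right[of c "\<lambda>d. d" D] T_sym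
  by simp_all

lemma trace_idempotents_nonneg:
  assumes "a \<odot> a = a" "b \<odot> b = b"
  shows "T a b \<ge> 0"
  using idempotent_operator_nonneg[OF assms(1), of b] T_assoc[of b a b] commute[of a b] assms(2) by simp

lemma spectral_frame: "spectral_decomposition x C l \<Longrightarrow> jordan_frame C"
  and spectral_sum_eq: "spectral_decomposition x C l \<Longrightarrow> x = (\<Sum>c\<in>C. l c *\<^sub>R c)"
  by (auto simp: spectral_decomposition_def)

lemma spectral_weights:
  assumes "spectral_decomposition x C l" "spectral_decomposition x D m" "c \<in> C" "d \<in> D"
  shows "T c d = 0 \<or> l c = m d"
proof -
  have "T (x \<odot> c) d = T c (x \<odot> d)" by (rule T_assoc)
  then show ?thesis using assms by (simp add: spectral_eigen T_simps)
qed

text \<open>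
Symmetric functions of the eigenvalues do not depend on the decomposition: \<open>T c d\<close> is a doubly
stochastic matrix, and it vanishes unless the eigenvalues at \<open>c\<close> and \<open>d\<close> agree.
\<close>

lemma spectral_function_sum:
  fixes f :: "real \<Rightarrow> real"
  assumes C: "spectral_decomposition x C l" and D: "spectral_decomposition x D m"
  shows "(\<Sum>c\<in>C. f (l c)) = (\<Sum>d\<in>D. f (m d))"
proof -
  note C' = spectral_frame[OF C] and D' = spectral_frame[OF D]
  have "(\<Sum>c\<in>C. f (l c)) = (\<Sum>c\<in>C. \<Sum>d\<in>D. f (l c) * T c d)"
    by (simp add: trace_frame_right[OF D'] frame_facts(2)[OF C'] flip: sum_distrib_left)
  also have "\<dots> = (\<Sum>c\<in>C. \<Sum>d\<in>D. f (m d) * T c d)"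
    using spectral_weights[OF C D] by (intro sum.cong) fastforce+
  also have "\<dots> = (\<Sum>d\<in>D. \<Sum>c\<in>C. f (m d) * T c d)" by (rule sum.swap)
  also have "\<dots> = (\<Sum>d\<in>D. f (m d))"
    by (simp add: trace_frame_right[OF C'] frame_facts(2)[OF D'] flip: sum_distrib_left)
  finally show ?thesis .
qed

lemma spectral_eigenvalues_unique:
  assumes C: "spectral_decomposition x C l" and D: "spectral_decomposition x D m"
  shows "image_mset l (mset_set C) = image_mset m (mset_set D)"
proof (rule multiset_eqI)
  fix r
  have *: "real (count (image_mset h (mset_set B)) r) = (\<Sum>b\<in>B. if h b = r then 1 else 0)"
    if "finite B" for h :: "'v \<Rightarrow> real" and B
  proof -
    have "count (image_mset h (mset_set B)) r = card {b \<in> B. h b = r}"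
      using that by (simp add: count_image_mset Collect_conj_eq Int_commute vimage_def)
    moreover have "(\<Sum>b\<in>B. if h b = r then 1 else (0::real)) = real (card {b \<in> B. h b = r})"
      using that by (simp add: sum.If_cases Int_def)
    ultimately show ?thesis by simp
  qed
  have "(\<Sum>c\<in>C. if l c = r then 1 else (0::real)) = (\<Sum>d\<in>D. if m d = r then 1 else 0)"
    using spectral_function_sum[OF C D, of "\<lambda>s. if s = r then 1 else 0"] .
  then show "count (image_mset l (mset_set C)) r = count (image_mset m (mset_set D)) r"
    using * frame_facts(1)[OF spectral_frame[OF C]] frame_facts(1)[OF spectral_frame[OF D]]
    by (metis of_nat_eq_iff)
qed

lemma jdet_eq:
  assumes "spectral_decomposition x C l"
  shows "jdet x = (\<Prod>c\<in>C. l c)"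
  unfolding jdet_def
proof (rule the_equality)
  show "\<exists>C' l'. spectral_decomposition x C' l' \<and> (\<Prod>c\<in>C. l c) = (\<Prod>c\<in>C'. l' c)"
    by (intro exI conjI) (rule assms, rule refl)
  show "r = (\<Prod>c\<in>C. l c)" if "\<exists>C l. spectral_decomposition x C l \<and> r = (\<Prod>c\<in>C. l c)" for r
    using that spectral_eigenvalues_unique[OF _ assms] by (metis prod_unfold_prod_mset)
qed

lemma spectral_coefficient:
  assumes "spectral_decomposition x C l" "c \<in> C"
  shows "l c = T x c"
proof -
  have c: "c \<odot> c = c" "T c c = 1"
    using frame_facts[OF spectral_frame[OF assms(1)]] assms(2) T_primitive by auto
  have "T (c \<odot> x) c = T x (c \<odot> c)" by (rule T_assoc)
  then show ?thesis using spectral_eigen[OF assms] c by (simp add: commute[of c x] T_simps)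
qed

lemma spectral_square:
  assumes "spectral_decomposition v D m"
  shows "v \<odot> v = (\<Sum>d\<in>D. (m d)\<^sup>2 *\<^sub>R d)"
  by (subst (2) spectral_sum_eq[OF assms])
    (simp add: J.sum_right J_simps spectral_eigen[OF assms] power2_eq_square)

lemma trace_square:
  assumes "spectral_decomposition v D m"
  shows "T x (v \<odot> v) = (\<Sum>d\<in>D. (m d)\<^sup>2 * T x d)"
  by (simp add: spectral_square[OF assms] T.sum_right T_simps)

lemma frame_combination:
  assumes "jordan_frame C"
  shows "spectral_decomposition (\<Sum>c\<in>C. l c *\<^sub>R c) C l"
  using assms by (simp add: spectral_decomposition_def)

lemma cone_of_squares_trace_nonneg:
  assumes "x \<in> cone_of_squares" "y \<in> cone_of_squares"
  shows "T x y \<ge> 0"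
proof -
  obtain v w where v: "x = v \<odot> v" and w: "y = w \<odot> w" using assms by (auto simp: cone_of_squares_def)
  obtain C l where C: "spectral_decomposition v C l" by (rule spectral_decomposition_exists)
  obtain D m where D: "spectral_decomposition w D m" by (rule spectral_decomposition_exists)
  have "T y c \<ge> 0" if c: "c \<in> C" for c
  proof -
    have "T c y = (\<Sum>d\<in>D. (m d)\<^sup>2 * T c d)" unfolding w by (rule trace_square[OF D])
    also have "\<dots> \<ge> 0"
      using frame_facts(3)[OF spectral_frame[OF C] c] frame_facts(3)[OF spectral_frame[OF D]]
      by (intro sum_nonneg mult_nonneg_nonneg trace_idempotents_nonneg) auto
    finally show ?thesis by (simp add: T_sym)
  qed
  then have "T y x \<ge> 0" unfolding v trace_square[OF C] by (intro sum_nonneg) auto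
  then show ?thesis by (simp add: T_sym)
qed

lemma cone_of_squares_spectral:
  assumes C: "spectral_decomposition x C l"
  shows "x \<in> cone_of_squares \<longleftrightarrow> (\<forall>c\<in>C. l c \<ge> 0)"
proof
  assume x: "x \<in> cone_of_squares"
  show "\<forall>c\<in>C. l c \<ge> 0"
  proof
    fix c assume c: "c \<in> C"
    have "c \<in> cone_of_squares"
      using frame_facts(3)[OF spectral_frame[OF C] c] unfolding cone_of_squares_def
      by (intro CollectI exI[of _ c]) simp
    then show "l c \<ge> 0" using spectral_coefficient[OF C c] cone_of_squares_trace_nonneg[OF x] by simp
  qed
next
  assume l: "\<forall>c\<in>C. l c \<ge> 0"
  let ?v = "\<Sum>c\<in>C. sqrt (l c) *\<^sub>R c"
  have "?v \<odot> ?v = (\<Sum>c\<in>C. l c *\<^sub>R c)"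
    unfolding spectral_square[OF frame_combination[OF spectral_frame[OF C]]]
    using l by (intro sum.cong) auto
  then have "x = ?v \<odot> ?v" using spectral_sum_eq[OF C] by simp
  then show "x \<in> cone_of_squares" unfolding cone_of_squares_def by blast
qed

text \<open>
Self-duality, which turns membership in the cone of squares into a family of linear inequalities.
\<close>

lemma cone_of_squares_dual:
  "x \<in> cone_of_squares \<longleftrightarrow> (\<forall>v. T x (v \<odot> v) \<ge> 0)"
proof
  assume "x \<in> cone_of_squares"
  then show "\<forall>v. T x (v \<odot> v) \<ge> 0"
    using cone_of_squares_trace_nonneg by (auto simp: cone_of_squares_def)
next
  assume x: "\<forall>v. T x (v \<odot> v) \<ge> 0"
  obtain C l where C: "spectral_decomposition x C l" by (rule spectral_decomposition_exists)
  have "l c \<ge> 0" if c: "c \<in> C" for c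
    using x frame_facts(3)[OF spectral_frame[OF C] c] spectral_coefficient[OF C c] by metis
  then show "x \<in> cone_of_squares" using cone_of_squares_spectral[OF C] by blast
qed

text \<open>
The interior of the cone of squares, described by positive definiteness of multiplication by \<open>x\<close>, since
\<open>T x (v \<odot> v) = T (x \<odot> v) v\<close>. In this form openness and solvability of \<open>x \<odot> u = v\<close> are immediate.
\<close>

definition pos_cone :: "'v set" where
  "pos_cone = {x. \<forall>v. v \<noteq> 0 \<longrightarrow> T x (v \<odot> v) > 0}"

lemma pos_cone_subset:
  assumes x: "x \<in> pos_cone"
  shows "x \<in> cone_of_squares"
  unfolding cone_of_squares_dual
proof
  fix v
  show "0 \<le> T x (v \<odot> v)"
    using x by (cases "v = 0") (auto simp: pos_cone_def J_simps T_simps less_imp_le)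
qed

lemma pos_cone_spectral:
  assumes C: "spectral_decomposition x C l"
  shows "x \<in> pos_cone \<longleftrightarrow> (\<forall>c\<in>C. l c > 0)"
proof
  assume x: "x \<in> pos_cone"
  show "\<forall>c\<in>C. l c > 0"
  proof
    fix c assume c: "c \<in> C"
    then have "c \<odot> c = c" "c \<noteq> 0" using frame_facts[OF spectral_frame[OF C]] by auto
    moreover from \<open>c \<noteq> 0\<close> have "T x (c \<odot> c) > 0" using x unfolding pos_cone_def by blast
    ultimately show "l c > 0" using spectral_coefficient[OF C c] by simp
  qed
next
  assume l: "\<forall>c\<in>C. l c > 0"
  note C' = frame_facts[OF spectral_frame[OF C]]
  show "x \<in> pos_cone"
    unfolding pos_cone_def
  proof (intro CollectI allI impI)
    fix v :: 'v assume v: "v \<noteq> 0"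
    obtain D m where D: "spectral_decomposition v D m" by (rule spectral_decomposition_exists)
    note D' = frame_facts[OF spectral_frame[OF D]]
    have pos: "T x d > 0" if d: "d \<in> D" for d
    proof -
      have nn: "T c d \<ge> 0" if "c \<in> C" for c
        using C'(3)[OF that] D'(3)[OF d] by (rule trace_idempotents_nonneg)
      have "(\<Sum>c\<in>C. T c d) = 1" using trace_frame_right(2)[OF spectral_frame[OF C] D'(2)[OF d]] .
      then obtain c where c: "c \<in> C" "T c d \<noteq> 0" by (metis sum.neutral zero_neq_one)
      have "T x d = (\<Sum>c\<in>C. l c * T c d)"
        by (subst spectral_sum_eq[OF C]) (simp add: T.sum_left T_simps)
      also have "\<dots> > 0"
        using c nn l by (intro sum_pos2[OF C'(1) c(1)]) (auto simp: less_le)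
      finally show ?thesis .
    qed
    obtain d where d: "d \<in> D" "m d \<noteq> 0"
    proof (rule ccontr)
      assume "\<not> thesis"
      then have "\<And>d. d \<in> D \<Longrightarrow> m d = 0" using that by blast
      then have "v = 0" by (subst spectral_sum_eq[OF D]) simp
      then show False using v by simp
    qed
    show "T x (v \<odot> v) > 0"
      unfolding trace_square[OF D]
      using d pos by (intro sum_pos2[OF D'(1) d(1)]) (auto simp: less_imp_le)
  qed
qed

lemma unit_in_pos_cone: "e \<in> pos_cone"
proof -
  obtain C where C: "jordan_frame C" by (rule frame_exists)
  have "spectral_decomposition e C (\<lambda>_. 1)"
    using C frame_facts(6)[OF C] by (simp add: spectral_decomposition_def)
  then show ?thesis using pos_cone_spectral by simp
qed

lemma pos_cone_add:
  assumes "x \<in> cone_of_squares" "y \<in> pos_cone"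
  shows "x + y \<in> pos_cone"
  using assms unfolding cone_of_squares_dual pos_cone_def
  by (auto simp: T_simps intro: add_nonneg_pos)

lemma pos_cone_scale: "x \<in> pos_cone \<Longrightarrow> r > 0 \<Longrightarrow> r *\<^sub>R x \<in> pos_cone"
  unfolding pos_cone_def by (auto simp: T_simps)

lemma trace_operator: "T (x \<odot> v) v = T x (v \<odot> v)"
  using T_assoc[of v x v] commute[of x v] by simp

text \<open>
Positive definiteness is uniform on the unit sphere, so it survives small perturbations of \<open>x\<close> together
with a bound for the inverse of multiplication by \<open>x\<close>.
\<close>

lemma pos_cone_coercive:
  assumes x: "x \<in> pos_cone"
  obtains r K where "r > 0" "K > 0" "\<And>y v. dist y x < r \<Longrightarrow> y \<in> pos_cone \<and> norm v \<le> K * norm (y \<odot> v)"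
proof -
  let ?S = "sphere (0::'v) 1"
  have "continuous_on ?S (\<lambda>v. T x (v \<odot> v))"
    by (intro continuous_intros J.continuous_on T.continuous_on)
  moreover have "?S \<noteq> {}" using unit_nonzero by (metis empty_iff mem_sphere_0 norm_sgn)
  ultimately obtain u where u: "u \<in> ?S" "\<And>w. w \<in> ?S \<Longrightarrow> T x (u \<odot> u) \<le> T x (w \<odot> w)"
    using continuous_attains_inf[OF compact_sphere] by blast
  define m where "m = T x (u \<odot> u)"
  have "u \<noteq> 0" using u(1) by auto
  then have m: "m > 0" using x unfolding m_def pos_cone_def by auto
  have low: "T x (v \<odot> v) \<ge> m * (norm v)\<^sup>2" for v
  proof (cases "v = 0")
    case False
    have "m \<le> T x (((1 / norm v) *\<^sub>R v) \<odot> ((1 / norm v) *\<^sub>R v))"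
      unfolding m_def by (rule u(2)) (use False in simp)
    also have "\<dots> = T x (v \<odot> v) / (norm v)\<^sup>2"
      by (simp add: J_simps T_simps power2_eq_square)
    finally show ?thesis using False by (simp add: le_divide_eq)
  qed (simp add: J_simps T_simps)
  obtain B where B: "B > 0" "\<And>a b. norm (T a b) \<le> norm a * norm b * B"
    using T.pos_bounded by blast
  obtain M where M: "M > 0" "\<And>a b. norm (a \<odot> b) \<le> norm a * norm b * M"
    using J.pos_bounded by blast
  \<comment> \<open>Within this radius the quadratic form of \<open>y - x\<close> is at most half of that of \<open>x\<close>.\<close>
  define r where "r = m / (2 * B * M)"
  have r: "r > 0" using m B M by (simp add: r_def)
  show ?thesis
  proof (rule that[of r "2 * B / m"])
    fix y v assume y: "dist y x < r"
    have low': "T y (v \<odot> v) \<ge> m / 2 * (norm v)\<^sup>2" for v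
    proof -
      have "\<bar>T (y - x) (v \<odot> v)\<bar> \<le> norm (y - x) * norm (v \<odot> v) * B"
        using B(2)[of "y - x" "v \<odot> v"] by simp
      also have "\<dots> \<le> r * (norm v * norm v * M) * B"
        using y B M(2)[of v v] r by (intro mult_right_mono mult_mono) (auto simp: dist_norm)
      also have "\<dots> = m / 2 * (norm v)\<^sup>2"
        using B M by (simp add: r_def power2_eq_square field_simps)
      finally have "T x (v \<odot> v) - T y (v \<odot> v) \<le> m / 2 * (norm v)\<^sup>2"
        unfolding T.diff_left by linarith
      then show ?thesis using low[of v] by (simp add: field_simps)
    qed
    have "T y (w \<odot> w) > 0" if "w \<noteq> 0" for w
      by (rule less_le_trans[OF _ low'[of w]]) (use m that in simp)
    then have 1: "y \<in> pos_cone" by (simp add: pos_cone_def)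
    have "m / 2 * (norm v)\<^sup>2 \<le> T (y \<odot> v) v" using low' by (simp add: trace_operator)
    also have "\<dots> \<le> norm (y \<odot> v) * norm v * B" using B(2)[of "y \<odot> v" v] by simp
    finally have "norm v * (m / 2 * norm v) \<le> norm v * (B * norm (y \<odot> v))"
      by (simp add: power2_eq_square algebra_simps)
    then have "v = 0 \<or> m / 2 * norm v \<le> B * norm (y \<odot> v)"
      by (cases "v = 0") (auto dest!: mult_left_le_imp_le)
    then have "norm v \<le> 2 * B / m * norm (y \<odot> v)"
      using m by (auto simp: field_simps J_simps)
    with 1 show "y \<in> pos_cone \<and> norm v \<le> 2 * B / m * norm (y \<odot> v)" by blast
  qed (use r m B in auto)
qed

lemma pos_cone_open: "open pos_cone"
  unfolding open_dist using pos_cone_coercive by metis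

section \<open>The Jordan inverse and the logarithm of the determinant\<close>

text \<open>
The inverse of multiplication by \<open>x\<close>, applied to \<open>v\<close>; in particular \<open>solve x e\<close> is the Jordan inverse of \<open>x\<close>.
The value is meaningful for \<open>x\<close> in the open cone, where this operator is invertible.
\<close>

definition solve :: "'v \<Rightarrow> 'v \<Rightarrow> 'v" where
  "solve x v = (THE u. x \<odot> u = v)"

lemma pos_cone_mult_inj:
  assumes "x \<in> pos_cone" "x \<odot> u = x \<odot> u'"
  shows "u = u'"
proof (rule ccontr)
  assume "u \<noteq> u'"
  then have "T x ((u - u') \<odot> (u - u')) > 0" using assms(1) by (simp add: pos_cone_def)
  moreover have "x \<odot> (u - u') = 0" using assms(2) by (simp add: J.diff_right)
  ultimately show False by (simp add: trace_operator[symmetric] T.zero_left)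
qed

lemma solve_unique:
  assumes "x \<in> pos_cone" "x \<odot> u = v"
  shows "solve x v = u"
  unfolding solve_def using assms pos_cone_mult_inj by blast

lemma mult_solve:
  assumes "x \<in> pos_cone"
  shows "x \<odot> solve x v = v"
proof -
  have "linear (\<lambda>u. x \<odot> u)" by (intro linearI) (simp_all add: J_simps)
  moreover have "inj (\<lambda>u. x \<odot> u)" using pos_cone_mult_inj[OF assms] by (auto intro: injI)
  ultimately have "surj (\<lambda>u. x \<odot> u)" by (rule linear_inj_imp_surj)
  from surjD[OF this, of v] obtain u where u: "v = x \<odot> u" by blast
  show ?thesis by (simp only: u solve_unique[OF assms refl])
qed

lemma solve_linear:
  assumes "x \<in> pos_cone"
  shows "linear (solve x)"
proof (rule linearI)
  show "solve x (v + w) = solve x v + solve x w" for v w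
    by (rule solve_unique[OF assms]) (simp only: J.add_right mult_solve[OF assms])
  show "solve x (r *\<^sub>R v) = r *\<^sub>R solve x v" for r v
    by (rule solve_unique[OF assms]) (simp only: J.scaleR_right mult_solve[OF assms])
qed

text \<open>
The resolvent identity \<open>L(y)\<^sup>-\<^sup>1 = L(x)\<^sup>-\<^sup>1 - L(y)\<^sup>-\<^sup>1 L(y - x) L(x)\<^sup>-\<^sup>1\<close>, used twice, leaves a
remainder that is quadratic in \<open>y - x\<close>.
\<close>

lemma solve_has_derivative:
  assumes x: "x \<in> pos_cone"
  shows "((\<lambda>y. solve y v) has_derivative (\<lambda>p. - solve x (p \<odot> solve x v))) (at x)"
proof -
  obtain r K where r: "r > 0" "K > 0" and
    rK: "\<And>y v. dist y x < r \<Longrightarrow> y \<in> pos_cone \<and> norm v \<le> K * norm (y \<odot> v)"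
    using pos_cone_coercive[OF x] by metis
  obtain M where M: "M > 0" "\<And>a b. norm (a \<odot> b) \<le> norm a * norm b * M"
    using J.pos_bounded by blast
  let ?z = "solve x v"
  interpret sx: linear "solve x" by (rule solve_linear[OF x])
  have "linear (\<lambda>p. - solve x (p \<odot> ?z))"
    by (intro linearI) (simp_all add: J_simps sx.add sx.scale)
  then have bl: "bounded_linear (\<lambda>p. - solve x (p \<odot> ?z))" by (simp add: linear_conv_bounded_linear)
  show ?thesis
  proof (rule has_derivativeI_sandwich[OF r(1) bl, where H = "\<lambda>y. K * K * M * M * norm ?z * norm (y - x)"])
    fix y assume y: "y \<noteq> x" "dist y x < r"
    let ?h = "y - x"
    note yP = rK[OF y(2), THEN conjunct1]
    have nx: "norm (solve x w) \<le> K * norm w" for w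
      using rK[of x "solve x w"] r mult_solve[OF x] by simp
    have ny: "norm (solve y w) \<le> K * norm w" for w
      using rK[OF y(2), of "solve y w"] mult_solve[OF yP] by simp
    have *: "solve y w = solve x w - solve y (?h \<odot> solve x w)" for w
    proof (rule solve_unique[OF yP])
      have "y \<odot> solve x w = w + ?h \<odot> solve x w"
        using mult_solve[OF x, of w] by (simp add: J_simps)
      then show "y \<odot> (solve x w - solve y (?h \<odot> solve x w)) = w"
        unfolding J.diff_right mult_solve[OF yP] by simp
    qed
    have "(solve y v - ?z) - (- solve x (?h \<odot> ?z)) = solve y (?h \<odot> solve x (?h \<odot> ?z))"
      using *[of v] *[of "?h \<odot> ?z"] by simp
    also have "norm \<dots> \<le> K * (norm ?h * (K * (norm ?h * norm ?z * M)) * M)"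
    proof -
      have "norm (?h \<odot> solve x (?h \<odot> ?z)) \<le> norm ?h * norm (solve x (?h \<odot> ?z)) * M" by (rule M(2))
      also have "\<dots> \<le> norm ?h * (K * (norm ?h * norm ?z * M)) * M"
        using M(1) r nx[of "?h \<odot> ?z"] M(2)[of ?h ?z]
        by (intro mult_right_mono mult_left_mono)
          (auto intro: order_trans[OF _ mult_left_mono])
      finally show ?thesis
        using ny[of "?h \<odot> solve x (?h \<odot> ?z)"] r by (meson mult_left_mono order_trans less_imp_le)
    qed
    finally have "norm ((solve y v - ?z) - (- solve x (?h \<odot> ?z))) / norm ?h
        \<le> K * (norm ?h * (K * (norm ?h * norm ?z * M)) * M) / norm ?h"
      by (rule divide_right_mono) simp
    also have "\<dots> = K * K * M * M * norm ?z * norm ?h"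
      using y by (simp add: field_simps)
    finally show "norm (solve y v - ?z - - solve x (?h \<odot> ?z)) / norm ?h \<le> K * K * M * M * norm ?z * norm ?h" .
  next
    have "((\<lambda>y. K * K * M * M * norm ?z * norm (y - x)) \<longlongrightarrow> K * K * M * M * norm ?z * norm (x - x)) (at x)"
      by (intro tendsto_intros)
    then show "((\<lambda>y. K * K * M * M * norm ?z * norm (y - x)) \<longlongrightarrow> 0) (at x)" by simp
  qed
qed

lemma solve_unit_spectral:
  assumes C: "spectral_decomposition x C l" and x: "x \<in> pos_cone"
  shows "solve x e = (\<Sum>c\<in>C. (1 / l c) *\<^sub>R c)"
proof (rule solve_unique[OF x])
  have "l c \<noteq> 0" if "c \<in> C" for c using pos_cone_spectral[OF C] x that by fastforce
  then have "x \<odot> (\<Sum>c\<in>C. (1 / l c) *\<^sub>R c) = \<Sum>C"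
    unfolding J.sum_right by (intro sum.cong) (auto simp: J_simps spectral_eigen[OF C])
  then show "x \<odot> (\<Sum>c\<in>C. (1 / l c) *\<^sub>R c) = e" using frame_facts(6)[OF spectral_frame[OF C]] by simp
qed

lemma solve_unit_pos:
  assumes x: "x \<in> pos_cone"
  shows "solve x e \<in> pos_cone"
proof -
  obtain C l where C: "spectral_decomposition x C l" by (rule spectral_decomposition_exists)
  show ?thesis
    unfolding solve_unit_spectral[OF C x] pos_cone_spectral[OF frame_combination[OF spectral_frame[OF C]]]
    using x pos_cone_spectral[OF C] by simp
qed

lemma jdet_pos: "x \<in> pos_cone \<Longrightarrow> jdet x > 0"
  using spectral_decomposition_exists[of x] jdet_eq pos_cone_spectral by (metis prod_pos)

lemma jdet_boundary:
  assumes "x \<in> cone_of_squares" "x \<notin> pos_cone"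
  shows "jdet x = 0"
proof -
  obtain C l where C: "spectral_decomposition x C l" by (rule spectral_decomposition_exists)
  obtain c where "c \<in> C" "\<not> l c > 0" using assms(2) pos_cone_spectral[OF C] by blast
  then have "c \<in> C" "l c = 0" using assms(1) cone_of_squares_spectral[OF C] by force+
  then show ?thesis
    using frame_facts(1)[OF spectral_frame[OF C]] jdet_eq[OF C] by (auto intro: prod_zero)
qed

definition logdet :: "'v \<Rightarrow> real" where "logdet x = ln (jdet x)"

lemma logdet_spectral:
  assumes C: "spectral_decomposition x C l" and x: "x \<in> pos_cone"
  shows "logdet x = (\<Sum>c\<in>C. ln (l c))"
proof -
  have "l c \<noteq> 0" if "c \<in> C" for c using pos_cone_spectral[OF C] x that by force
  then show ?thesis
    using frame_facts(1)[OF spectral_frame[OF C]] by (simp add: logdet_def jdet_eq[OF C] ln_prod)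
qed

lemma trace_solve_self: "x \<in> pos_cone \<Longrightarrow> T (solve x e) x = real jrank"
  using T_assoc[of x "solve x e" e] mult_solve[of x e] trace_unit by (simp add: unit_right)

lemma trace_solve_pos:
  assumes "x \<in> pos_cone" "y \<in> pos_cone"
  shows "T (solve x e) y > 0"
proof -
  obtain v where v: "y = v \<odot> v" using pos_cone_subset[OF assms(2)] by (auto simp: cone_of_squares_def)
  then have "v \<noteq> 0" using assms(2) unit_nonzero by (auto simp: pos_cone_def J_simps T_simps)
  then show ?thesis using solve_unit_pos[OF assms(1)] by (auto simp: v pos_cone_def)
qed

text \<open>
A sharpened Klein inequality. With eigenvalues \<open>l\<close> of \<open>x\<close> and \<open>m\<close> of \<open>y\<close>, the difference of the two
logarithms is the sum of \<open>ln (m d / l c)\<close> weighted by the doubly stochastic matrix \<open>T c d\<close>, and the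
weighted sum of \<open>m d / l c\<close> is \<open>T (solve x e) y\<close>. Jensen's inequality gives the claim. The logarithm on
the right, rather than its linear bound, makes the inequality invariant under scaling of \<open>y\<close>; this is
what the root of the determinant requires.
\<close>

lemma logdet_le:
  assumes x: "x \<in> pos_cone" and y: "y \<in> pos_cone"
  shows "logdet y \<le> logdet x + jrank * ln (T (solve x e) y / jrank)"
proof -
  define \<theta> where "\<theta> = T (solve x e) y / jrank"
  have \<theta>: "\<theta> > 0" using trace_solve_pos[OF assms] jrank_pos by (simp add: \<theta>_def)
  obtain C l where C: "spectral_decomposition x C l" by (rule spectral_decomposition_exists)
  obtain D m where D: "spectral_decomposition y D m" by (rule spectral_decomposition_exists)
  note Cf = spectral_frame[OF C] and Df = spectral_frame[OF D]
  note C' = frame_facts[OF Cf] and D' = frame_facts[OF Df]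
  have l: "l c > 0" if "c \<in> C" for c using pos_cone_spectral[OF C] x that by blast
  have m: "m d > 0" if "d \<in> D" for d using pos_cone_spectral[OF D] y that by blast
  have sumC: "(\<Sum>c\<in>C. f c) = (\<Sum>c\<in>C. \<Sum>d\<in>D. T c d * f c)" for f :: "'v \<Rightarrow> real"
    by (simp add: trace_frame_right[OF Df] C'(2) flip: sum_distrib_right)
  have sumD: "(\<Sum>d\<in>D. f d) = (\<Sum>c\<in>C. \<Sum>d\<in>D. T c d * f d)" for f :: "'v \<Rightarrow> real"
    by (subst sum.swap) (simp add: trace_frame_right[OF Cf] D'(2) flip: sum_distrib_right)
  have "logdet y - logdet x = (\<Sum>c\<in>C. \<Sum>d\<in>D. T c d * (ln (m d) - ln (l c)))"
    using sumC[of "\<lambda>c. ln (l c)"] sumD[of "\<lambda>d. ln (m d)"]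
    by (simp add: logdet_spectral[OF C x] logdet_spectral[OF D y] right_diff_distrib sum_subtractf)
  \<comment> \<open>Jensen's inequality as the tangent bound of the logarithm at the weighted mean \<open>\<theta>\<close> of the quotients.\<close>
  also have "\<dots> \<le> (\<Sum>c\<in>C. \<Sum>d\<in>D. T c d * (ln \<theta> - 1 + (m d / l c) / \<theta>))"
  proof (intro sum_mono mult_left_mono)
    fix c d assume cd: "c \<in> C" "d \<in> D"
    have "ln (m d / (l c * \<theta>)) \<le> m d / (l c * \<theta>) - 1"
      by (rule ln_le_minus_one) (use l[OF cd(1)] m[OF cd(2)] \<theta> in simp)
    then show "ln (m d) - ln (l c) \<le> ln \<theta> - 1 + (m d / l c) / \<theta>"
      using l[OF cd(1)] m[OF cd(2)] \<theta> by (simp add: ln_div ln_mult)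
    show "T c d \<ge> 0" using C'(3)[OF cd(1)] D'(3)[OF cd(2)] by (rule trace_idempotents_nonneg)
  qed
  also have "\<dots> = (\<Sum>c\<in>C. ln \<theta> - 1) + (\<Sum>c\<in>C. \<Sum>d\<in>D. T c d * (m d / l c)) / \<theta>"
    by (subst sumC) (simp only: distrib_left sum.distrib sum_divide_distrib times_divide_eq_right)
  also have "(\<Sum>c\<in>C. \<Sum>d\<in>D. T c d * (m d / l c)) = T (solve x e) y"
    by (subst sum.swap, subst spectral_sum_eq[OF D], unfold solve_unit_spectral[OF C x] T.sum_left T.sum_right)
      (simp add: T_simps mult_ac)
  also have "T (solve x e) y / \<theta> = jrank" using trace_solve_pos[OF assms] jrank_pos by (simp add: \<theta>_def)
  also have "(\<Sum>c\<in>C. ln \<theta> - 1) = jrank * (ln \<theta> - 1)" by (simp add: jrank_eq_card[OF Cf])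
  finally show ?thesis by (simp add: \<theta>_def algebra_simps)
qed

lemma logdet_le_linear:
  assumes x: "x \<in> pos_cone" and y: "y \<in> pos_cone"
  shows "logdet y \<le> logdet x + T (solve x e) (y - x)"
proof -
  let ?t = "T (solve x e) y"
  have "ln (?t / jrank) \<le> ?t / jrank - 1"
    by (rule ln_le_minus_one) (use trace_solve_pos[OF assms] jrank_pos in simp)
  then have "jrank * ln (?t / jrank) \<le> jrank * (?t / jrank - 1)" by (rule mult_left_mono) simp
  also have "\<dots> = ?t - jrank" using jrank_pos by (simp add: field_simps)
  finally show ?thesis using logdet_le[OF assms] trace_solve_self[OF x] by (simp add: T_simps)
qed

text \<open>
The two gradient inequalities at \<open>x\<close> and at \<open>y\<close> enclose the difference, and the gap between them is
controlled by the continuity of the Jordan inverse.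
\<close>

lemma logdet_has_derivative:
  assumes x: "x \<in> pos_cone"
  shows "(logdet has_derivative T (solve x e)) (at x)"
proof -
  obtain r where r: "r > 0" "\<And>y. dist y x < r \<Longrightarrow> y \<in> pos_cone"
    using pos_cone_open x unfolding open_dist by blast
  obtain B where B: "B > 0" "\<And>a b. norm (T a b) \<le> norm a * norm b * B"
    using T.pos_bounded by blast
  show ?thesis
  proof (rule has_derivativeI_sandwich[OF r(1), where H = "\<lambda>y. norm (solve y e - solve x e) * B"])
    show "bounded_linear (T (solve x e))" by (rule T.bounded_linear_right)
    fix y assume y: "y \<noteq> x" "dist y x < r"
    note yP = r(2)[OF y(2)]
    have "norm (logdet y - logdet x - T (solve x e) (y - x)) \<le> norm (T (solve y e - solve x e) (y - x))"
      using logdet_le_linear[OF x yP] logdet_le_linear[OF yP x] by (simp add: T_simps)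
    also have "\<dots> \<le> norm (solve y e - solve x e) * norm (y - x) * B" by (rule B(2))
    finally show "norm (logdet y - logdet x - T (solve x e) (y - x)) / norm (y - x) \<le> norm (solve y e - solve x e) * B"
      using y by (simp add: field_simps)
  next
    have "isCont (\<lambda>y. solve y e) x" using solve_has_derivative[OF x] has_derivative_continuous by blast
    then have "((\<lambda>y. norm (solve y e - solve x e) * B) \<longlongrightarrow> norm (solve x e - solve x e) * B) (at x)"
      unfolding isCont_def by (intro tendsto_intros)
    then show "((\<lambda>y. norm (solve y e - solve x e) * B) \<longlongrightarrow> 0) (at x)" by simp
  qed
qed

section \<open>The hypograph of the root-determinant\<close>

definition rtdet :: "'v \<Rightarrow> real" where "rtdet x = jdet x powr (1 / real jrank)"

lemma rtdet_eq_exp: "x \<in> pos_cone \<Longrightarrow> rtdet x = exp (logdet x / jrank)"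
  using jdet_pos[of x] by (simp add: rtdet_def logdet_def powr_def)

lemma rtdet_pos: "x \<in> pos_cone \<Longrightarrow> rtdet x > 0"
  using jdet_pos[of x] by (simp add: rtdet_def)

lemma rtdet_nonneg: "rtdet x \<ge> 0"
  by (simp add: rtdet_def)

lemma rtdet_boundary: "x \<in> cone_of_squares \<Longrightarrow> x \<notin> pos_cone \<Longrightarrow> rtdet x = 0"
  by (simp add: rtdet_def jdet_boundary)

text \<open>
The root of the determinant lies below a linear function that touches it at \<open>x\<close>. This contains its
concavity.
\<close>

lemma rtdet_le:
  assumes x: "x \<in> pos_cone" and y: "y \<in> cone_of_squares"
  shows "rtdet y \<le> rtdet x * (T (solve x e) y / jrank)"
proof (cases "y \<in> pos_cone")
  case True
  have t: "T (solve x e) y / jrank > 0" using trace_solve_pos[OF x True] jrank_pos by simp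
  have "logdet y / jrank \<le> logdet x / jrank + ln (T (solve x e) y / jrank)"
    using logdet_le[OF x True] jrank_pos by (simp add: field_simps)
  then have "exp (logdet y / jrank) \<le> exp (logdet x / jrank + ln (T (solve x e) y / jrank))" by simp
  also have "\<dots> = exp (logdet x / jrank) * (T (solve x e) y / jrank)" using t by (simp only: exp_add exp_ln)
  finally show ?thesis by (simp only: rtdet_eq_exp x True)
next
  case False
  have "T (solve x e) y \<ge> 0"
    using cone_of_squares_trace_nonneg[OF pos_cone_subset[OF solve_unit_pos[OF x]] y] .
  then show ?thesis using rtdet_nonneg[of x] by (simp add: rtdet_boundary[OF y False])
qed

lemma rtdet_cone_iff: "(u, w) \<in> rtdet_cone \<longleftrightarrow> w \<in> cone_of_squares \<and> u \<le> rtdet w"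
  by (simp add: rtdet_cone_def rtdet_def)

lemma spectral_shift:
  assumes C: "spectral_decomposition w C l"
  shows "spectral_decomposition (w + \<epsilon> *\<^sub>R e) C (\<lambda>c. l c + \<epsilon>)"
proof -
  have "w + \<epsilon> *\<^sub>R e = (\<Sum>c\<in>C. (l c + \<epsilon>) *\<^sub>R c)"
    by (subst spectral_sum_eq[OF C], subst frame_facts(6)[OF spectral_frame[OF C], symmetric])
      (simp add: scaleR_add_left sum.distrib scaleR_sum_right)
  then show ?thesis using spectral_frame[OF C] by (simp add: spectral_decomposition_def)
qed

text \<open>
At a point \<open>w\<close> of the open cone the half-space with \<open>x = w\<close> is tight. At a boundary point \<open>w\<close> the bound
zero is attained in the limit by the half-spaces with \<open>x = w + \<epsilon> e\<close>.
\<close>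

lemma rtdet_cone_half_spaces:
  "rtdet_cone = {k. \<forall>v. 0 \<le> T (snd k) (v \<odot> v)} \<inter>
    (\<Inter>x\<in>pos_cone. {k. fst k \<le> rtdet x * (T (solve x e) (snd k) / jrank)})"
proof (intro subset_antisym subsetI)
  fix k assume "k \<in> rtdet_cone"
  then show "k \<in> {k. \<forall>v. 0 \<le> T (snd k) (v \<odot> v)} \<inter>
    (\<Inter>x\<in>pos_cone. {k. fst k \<le> rtdet x * (T (solve x e) (snd k) / jrank)})"
    using rtdet_le by (cases k) (force simp: rtdet_cone_iff cone_of_squares_dual)
next
  fix k assume k: "k \<in> {k. \<forall>v. 0 \<le> T (snd k) (v \<odot> v)} \<inter>
    (\<Inter>x\<in>pos_cone. {k. fst k \<le> rtdet x * (T (solve x e) (snd k) / jrank)})"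
  obtain u w where uw: "k = (u, w)" by (cases k)
  have w: "w \<in> cone_of_squares" using k by (simp add: uw cone_of_squares_dual)
  have u: "u \<le> rtdet x * (T (solve x e) w / jrank)" if "x \<in> pos_cone" for x
    using k that by (simp add: uw)
  have "u \<le> rtdet w"
  proof (cases "w \<in> pos_cone")
    case True
    then show ?thesis using u[OF True] trace_solve_self[OF True] jrank_pos by simp
  next
    case False
    obtain C l where C: "spectral_decomposition w C l" by (rule spectral_decomposition_exists)
    note C' = frame_facts[OF spectral_frame[OF C]]
    have l: "l c \<ge> 0" if "c \<in> C" for c using w cone_of_squares_spectral[OF C] that by blast
    have prod0: "(\<Prod>c\<in>C. l c + 0) = 0" using jdet_boundary[OF w False] jdet_eq[OF C] by simp
    have "((\<lambda>\<epsilon>. (\<Prod>c\<in>C. l c + \<epsilon>) powr (1 / jrank)) \<longlongrightarrow> (\<Prod>c\<in>C. l c + 0) powr (1 / jrank)) (at_right 0)"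
    proof (rule tendsto_powr')
      show "((\<lambda>\<epsilon>. \<Prod>c\<in>C. l c + \<epsilon>) \<longlongrightarrow> (\<Prod>c\<in>C. l c + 0)) (at_right 0)"
        by (intro tendsto_intros)
      have "\<forall>\<^sub>F \<epsilon> in at_right 0. (\<Prod>c\<in>C. l c + \<epsilon>) \<ge> 0"
        using eventually_at_right_less[of "0::real"] by eventually_elim (use l in \<open>auto intro!: prod_nonneg add_nonneg_nonneg\<close>)
      then show "(\<Prod>c\<in>C. l c + 0) \<noteq> 0 \<or> 0 < 1 / real jrank \<and> (\<forall>\<^sub>F \<epsilon> in at_right 0. (\<Prod>c\<in>C. l c + \<epsilon>) \<ge> 0)"
        using jrank_pos by simp
    qed (rule tendsto_const)
    moreover have "\<forall>\<^sub>F \<epsilon> in at_right 0. u \<le> (\<Prod>c\<in>C. l c + \<epsilon>) powr (1 / jrank)"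
      using eventually_at_right_less[of "0::real"]
    proof eventually_elim
      case (elim \<epsilon>)
      let ?x = "w + \<epsilon> *\<^sub>R e"
      have x: "?x \<in> pos_cone" using w elim by (intro pos_cone_add pos_cone_scale unit_in_pos_cone)
      note S = spectral_shift[OF C, of \<epsilon>]
      have "T (solve ?x e) w = (\<Sum>c\<in>C. l c / (l c + \<epsilon>))"
        by (simp add: solve_unit_spectral[OF S x] T.sum_left T_simps spectral_coefficient[OF C] T_sym[of w])
      also have "\<dots> \<le> (\<Sum>c\<in>C. 1)"
        using l elim by (intro sum_mono) (auto simp: divide_le_eq add_nonneg_pos)
      finally have "T (solve ?x e) w / jrank \<le> 1"
        using jrank_pos by (simp add: jrank_eq_card[OF spectral_frame[OF C]])
      then have "rtdet ?x * (T (solve ?x e) w / jrank) \<le> rtdet ?x * 1"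
        by (intro mult_left_mono rtdet_nonneg)
      with u[OF x] show ?case by (simp add: rtdet_def jdet_eq[OF S])
    qed
    ultimately have "u \<le> (\<Prod>c\<in>C. l c + 0) powr (1 / jrank)"
      by (rule tendsto_lowerbound) simp
    then show ?thesis using prod0 by (simp add: rtdet_def jdet_eq[OF C])
  qed
  with w show "k \<in> rtdet_cone" by (simp add: uw rtdet_cone_iff)
qed

lemma rtdet_cone_closed: "closed rtdet_cone"
  unfolding rtdet_cone_half_spaces
  using jrank_pos
  by (intro closed_Int closed_INT ballI closed_Collect_all closed_Collect_le continuous_intros
      T.continuous_on) auto

lemma rtdet_cone_convex: "convex rtdet_cone"
  unfolding rtdet_cone_half_spaces
proof (intro convex_Int convex_INT)
  show "convex {k :: real \<times> 'v. \<forall>v. 0 \<le> T (snd k) (v \<odot> v)}"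
    by (auto simp: convex_def T_simps intro!: add_nonneg_nonneg)
  fix x
  show "convex {k :: real \<times> 'v. fst k \<le> rtdet x * (T (solve x e) (snd k) / jrank)}"
    unfolding convex_def
  proof clarsimp
    fix a w b w' and s t :: real
    assume h: "a \<le> rtdet x * T (solve x e) w / jrank" "b \<le> rtdet x * T (solve x e) w' / jrank"
      "0 \<le> s" "0 \<le> t"
    have "s * a + t * b \<le> s * (rtdet x * T (solve x e) w / jrank) + t * (rtdet x * T (solve x e) w' / jrank)"
      by (intro add_mono mult_left_mono h)
    also have "\<dots> = rtdet x * T (solve x e) (s *\<^sub>R w + t *\<^sub>R w') / jrank"
      by (simp add: T_simps add_divide_distrib algebra_simps)
    finally show "s * a + t * b \<le> rtdet x * T (solve x e) (s *\<^sub>R w + t *\<^sub>R w') / jrank" .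
  qed
qed

lemma rtdet_continuous_on: "continuous_on pos_cone rtdet"
proof -
  have "continuous_on pos_cone logdet"
    by (meson continuous_at_imp_continuous_on has_derivative_continuous logdet_has_derivative)
  then have "continuous_on pos_cone (\<lambda>x. exp (logdet x / jrank))" by (intro continuous_intros) (use jrank_pos in auto)
  then show ?thesis by (rule continuous_on_eq) (simp add: rtdet_eq_exp)
qed

lemma pos_cone_of_shift:
  assumes "\<epsilon> > 0" "w - \<epsilon> *\<^sub>R e \<in> cone_of_squares"
  shows "w \<in> pos_cone"
  using pos_cone_add[OF assms(2) pos_cone_scale[OF unit_in_pos_cone assms(1)]] by simp

lemma interior_rtdet_cone: "interior rtdet_cone = {(u, w). w \<in> pos_cone \<and> u < rtdet w}"
proof (intro subset_antisym subsetI)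
  fix k assume "k \<in> {(u, w). w \<in> pos_cone \<and> u < rtdet w}"
  moreover have "open {(u, w). w \<in> pos_cone \<and> u < rtdet w}"
  proof -
    let ?f = "\<lambda>k. rtdet (snd k) - fst k"
    have "continuous_on (UNIV \<times> pos_cone) ?f"
      by (intro continuous_intros continuous_on_compose2[OF rtdet_continuous_on]) auto
    then have "open (?f -` {0<..} \<inter> (UNIV \<times> pos_cone))"
      by (rule continuous_on_open_vimage[THEN iffD1, rule_format, rotated])
        (auto intro: open_Times pos_cone_open)
    moreover have "?f -` {0<..} \<inter> (UNIV \<times> pos_cone) = {(u, w). w \<in> pos_cone \<and> u < rtdet w}" by auto
    ultimately show ?thesis by simp
  qed
  moreover have "{(u, w). w \<in> pos_cone \<and> u < rtdet w} \<subseteq> rtdet_cone"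
    using pos_cone_subset by (auto simp: rtdet_cone_iff)
  ultimately show "k \<in> interior rtdet_cone" unfolding interior_def by blast
next
  fix k assume k: "k \<in> interior rtdet_cone"
  obtain u w where uw: "k = (u, w)" by (cases k)
  obtain r where r: "r > 0" "ball k r \<subseteq> rtdet_cone" using k by (auto simp: mem_interior)
  \<comment> \<open>Small enough that both perturbations \<open>(u, w - \<epsilon> e)\<close> and \<open>(u + \<epsilon>, w)\<close> stay in the ball of radius \<open>r\<close>.\<close>
  define \<epsilon> where "\<epsilon> = (r / 2) / (1 + norm e)"
  have pos: "1 + norm e > 0" by (simp add: add_pos_nonneg)
  have \<epsilon>: "\<epsilon> > 0" "\<epsilon> < r" "\<epsilon> * norm e < r"
  proof -
    show "\<epsilon> > 0" using r pos by (simp add: \<epsilon>_def)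
    have "\<epsilon> * (1 + norm e) = r / 2"
      unfolding \<epsilon>_def using pos by (intro nonzero_divide_mult_cancel_right nonzero_eq_divide_eq[THEN iffD1]) auto
    then have "\<epsilon> + \<epsilon> * norm e = r / 2" by (simp add: distrib_left)
    moreover have "\<epsilon> * norm e \<ge> 0" using \<open>\<epsilon> > 0\<close> by simp
    ultimately show "\<epsilon> < r" "\<epsilon> * norm e < r" using \<open>\<epsilon> > 0\<close> r by linarith+
  qed
  have "(u, w - \<epsilon> *\<^sub>R e) \<in> ball k r" using \<epsilon> by (simp add: uw dist_Pair_Pair dist_norm)
  then have "w - \<epsilon> *\<^sub>R e \<in> cone_of_squares" using r by (auto simp: rtdet_cone_iff)
  then have w: "w \<in> pos_cone" by (rule pos_cone_of_shift[OF \<epsilon>(1)])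
  have "(u + \<epsilon>, w) \<in> ball k r" using \<epsilon> by (simp add: uw dist_Pair_Pair dist_norm)
  then have "u + \<epsilon> \<le> rtdet w" using r by (auto simp: rtdet_cone_iff)
  with w \<epsilon> show "k \<in> {(u, w). w \<in> pos_cone \<and> u < rtdet w}" by (simp add: uw)
qed

lemma spectral_scale:
  assumes C: "spectral_decomposition w C l"
  shows "spectral_decomposition (r *\<^sub>R w) C (\<lambda>c. r * l c)"
  using assms by (auto simp: spectral_decomposition_def scaleR_sum_right)

lemma jdet_scale: "jdet (r *\<^sub>R w) = r ^ jrank * jdet w"
proof -
  obtain C l where C: "spectral_decomposition w C l" by (rule spectral_decomposition_exists)
  show ?thesis
    by (simp add: jdet_eq[OF C] jdet_eq[OF spectral_scale[OF C]] prod.distrib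
        jrank_eq_card[OF spectral_frame[OF C]])
qed

lemma cone_of_squares_scale: "w \<in> cone_of_squares \<Longrightarrow> r \<ge> 0 \<Longrightarrow> r *\<^sub>R w \<in> cone_of_squares"
  unfolding cone_of_squares_dual by (simp add: T_simps)

lemma jdet_nonneg: "w \<in> cone_of_squares \<Longrightarrow> jdet w \<ge> 0"
  using jdet_pos[of w] jdet_boundary[of w] by (cases "w \<in> pos_cone") auto

lemma rtdet_scale:
  assumes "w \<in> cone_of_squares" "r \<ge> 0"
  shows "rtdet (r *\<^sub>R w) = r * rtdet w"
proof -
  have "(r ^ jrank) powr (1 / jrank) = r"
    using assms(2) jrank_pos by (cases "r = 0") (simp_all add: powr_powr flip: powr_realpow)
  then show ?thesis
    using assms jdet_nonneg by (simp add: rtdet_def jdet_scale powr_mult)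
qed

lemma cone_of_squares_pointed:
  assumes "w \<in> cone_of_squares" "- w \<in> cone_of_squares"
  shows "w = 0"
proof -
  obtain C l where C: "spectral_decomposition w C l" by (rule spectral_decomposition_exists)
  note S = spectral_scale[OF C, of "-1"]
  have "l c = 0" if "c \<in> C" for c
    using assms cone_of_squares_spectral[OF C] cone_of_squares_spectral[OF S] that by force
  then show ?thesis by (subst spectral_sum_eq[OF C]) simp
qed

lemma rtdet_cone_proper: "proper_cone rtdet_cone"
  unfolding proper_cone_def
proof (intro conjI rtdet_cone_closed rtdet_cone_convex)
  have zero: "0 \<in> cone_of_squares" unfolding cone_of_squares_dual by (simp add: T_simps)
  have rt0: "rtdet 0 = 0" using rtdet_scale[OF zero, of 0] by simp
  show "cone rtdet_cone"
    unfolding cone_def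
  proof clarify
    fix u w and r :: real assume "(u, w) \<in> rtdet_cone" "r \<ge> 0"
    then show "r *\<^sub>R (u, w) \<in> rtdet_cone"
      using cone_of_squares_scale[of w r] rtdet_scale[of w r] by (simp add: rtdet_cone_iff mult_left_mono)
  qed
  show "rtdet_cone \<inter> uminus ` rtdet_cone = {0}"
  proof (intro subset_antisym subsetI)
    fix k assume k: "k \<in> rtdet_cone \<inter> uminus ` rtdet_cone"
    obtain u w where uw: "k = (u, w)" by (cases k)
    have "(u, w) \<in> rtdet_cone" "(- u, - w) \<in> rtdet_cone" using k uw by auto
    then have "w \<in> cone_of_squares" "- w \<in> cone_of_squares" "u \<le> rtdet w" "- u \<le> rtdet (- w)"
      by (auto simp: rtdet_cone_iff)
    moreover from this have "w = 0" by (intro cone_of_squares_pointed)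
    ultimately show "k \<in> {0}" using rt0 by (simp add: uw zero_prod_def)
  next
    fix k :: "real \<times> 'v" assume "k \<in> {0}"
    moreover have "(0::real, 0::'v) \<in> rtdet_cone" by (simp add: rtdet_cone_iff zero rt0)
    ultimately show "k \<in> rtdet_cone \<inter> uminus ` rtdet_cone"
      by (auto simp: zero_prod_def intro!: image_eqI[of _ _ "(0, 0)"])
  qed
  have "(0, e) \<in> interior rtdet_cone"
    using unit_in_pos_cone rtdet_pos by (simp add: interior_rtdet_cone)
  then have "interior rtdet_cone \<noteq> {}" by blast
  then show "aff_dim rtdet_cone = int DIM(real \<times> 'v)" by (rule aff_dim_nonempty_interior)
qed

section \<open>Homogeneity, convexity and blow-up of the barrier\<close>

lemma rtdet_barrier_eq: "rtdet_barrier (u, w) = - ln (rtdet w - u) - logdet w"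
  by (simp add: rtdet_barrier_def rtdet_def logdet_def)

lemma rtdet_barrier_homogeneous:
  assumes "x \<in> interior rtdet_cone" "\<theta> > 0"
  shows "rtdet_barrier (\<theta> *\<^sub>R x) = rtdet_barrier x - (1 + real jrank) * ln \<theta>"
proof -
  obtain u w where x: "x = (u, w)" "w \<in> pos_cone" "u < rtdet w"
    using assms by (auto simp: interior_rtdet_cone)
  have "rtdet (\<theta> *\<^sub>R w) - \<theta> * u = \<theta> * (rtdet w - u)"
    using rtdet_scale[OF pos_cone_subset[OF x(2)], of \<theta>] assms by (simp add: algebra_simps)
  then have "ln (rtdet (\<theta> *\<^sub>R w) - \<theta> * u) = ln \<theta> + ln (rtdet w - u)"
    using assms x by (simp add: ln_mult)
  then show ?thesis
    using assms x jdet_pos[OF x(2)]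
    by (simp add: rtdet_barrier_eq logdet_def jdet_scale ln_mult ln_realpow algebra_simps)
qed

lemma rtdet_barrier_convex: "convex_on (interior rtdet_cone) rtdet_barrier"
proof (rule convex_onI)
  show "convex (interior rtdet_cone)" by (rule convex_interior[OF rtdet_cone_convex])
  fix t :: real and x y
  assume t: "0 < t" "t < 1" and xy: "x \<in> interior rtdet_cone" "y \<in> interior rtdet_cone"
  obtain u w where x: "x = (u, w)" "w \<in> pos_cone" "u < rtdet w"
    using xy by (auto simp: interior_rtdet_cone)
  obtain u' w' where y: "y = (u', w')" "w' \<in> pos_cone" "u' < rtdet w'"
    using xy by (auto simp: interior_rtdet_cone)
  define z where "z = (1 - t) *\<^sub>R w + t *\<^sub>R w'"
  have z: "z \<in> pos_cone"
    unfolding z_def using t x y by (intro pos_cone_add pos_cone_scale pos_cone_subset[OF pos_cone_scale]) auto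
  define h where "h = rtdet w - u"
  define h' where "h' = rtdet w' - u'"
  have h: "h > 0" "h' > 0" using x y by (auto simp: h_def h'_def)
  have "(1 - t) * rtdet w + t * rtdet w' \<le> (1 - t) * (rtdet z * (T (solve z e) w / jrank))
      + t * (rtdet z * (T (solve z e) w' / jrank))"
    using t rtdet_le[OF z pos_cone_subset[OF x(2)]] rtdet_le[OF z pos_cone_subset[OF y(2)]]
    by (intro add_mono mult_left_mono) auto
  also have "\<dots> = rtdet z * (T (solve z e) ((1 - t) *\<^sub>R w + t *\<^sub>R w') / jrank)"
    by (simp only: T.add_right T.scaleR_right add_divide_distrib) (simp add: algebra_simps)
  also have "\<dots> = rtdet z"
    using trace_solve_self[OF z] jrank_pos by (simp add: z_def[symmetric])
  finally have conc: "(1 - t) * h + t * h' \<le> rtdet z - ((1 - t) * u + t * u')"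
    by (simp add: h_def h'_def algebra_simps)
  have "(1 - t) * ln h + t * ln h' \<le> ln ((1 - t) * h + t * h')"
    using concave_onD[OF ln_concave, of t h h'] t h by simp
  also have "\<dots> \<le> ln (rtdet z - ((1 - t) * u + t * u'))"
    using conc t h by (intro ln_mono) (auto intro: add_pos_pos)
  finally have 1: "- ln (rtdet z - ((1 - t) * u + t * u')) \<le> (1 - t) * - ln h + t * - ln h'" by simp
  have "(1 - t) * logdet w + t * logdet w' \<le> (1 - t) * (logdet z + T (solve z e) (w - z))
      + t * (logdet z + T (solve z e) (w' - z))"
    using t logdet_le_linear[OF z x(2)] logdet_le_linear[OF z y(2)]
    by (intro add_mono mult_left_mono) auto
  also have "\<dots> = logdet z + T (solve z e) (((1 - t) *\<^sub>R w + t *\<^sub>R w') - z)"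
    by (simp add: T.add_right T.diff_right T.scaleR_right algebra_simps)
  finally have 2: "(1 - t) * logdet w + t * logdet w' \<le> logdet z" by (simp add: z_def[symmetric] T_simps)
  have "rtdet_barrier ((1 - t) *\<^sub>R x + t *\<^sub>R y) = - ln (rtdet z - ((1 - t) * u + t * u')) - logdet z"
    by (simp add: x y rtdet_barrier_eq z_def)
  also have "\<dots> \<le> (1 - t) * (- ln h - logdet w) + t * (- ln h' - logdet w')"
    using 1 2 by (simp add: algebra_simps)
  also have "\<dots> = (1 - t) * rtdet_barrier x + t * rtdet_barrier y"
    by (simp add: x y rtdet_barrier_eq h_def h'_def)
  finally show "rtdet_barrier ((1 - t) *\<^sub>R x + t *\<^sub>R y) \<le> (1 - t) * rtdet_barrier x + t * rtdet_barrier y" .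
qed

lemma logdet_eq_ln_rtdet: "x \<in> pos_cone \<Longrightarrow> logdet x = jrank * ln (rtdet x)"
  using jrank_pos by (simp add: rtdet_eq_exp)

text \<open>
At a boundary point with \<open>w\<close> in the open cone the gap \<open>rtdet w - u\<close> vanishes; otherwise \<open>rtdet w\<close>
vanishes. In both cases one logarithm tends to infinity and the other stays bounded below. Continuity of
\<open>rtdet\<close> at a boundary point of the cone of squares comes from the closedness of its hypograph.
\<close>

lemma rtdet_barrier_blows_up:
  assumes X: "\<And>i::nat. X i \<in> interior rtdet_cone" and lim: "X \<longlonglongrightarrow> b" and b: "b \<in> frontier rtdet_cone"
  shows "filterlim (\<lambda>i. rtdet_barrier (X i)) at_top sequentially"
proof -
  define U where "U i = fst (X i)" for i
  define W where "W i = snd (X i)" for i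
  obtain u w where uw: "b = (u, w)" by (cases b)
  have XW: "X i = (U i, W i)" "W i \<in> pos_cone" "U i < rtdet (W i)" for i
    using X[of i] by (auto simp: U_def W_def interior_rtdet_cone split: prod.splits)
  have U: "U \<longlonglongrightarrow> u" and W: "W \<longlonglongrightarrow> w"
    using tendsto_fst[OF lim] tendsto_snd[OF lim] by (auto simp: U_def[abs_def] W_def[abs_def] uw)
  have bK: "b \<in> rtdet_cone" "b \<notin> interior rtdet_cone"
    using b rtdet_cone_closed by (auto simp: frontier_def closure_closed)
  then have w: "w \<in> cone_of_squares" "u \<le> rtdet w" by (auto simp: uw rtdet_cone_iff)
  have gap: "(\<lambda>i. rtdet (W i) - U i) \<longlonglongrightarrow> rtdet w - u" and rt: "(\<lambda>i. rtdet (W i)) \<longlonglongrightarrow> rtdet w"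
  proof -
    show rt: "(\<lambda>i. rtdet (W i)) \<longlonglongrightarrow> rtdet w"
    proof (cases "w \<in> pos_cone")
      case True
      have "isCont rtdet w" using rtdet_continuous_on pos_cone_open True by (simp add: continuous_on_eq_continuous_at)
      then show ?thesis using W by (rule isCont_tendsto_compose)
    next
      case False
      show ?thesis
        unfolding rtdet_boundary[OF w(1) False]
      proof (rule order_tendstoI)
        show "\<forall>\<^sub>F i in sequentially. a < rtdet (W i)" if "a < 0" for a
          using that rtdet_nonneg by (intro always_eventually) (auto intro: less_le_trans)
        fix a :: real assume a: "0 < a"
        have "(a, w) \<in> - rtdet_cone" using a by (simp add: rtdet_cone_iff rtdet_boundary[OF w(1) False])
        moreover have "(\<lambda>i. (a, W i)) \<longlonglongrightarrow> (a, w)" using W by (intro tendsto_intros)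
        ultimately have "\<forall>\<^sub>F i in sequentially. (a, W i) \<in> - rtdet_cone"
          using rtdet_cone_closed by (intro topological_tendstoD) auto
        then show "\<forall>\<^sub>F i in sequentially. rtdet (W i) < a"
          by eventually_elim (use pos_cone_subset[OF XW(2)] in \<open>auto simp: rtdet_cone_iff\<close>)
      qed
    qed
    show "(\<lambda>i. rtdet (W i) - U i) \<longlonglongrightarrow> rtdet w - u" by (intro tendsto_diff rt U)
  qed
  have eq: "rtdet_barrier (X i) = - ln (rtdet (W i) - U i) + - (jrank * ln (rtdet (W i)))" for i
    by (simp add: XW rtdet_barrier_eq logdet_eq_ln_rtdet)
  have blow: "filterlim (\<lambda>i. - ln (h i)) at_top sequentially" if "h \<longlonglongrightarrow> 0" "\<And>i. h i > 0" for h :: "nat \<Rightarrow> real"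
  proof -
    have "h i \<noteq> 0" for i using that(2)[of i] by simp
    then have "filterlim h (at_right 0) sequentially"
      using that by (auto simp: filterlim_at intro!: always_eventually)
    then show ?thesis
      using filterlim_compose[OF ln_at_0] by (simp add: filterlim_uminus_at_top)
  qed
  have below: "\<exists>M. \<forall>\<^sub>F i in sequentially. - ln (h i) \<ge> M" if "h \<longlonglongrightarrow> a" "\<And>i. h i > 0" for h :: "nat \<Rightarrow> real" and a
  proof -
    have "\<forall>\<^sub>F i in sequentially. h i < \<bar>a\<bar> + 1" using that(1) by (rule order_tendstoD) simp
    then have "\<forall>\<^sub>F i in sequentially. - ln (h i) \<ge> - ln (\<bar>a\<bar> + 1)"
      by eventually_elim (use that(2) in \<open>simp add: less_imp_le\<close>)
    then show ?thesis by blast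
  qed
  show ?thesis
  proof (cases "w \<in> pos_cone")
    case True
    then have "rtdet w - u = 0" using bK w by (auto simp: uw interior_rtdet_cone)
    then have 1: "filterlim (\<lambda>i. - ln (rtdet (W i) - U i)) at_top sequentially"
      using gap XW(3) by (intro blow) auto
    obtain M where M: "\<forall>\<^sub>F i in sequentially. - ln (rtdet (W i)) \<ge> M"
      using below[OF rt] rtdet_pos XW(2) by blast
    then have "\<forall>\<^sub>F i in sequentially. - (jrank * ln (rtdet (W i))) \<ge> jrank * M"
      by eventually_elim (use mult_left_mono[of M _ "real jrank"] in fastforce)
    then show ?thesis unfolding eq by (rule filterlim_at_top_add_bounded_below[OF 1])
  next
    case False
    have "filterlim (\<lambda>i. - ln (rtdet (W i))) at_top sequentially"
      using rt rtdet_boundary[OF w(1) False] rtdet_pos XW(2) by (intro blow) auto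
    then have 1: "filterlim (\<lambda>i. jrank * - ln (rtdet (W i))) at_top sequentially"
      using jrank_pos by (intro filterlim_tendsto_pos_mult_at_top[OF tendsto_const]) auto
    obtain M where M: "\<forall>\<^sub>F i in sequentially. - ln (rtdet (W i) - U i) \<ge> M"
      using below[OF gap] XW(3) by (metis diff_gt_0_iff_gt)
    have "filterlim (\<lambda>i. jrank * - ln (rtdet (W i)) + - ln (rtdet (W i) - U i)) at_top sequentially"
      by (rule filterlim_at_top_add_bounded_below[OF 1 M])
    then show ?thesis unfolding eq by (simp add: add.commute)
  qed
qed

end

section \<open>Smoothness\<close>

lemma C_smooth_on_cong:
  assumes "open S" "\<And>x. x \<in> S \<Longrightarrow> f x = g x" "C_smooth_on n S f"
  shows "C_smooth_on n S g"
  using assms(2,3)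
proof (induction n arbitrary: f g)
  case 0
  then show ?case using continuous_on_cong[of S S f g] by simp
next
  case (Suc n)
  have der: "(g has_derivative frechet_derivative f (at x)) (at x)" if x: "x \<in> S" for x
  proof (rule has_derivative_transform_within_open[OF _ assms(1) x])
    show "(f has_derivative frechet_derivative f (at x)) (at x)"
      using Suc.prems(2) x frechet_derivative_works by auto
  qed (use Suc.prems in auto)
  have eq: "frechet_derivative f (at x) = frechet_derivative g (at x)" if "x \<in> S" for x
    by (rule frechet_derivative_at[OF der[OF that]])
  have "C_smooth_on n S (\<lambda>x. frechet_derivative g (at x) v)" for v
  proof (rule Suc.IH)
    show "C_smooth_on n S (\<lambda>x. frechet_derivative f (at x) v)" using Suc.prems(2) by simp
  qed (simp add: eq)
  moreover have "g differentiable at x" if "x \<in> S" for x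
    using der[OF that] by (auto simp: differentiable_def)
  ultimately show ?case by simp
qed

text \<open>
An explicitly given derivative may replace \<^const>\<open>frechet_derivative\<close>, provided that it is correct on an
open set.
\<close>

lemma C_smooth_on_SucI:
  assumes "open S" "\<And>x. x \<in> S \<Longrightarrow> (f has_derivative f' x) (at x)"
    and "\<And>v. C_smooth_on n S (\<lambda>x. f' x v)"
  shows "C_smooth_on (Suc n) S f"
proof -
  have "f' x = frechet_derivative f (at x)" if "x \<in> S" for x
    using assms(2)[OF that] frechet_derivative_at by blast
  then have "C_smooth_on n S (\<lambda>x. frechet_derivative f (at x) v)" for v
    by (intro C_smooth_on_cong[OF assms(1) _ assms(3)[of v]]) simp
  moreover have "f differentiable at x" if "x \<in> S" for x
    using assms(2)[OF that] by (auto simp: differentiable_def)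
  ultimately show ?thesis by simp
qed

lemma C_smooth_on_SucD:
  assumes "C_smooth_on (Suc n) S f"
  shows "x \<in> S \<Longrightarrow> (f has_derivative frechet_derivative f (at x)) (at x)"
    and "C_smooth_on n S (\<lambda>x. frechet_derivative f (at x) v)"
  using assms frechet_derivative_works by auto

lemma C_smooth_on_decrease: "C_smooth_on (Suc n) S f \<Longrightarrow> C_smooth_on n S f"
proof (induction n arbitrary: f)
  case 0
  then show ?case
    by (auto intro!: continuous_at_imp_continuous_on differentiable_imp_continuous_within)
next
  case (Suc n)
  then show ?case using C_smooth_on.simps(2) by blast
qed

lemma C_smooth_on_subset: "C_smooth_on n S f \<Longrightarrow> S' \<subseteq> S \<Longrightarrow> C_smooth_on n S' f"
  by (induction n arbitrary: f) (auto intro: continuous_on_subset)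

lemma C_smooth_on_const: "open S \<Longrightarrow> C_smooth_on n S (\<lambda>x. c)"
proof (induction n arbitrary: c)
  case (Suc n)
  then show ?case by (intro C_smooth_on_SucI[of S _ "\<lambda>x v. 0"]) auto
qed simp

lemma C_smooth_on_linear:
  assumes "open S" "bounded_linear f"
  shows "C_smooth_on n S f"
proof (cases n)
  case 0
  then show ?thesis using assms(2) by (simp add: linear_continuous_on)
next
  case (Suc m)
  show ?thesis unfolding Suc
    by (rule C_smooth_on_SucI[OF assms(1) bounded_linear_imp_has_derivative[OF assms(2)]])
      (rule C_smooth_on_const[OF assms(1)])
qed

lemma C_smooth_on_add:
  assumes "open S" "C_smooth_on n S f" "C_smooth_on n S g"
  shows "C_smooth_on n S (\<lambda>x. f x + g x)"
  using assms(2,3)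
proof (induction n arbitrary: f g)
  case (Suc n)
  note F = C_smooth_on_SucD[OF Suc.prems(1)] and G = C_smooth_on_SucD[OF Suc.prems(2)]
  show ?case
    by (rule C_smooth_on_SucI[OF assms(1) has_derivative_add[OF F(1) G(1)]])
      (auto intro!: Suc.IH F(2) G(2))
qed (auto intro: continuous_on_add)

lemma C_smooth_on_mult:
  fixes f g :: "'a::euclidean_space \<Rightarrow> real"
  assumes "open S" "C_smooth_on n S f" "C_smooth_on n S g"
  shows "C_smooth_on n S (\<lambda>x. f x * g x)"
  using assms(2,3)
proof (induction n arbitrary: f g)
  case (Suc n)
  note F = C_smooth_on_SucD[OF Suc.prems(1)] and G = C_smooth_on_SucD[OF Suc.prems(2)]
  show ?case
    by (rule C_smooth_on_SucI[OF assms(1) has_derivative_mult[OF F(1) G(1)]])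
      (auto intro!: C_smooth_on_add assms(1) Suc.IH F(2) G(2) C_smooth_on_decrease[OF Suc.prems(1)] C_smooth_on_decrease[OF Suc.prems(2)])
qed (auto intro: continuous_on_mult)

lemma C_smooth_on_cmult: "open S \<Longrightarrow> C_smooth_on n S f \<Longrightarrow> C_smooth_on n S (\<lambda>x. c * f x)"
  by (intro C_smooth_on_mult C_smooth_on_const)

lemma C_smooth_on_minus: "open S \<Longrightarrow> C_smooth_on n S f \<Longrightarrow> C_smooth_on n S (\<lambda>x. - f x)"
  using C_smooth_on_cmult[of S n f "-1"] by simp

lemma C_smooth_on_diff:
  "open S \<Longrightarrow> C_smooth_on n S f \<Longrightarrow> C_smooth_on n S g \<Longrightarrow> C_smooth_on n S (\<lambda>x. f x - g x)"
  using C_smooth_on_add[of S n f "\<lambda>x. - g x"] C_smooth_on_minus[of S n g] by simp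

lemma C_smooth_on_sum:
  assumes "open S" "\<And>i. i \<in> I \<Longrightarrow> C_smooth_on n S (f i)"
  shows "C_smooth_on n S (\<lambda>x. \<Sum>i\<in>I. f i x)"
  using assms(2)
  by (induction I rule: infinite_finite_induct)
    (auto intro: C_smooth_on_const C_smooth_on_add assms(1))

lemma C_smooth_on_exp:
  assumes "open S" "C_smooth_on n S f"
  shows "C_smooth_on n S (\<lambda>x. exp (f x))"
  using assms(2)
proof (induction n arbitrary: f)
  case (Suc n)
  note F = C_smooth_on_SucD[OF Suc.prems]
  have "((\<lambda>x. exp (f x)) has_derivative (\<lambda>v. exp (f x) * frechet_derivative f (at x) v)) (at x)"
    if "x \<in> S" for x
    by (rule has_derivative_eq_rhs[OF has_derivative_exp[OF F(1)[OF that]]]) (simp add: mult.commute)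
  moreover have "C_smooth_on n S (\<lambda>x. exp (f x) * frechet_derivative f (at x) v)" for v
    by (intro C_smooth_on_mult assms(1) Suc.IH F(2) C_smooth_on_decrease[OF Suc.prems])
  ultimately show ?case by (rule C_smooth_on_SucI[OF assms(1)])
qed (auto intro: continuous_on_exp)

lemma C_smooth_on_inverse:
  fixes f :: "'a::euclidean_space \<Rightarrow> real"
  assumes "open S" "C_smooth_on n S f" "\<And>x. x \<in> S \<Longrightarrow> f x \<noteq> 0"
  shows "C_smooth_on n S (\<lambda>x. inverse (f x))"
  using assms(2,3)
proof (induction n arbitrary: f)
  case (Suc n)
  note F = C_smooth_on_SucD[OF Suc.prems(1)]
  have "((\<lambda>x. inverse (f x)) has_derivative
      (\<lambda>v. - (inverse (f x) * frechet_derivative f (at x) v * inverse (f x)))) (at x)"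
    if "x \<in> S" for x
    by (rule Deriv.has_derivative_inverse[OF Suc.prems(2)[OF that] F(1)[OF that]])
  moreover have "C_smooth_on n S (\<lambda>x. - (inverse (f x) * frechet_derivative f (at x) v * inverse (f x)))" for v
    by (intro C_smooth_on_mult C_smooth_on_minus assms(1) Suc.IH F(2) C_smooth_on_decrease[OF Suc.prems(1)] Suc.prems(2))
  ultimately show ?case by (rule C_smooth_on_SucI[OF assms(1)])
qed (auto intro: continuous_on_inverse)

lemma C_smooth_on_ln:
  assumes "open S" "C_smooth_on n S f" "\<And>x. x \<in> S \<Longrightarrow> f x > 0"
  shows "C_smooth_on n S (\<lambda>x. ln (f x))"
proof (cases n)
  case 0
  then show ?thesis using assms(2,3) by (auto intro!: continuous_on_ln simp: less_imp_neq[symmetric] dest: less_imp_neq)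
next
  case (Suc m)
  note F = C_smooth_on_SucD[OF assms(2)[unfolded Suc]]
  have der: "((\<lambda>x. ln (f x)) has_derivative (\<lambda>v. frechet_derivative f (at x) v * inverse (f x))) (at x)"
    if "x \<in> S" for x
    using has_derivative_ln[OF assms(3)[OF that] F(1)[OF that]] by simp
  have "f x \<noteq> 0" if "x \<in> S" for x using assms(3)[OF that] by simp
  then have "C_smooth_on m S (\<lambda>x. frechet_derivative f (at x) v * inverse (f x))" for v
    by (intro C_smooth_on_mult C_smooth_on_inverse assms(1) F(2)
        C_smooth_on_decrease[OF assms(2)[unfolded Suc]])
  with der show ?thesis unfolding Suc by (rule C_smooth_on_SucI[OF assms(1)])
qed

lemma C_smooth_on_snd:
  fixes f :: "'b::euclidean_space \<Rightarrow> real"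
  assumes "open S" "C_smooth_on n S f"
  shows "C_smooth_on n (UNIV \<times> S) (\<lambda>k :: 'a::euclidean_space \<times> 'b. f (snd k))"
  using assms(2)
proof (induction n arbitrary: f)
  case 0
  have "continuous_on (UNIV \<times> S) (\<lambda>k :: 'a \<times> 'b. f (snd k))"
  proof (rule continuous_on_compose2[of S f _ snd])
    show "continuous_on S f" using 0 by simp
    show "continuous_on (UNIV \<times> S) (snd :: 'a \<times> 'b \<Rightarrow> 'b)" by (intro continuous_intros)
  qed auto
  then show ?case by simp
next
  case (Suc n)
  note F = C_smooth_on_SucD[OF Suc.prems]
  have "open (UNIV \<times> S :: ('a \<times> 'b) set)" using assms(1) by (intro open_Times) auto
  then show ?case
  proof (rule C_smooth_on_SucI)
    fix k :: "'a \<times> 'b" assume "k \<in> UNIV \<times> S"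
    then have "snd k \<in> S" by auto
    from has_derivative_compose[OF has_derivative_snd[OF has_derivative_ident] F(1)[OF this]]
    show "((\<lambda>k. f (snd k)) has_derivative (\<lambda>v. frechet_derivative f (at (snd k)) (snd v))) (at k)" .
  next
    show "C_smooth_on n (UNIV \<times> S) (\<lambda>k :: 'a \<times> 'b. frechet_derivative f (at (snd k)) (snd v))" for v :: "'a \<times> 'b"
      by (rule Suc.IH[OF F(2)])
  qed
qed

lemma nabla_smooth:
  "C_smooth_on (n + k) S f \<Longrightarrow> C_smooth_on n S (\<lambda>y. nabla k f y p)"
proof (induction k arbitrary: n)
  case (Suc k)
  then have "C_smooth_on (Suc n) S (\<lambda>y. nabla k f y p)" by (intro Suc.IH) simp
  then show ?case using C_smooth_on_SucD(2) by simp
qed simp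

text \<open>
Repeated differentiation in a fixed direction can be computed along the line through the point in this
direction, where the derivatives are given by functions \<open>\<eta> k\<close> of one real variable.
\<close>

lemma nabla_along_line:
  assumes smooth: "C_smooth_on N S f"
    and line: "\<And>t. \<bar>t\<bar> < \<epsilon> \<Longrightarrow> x + t *\<^sub>R p \<in> S"
    and \<eta>0: "\<And>t. \<bar>t\<bar> < \<epsilon> \<Longrightarrow> \<eta> 0 t = f (x + t *\<^sub>R p)"
    and \<eta>: "\<And>k t. k < N \<Longrightarrow> \<bar>t\<bar> < \<epsilon> \<Longrightarrow> (\<eta> k has_real_derivative \<eta> (Suc k) t) (at t)"
    and k: "k \<le> N" and t: "\<bar>t\<bar> < \<epsilon>"
  shows "nabla k f (x + t *\<^sub>R p) p = \<eta> k t"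
  using k t
proof (induction k arbitrary: t)
  case 0
  then show ?case using \<eta>0 by simp
next
  case (Suc k)
  let ?g = "\<lambda>y. nabla k f y p"
  let ?y = "x + t *\<^sub>R p"
  have "C_smooth_on (Suc 0) S ?g"
  proof -
    have "C_smooth_on (N - k) S ?g" using smooth Suc.prems by (intro nabla_smooth) simp
    moreover have "C_smooth_on m S ?g \<Longrightarrow> m \<ge> Suc 0 \<Longrightarrow> C_smooth_on (Suc 0) S ?g" for m
      by (induction m) (auto simp: le_Suc_eq dest: C_smooth_on_decrease simp del: C_smooth_on.simps)
    ultimately show ?thesis using Suc.prems by auto
  qed
  then have g: "(?g has_derivative frechet_derivative ?g (at ?y)) (at ?y)"
    using C_smooth_on_SucD(1) line[OF Suc.prems(2)] by blast
  have "((\<lambda>s. x + s *\<^sub>R p) has_derivative (\<lambda>s. s *\<^sub>R p)) (at t)"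
    by (auto intro!: derivative_eq_intros)
  from has_derivative_compose[OF this g]
  have "((\<lambda>s. ?g (x + s *\<^sub>R p)) has_derivative (\<lambda>s. frechet_derivative ?g (at ?y) (s *\<^sub>R p))) (at t)" .
  moreover have "(\<lambda>s. frechet_derivative ?g (at ?y) (s *\<^sub>R p)) = (\<lambda>s. frechet_derivative ?g (at ?y) p * s)"
    using linear_scale[OF has_derivative_linear[OF g]] by (auto simp: mult.commute)
  ultimately have 1: "((\<lambda>s. ?g (x + s *\<^sub>R p)) has_real_derivative frechet_derivative ?g (at ?y) p) (at t)"
    by (simp add: has_field_derivative_def)
  have "((\<lambda>s. ?g (x + s *\<^sub>R p)) has_real_derivative \<eta> (Suc k) t) (at t)"
  proof (rule has_field_derivative_transform_within_open[of "\<eta> k"])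
    show "(\<eta> k has_real_derivative \<eta> (Suc k) t) (at t)" using \<eta> Suc.prems by auto
    show "open {-\<epsilon><..<\<epsilon>}" by simp
    show "t \<in> {-\<epsilon><..<\<epsilon>}" using Suc.prems by auto
    show "\<eta> k s = ?g (x + s *\<^sub>R p)" if "s \<in> {-\<epsilon><..<\<epsilon>}" for s
      using Suc.IH[of s] Suc.prems that by auto
  qed
  then show ?case using DERIV_unique[OF 1] by simp
qed

context trace_form
begin

text \<open>
The derivative of \<open>L(x)\<^sup>-\<^sup>1 v\<close> in direction \<open>p\<close> is \<open>- L(x)\<^sup>-\<^sup>1 L(p) L(x)\<^sup>-\<^sup>1 v\<close>. Expanding
\<open>L(x)\<^sup>-\<^sup>1 v\<close> in a basis writes it as a sum of products of functions of the same shape, which closes the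
induction over the order of differentiability.
\<close>

lemma solve_smooth:
  "bounded_linear \<phi> \<Longrightarrow> C_smooth_on n pos_cone (\<lambda>x. \<phi> (solve x v))"
proof (induction n arbitrary: \<phi> v)
  case 0
  have "continuous_on pos_cone (\<lambda>x. solve x v)"
    by (intro continuous_at_imp_continuous_on ballI has_derivative_continuous[OF solve_has_derivative])
  then show ?case using bounded_linear.continuous_on[OF 0] by simp
next
  case (Suc n)
  interpret \<phi>: bounded_linear \<phi> by (rule Suc.prems)
  show ?case
  proof (rule C_smooth_on_SucI[OF pos_cone_open])
    fix x assume x: "x \<in> pos_cone"
    show "((\<lambda>x. \<phi> (solve x v)) has_derivative (\<lambda>p. - (\<Sum>b\<in>Basis. (solve x v \<bullet> b) * \<phi> (solve x (p \<odot> b))))) (at x)"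
    proof (rule has_derivative_eq_rhs[OF \<phi>.has_derivative[OF solve_has_derivative[OF x]]])
      show "(\<lambda>p. \<phi> (- solve x (p \<odot> solve x v))) = (\<lambda>p. - (\<Sum>b\<in>Basis. (solve x v \<bullet> b) * \<phi> (solve x (p \<odot> b))))"
      proof
        fix p
        have "p \<odot> solve x v = p \<odot> (\<Sum>b\<in>Basis. (solve x v \<bullet> b) *\<^sub>R b)" by (simp add: euclidean_representation)
        also have "\<dots> = (\<Sum>b\<in>Basis. (solve x v \<bullet> b) *\<^sub>R (p \<odot> b))" by (simp add: J.sum_right J_simps)
        finally show "\<phi> (- solve x (p \<odot> solve x v)) = - (\<Sum>b\<in>Basis. (solve x v \<bullet> b) * \<phi> (solve x (p \<odot> b)))"
          by (simp add: linear_sum[OF solve_linear[OF x]] linear_scale[OF solve_linear[OF x]] \<phi>.neg \<phi>.sum \<phi>.scaleR)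
      qed
    qed
  next
    show "C_smooth_on n pos_cone (\<lambda>x. - (\<Sum>b\<in>Basis. (solve x v \<bullet> b) * \<phi> (solve x (p \<odot> b))))" for p
      by (intro C_smooth_on_minus C_smooth_on_sum C_smooth_on_mult pos_cone_open Suc.IH Suc.prems
          bounded_linear_inner_left)
  qed
qed

lemma logdet_smooth: "C_smooth_on n pos_cone logdet"
proof (rule C_smooth_on_decrease, rule C_smooth_on_SucI[OF pos_cone_open logdet_has_derivative])
  show "C_smooth_on n pos_cone (\<lambda>x. T (solve x e) v)" for v
    by (rule solve_smooth[OF T.bounded_linear_left])
qed

lemma rtdet_smooth: "C_smooth_on n pos_cone rtdet"
proof (rule C_smooth_on_cong[OF pos_cone_open])
  show "C_smooth_on n pos_cone (\<lambda>x. exp ((1 / jrank) * logdet x))"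
    by (intro C_smooth_on_exp C_smooth_on_cmult pos_cone_open logdet_smooth)
qed (simp add: rtdet_eq_exp)

lemma rtdet_barrier_smooth: "C_smooth_on n (interior rtdet_cone) rtdet_barrier"
proof (rule C_smooth_on_cong[OF open_interior])
  have sub: "interior rtdet_cone \<subseteq> UNIV \<times> pos_cone" by (auto simp: interior_rtdet_cone)
  have pos: "rtdet (snd k) - fst k > 0" if "k \<in> interior rtdet_cone" for k
    using that by (auto simp: interior_rtdet_cone)
  have "C_smooth_on n (interior rtdet_cone) (\<lambda>k. rtdet (snd k))" "C_smooth_on n (interior rtdet_cone) (\<lambda>k. logdet (snd k))"
    using C_smooth_on_subset[OF C_smooth_on_snd[OF pos_cone_open rtdet_smooth] sub]
      C_smooth_on_subset[OF C_smooth_on_snd[OF pos_cone_open logdet_smooth] sub] by auto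
  then show "C_smooth_on n (interior rtdet_cone) (\<lambda>k. - ln (rtdet (snd k) - fst k) - logdet (snd k))"
    by (intro C_smooth_on_diff C_smooth_on_minus C_smooth_on_ln open_interior pos
        C_smooth_on_linear[OF open_interior bounded_linear_fst])
qed (auto simp: rtdet_barrier_eq)

section \<open>Transport from the identity element\<close>

text \<open>
The operator \<open>exp (\<theta> L(c))\<close> for an idempotent \<open>c\<close>, written through its three spectral projections: the
brackets are the components of \<open>v\<close> for the eigenvalues \<open>0\<close>, \<open>1/2\<close> and \<open>1\<close> of \<open>L(c)\<close>.
\<close>

definition flow :: "'v \<Rightarrow> real \<Rightarrow> 'v \<Rightarrow> 'v" where
  "flow c \<theta> v = (v - 3 *\<^sub>R (c \<odot> v) + 2 *\<^sub>R (c \<odot> (c \<odot> v)))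
    + exp (\<theta> / 2) *\<^sub>R (4 *\<^sub>R (c \<odot> v - c \<odot> (c \<odot> v))) + exp \<theta> *\<^sub>R (2 *\<^sub>R (c \<odot> (c \<odot> v)) - c \<odot> v)"

lemma flow_0: "flow c 0 v = v"
  by (rule euclidean_eqI) (simp add: flow_def inner_simps algebra_simps)

lemma flow_linear: "linear (flow c \<theta>)"
  by (intro linearI) (simp_all add: flow_def J_simps algebra_simps)

lemma peirce_components:
  assumes c: "c \<odot> c = c"
  shows "c \<odot> (v - 3 *\<^sub>R (c \<odot> v) + 2 *\<^sub>R (c \<odot> (c \<odot> v))) = 0"
    and "c \<odot> (4 *\<^sub>R (c \<odot> v - c \<odot> (c \<odot> v))) = (1/2) *\<^sub>R (4 *\<^sub>R (c \<odot> v - c \<odot> (c \<odot> v)))"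
    and "c \<odot> (2 *\<^sub>R (c \<odot> (c \<odot> v)) - c \<odot> v) = 2 *\<^sub>R (c \<odot> (c \<odot> v)) - c \<odot> v"
proof -
  have cub: "2 * ((c \<odot> (c \<odot> (c \<odot> v))) \<bullet> b) = 3 * ((c \<odot> (c \<odot> v)) \<bullet> b) - (c \<odot> v) \<bullet> b" for b
    using arg_cong[OF peirce_cubic[OF c, of v], of "\<lambda>u. u \<bullet> b"] by (simp add: inner_simps)
  show "c \<odot> (v - 3 *\<^sub>R (c \<odot> v) + 2 *\<^sub>R (c \<odot> (c \<odot> v))) = 0"
    by (rule euclidean_eqI) (simp add: J_simps inner_simps cub)
  show "c \<odot> (4 *\<^sub>R (c \<odot> v - c \<odot> (c \<odot> v))) = (1/2) *\<^sub>R (4 *\<^sub>R (c \<odot> v - c \<odot> (c \<odot> v)))"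
  proof (rule euclidean_eqI)
    fix b :: 'v
    show "(c \<odot> (4 *\<^sub>R (c \<odot> v - c \<odot> (c \<odot> v)))) \<bullet> b = ((1/2) *\<^sub>R (4 *\<^sub>R (c \<odot> v - c \<odot> (c \<odot> v)))) \<bullet> b"
      using cub[of b] by (simp add: J_simps inner_simps)
  qed
  show "c \<odot> (2 *\<^sub>R (c \<odot> (c \<odot> v)) - c \<odot> v) = 2 *\<^sub>R (c \<odot> (c \<odot> v)) - c \<odot> v"
    by (rule euclidean_eqI) (simp add: J_simps inner_simps cub)
qed

lemma mult_flow:
  assumes "c \<odot> c = c"
  shows "c \<odot> flow c \<theta> v = (exp (\<theta> / 2) / 2) *\<^sub>R (4 *\<^sub>R (c \<odot> v - c \<odot> (c \<odot> v)))
    + exp \<theta> *\<^sub>R (2 *\<^sub>R (c \<odot> (c \<odot> v)) - c \<odot> v)"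
proof -
  define h where "h = 4 *\<^sub>R (c \<odot> v - c \<odot> (c \<odot> v))"
  define q where "q = 2 *\<^sub>R (c \<odot> (c \<odot> v)) - c \<odot> v"
  define r where "r = v - 3 *\<^sub>R (c \<odot> v) + 2 *\<^sub>R (c \<odot> (c \<odot> v))"
  have "c \<odot> r = 0" "c \<odot> h = (1/2) *\<^sub>R h" "c \<odot> q = q"
    unfolding h_def q_def r_def by (rule peirce_components[OF assms])+
  then have "c \<odot> (r + exp (\<theta> / 2) *\<^sub>R h + exp \<theta> *\<^sub>R q) = (exp (\<theta> / 2) / 2) *\<^sub>R h + exp \<theta> *\<^sub>R q"
    by (simp add: J_simps)
  then show ?thesis unfolding flow_def h_def q_def r_def .
qed

lemma flow_inverse:
  assumes c: "c \<odot> c = c"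
  shows "flow c \<theta> (flow c (- \<theta>) v) = v"
proof -
  define h where "h = 4 *\<^sub>R (c \<odot> v - c \<odot> (c \<odot> v))"
  define q where "q = 2 *\<^sub>R (c \<odot> (c \<odot> v)) - c \<odot> v"
  define r where "r = v - 3 *\<^sub>R (c \<odot> v) + 2 *\<^sub>R (c \<odot> (c \<odot> v))"
  have h: "c \<odot> h = (1/2) *\<^sub>R h" and q: "c \<odot> q = q"
    unfolding h_def q_def by (rule peirce_components[OF c])+
  define u where "u = flow c (- \<theta>) v"
  have u: "u = r + exp (- \<theta> / 2) *\<^sub>R h + exp (- \<theta>) *\<^sub>R q"
    by (simp add: u_def flow_def h_def q_def r_def)
  have cu: "c \<odot> u = (exp (- \<theta> / 2) / 2) *\<^sub>R h + exp (- \<theta>) *\<^sub>R q"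
    unfolding u_def mult_flow[OF c] h_def q_def ..
  have ccu: "c \<odot> (c \<odot> u) = (exp (- \<theta> / 2) / 4) *\<^sub>R h + exp (- \<theta>) *\<^sub>R q"
    unfolding cu by (simp add: J_simps h q)
  have e1: "exp (\<theta> / 2) * exp (- \<theta> / 2) = 1" "exp \<theta> * exp (- \<theta>) = 1"
    by (simp_all flip: exp_add)
  have 1: "u - 3 *\<^sub>R (c \<odot> u) + 2 *\<^sub>R (c \<odot> (c \<odot> u)) = r"
    unfolding ccu unfolding cu by (rule euclidean_eqI) (simp add: u inner_simps algebra_simps)
  have 2: "4 *\<^sub>R (c \<odot> u - c \<odot> (c \<odot> u)) = exp (- \<theta> / 2) *\<^sub>R h"
    unfolding ccu unfolding cu by (rule euclidean_eqI) (simp add: inner_simps algebra_simps)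
  have 3: "2 *\<^sub>R (c \<odot> (c \<odot> u)) - c \<odot> u = exp (- \<theta>) *\<^sub>R q"
    unfolding ccu unfolding cu by (rule euclidean_eqI) (simp add: inner_simps algebra_simps)
  have "flow c \<theta> u = r + h + q"
    unfolding flow_def 1 2 3 scaleR_scaleR e1 by simp
  also have "\<dots> = v"
    by (rule euclidean_eqI) (simp add: r_def h_def q_def inner_simps algebra_simps)
  finally show ?thesis by (simp add: u_def)
qed

lemma flow_has_derivative:
  assumes c: "c \<odot> c = c"
  shows "((\<lambda>s. flow c (s * \<theta>) v) has_derivative (\<lambda>h. h *\<^sub>R (\<theta> *\<^sub>R (c \<odot> flow c (s * \<theta>) v)))) (at s)"
proof -
  define h where "h = 4 *\<^sub>R (c \<odot> v - c \<odot> (c \<odot> v))"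
  define q where "q = 2 *\<^sub>R (c \<odot> (c \<odot> v)) - c \<odot> v"
  define r where "r = v - 3 *\<^sub>R (c \<odot> v) + 2 *\<^sub>R (c \<odot> (c \<odot> v))"
  have "((\<lambda>s. r + exp (s * \<theta> / 2) *\<^sub>R h + exp (s * \<theta>) *\<^sub>R q) has_derivative
      (\<lambda>k. k *\<^sub>R (\<theta> *\<^sub>R ((exp (s * \<theta> / 2) / 2) *\<^sub>R h + exp (s * \<theta>) *\<^sub>R q)))) (at s)"
    by (auto intro!: derivative_eq_intros simp: algebra_simps)
  then show ?thesis
    unfolding mult_flow[OF c] unfolding flow_def h_def q_def r_def .
qed

text \<open>
Along the flow the derivative of the logarithm of the determinant is \<open>\<theta> T (y\<^sup>-\<^sup>1) (c \<odot> y)\<close>, which equals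
\<open>\<theta> T e c = \<theta>\<close> by associativity of the trace form.
\<close>

lemma logdet_along_flow:
  assumes c: "primitive_idempotent c" and b: "b > 0"
    and pos: "\<And>s. 0 \<le> s \<Longrightarrow> s \<le> b \<Longrightarrow> flow c (s * \<theta>) y \<in> pos_cone"
  shows "logdet (flow c (b * \<theta>) y) = logdet y + b * \<theta>"
proof -
  have cc: "c \<odot> c = c" using c by (simp add: primitive_idempotent_def idempotent_def)
  define D where "D s = logdet (flow c (s * \<theta>) y) - s * \<theta>" for s
  have der: "DERIV D s :> 0" if s: "0 \<le> s" "s \<le> b" for s
  proof -
    let ?y = "flow c (s * \<theta>) y"
    have y: "?y \<in> pos_cone" using pos s by simp
    have "T (solve ?y e) (c \<odot> ?y) = T (?y \<odot> solve ?y e) c"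
      by (simp only: T_assoc commute[of c])
    also have "\<dots> = 1" using trace_primitive[OF c] by (simp add: mult_solve[OF y] T_sym[of e])
    finally have 1: "T (solve ?y e) (c \<odot> ?y) = 1" .
    have "((\<lambda>s. logdet (flow c (s * \<theta>) y)) has_derivative
        (\<lambda>h. T (solve ?y e) (h *\<^sub>R (\<theta> *\<^sub>R (c \<odot> ?y))))) (at s)"
      by (rule has_derivative_compose[OF flow_has_derivative[OF cc] logdet_has_derivative[OF y]])
    then have "((\<lambda>s. logdet (flow c (s * \<theta>) y)) has_real_derivative \<theta>) (at s)"
      by (simp add: has_field_derivative_def T.scaleR_right 1 mult_commute_abs)
    then show ?thesis
      unfolding D_def by (auto intro!: derivative_eq_intros)
  qed
  have "D b = D 0"
  proof (rule DERIV_isconst_end[OF b])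
    show "continuous_on {0..b} D"
      using der by (intro continuous_at_imp_continuous_on ballI DERIV_isCont) auto
    show "DERIV D s :> 0" if "0 < s" "s < b" for s using der that by simp
  qed
  then show ?thesis by (simp add: D_def flow_0)
qed

text \<open>
The flow cannot leave the open cone. Up to a first exit time \<open>s0\<close> the determinant changes by a factor
\<open>exp (s \<theta>)\<close>, so it stays away from zero, while it would have to vanish at the exit point.
\<close>

lemma flow_pos_cone:
  assumes c: "primitive_idempotent c" and y: "y \<in> pos_cone"
  shows "flow c \<theta> y \<in> pos_cone" "logdet (flow c \<theta> y) = logdet y + \<theta>"
proof -
  have cc: "c \<odot> c = c" using c by (simp add: primitive_idempotent_def idempotent_def)
  let ?y = "\<lambda>s. flow c (s * \<theta>) y"
  have cont: "continuous_on UNIV ?y"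
    using has_derivative_continuous[OF flow_has_derivative[OF cc]]
    by (intro continuous_at_imp_continuous_on) auto
  have all: "?y s \<in> pos_cone" if s: "0 \<le> s" "s \<le> 1" for s
  proof (rule ccontr)
    assume not: "?y s \<notin> pos_cone"
    define A where "A = {0..1} \<inter> ?y -` (- pos_cone)"
    have "closed (?y -` (- pos_cone))"
      using pos_cone_open by (intro closed_vimage cont) auto
    then have "closed A" unfolding A_def by (intro closed_Int) auto
    moreover have "A \<noteq> {}" "bdd_below A" using not s by (auto simp: A_def)
    ultimately have inf: "Inf A \<in> A" by (intro closed_contains_Inf)
    define s0 where "s0 = Inf A"
    have s0: "0 \<le> s0" "s0 \<le> 1" "?y s0 \<notin> pos_cone" using inf by (auto simp: A_def s0_def)
    have "s0 \<noteq> 0" using s0(3) y by (auto simp: flow_0)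
    with s0 have s0pos: "s0 > 0" by simp
    have before: "?y r \<in> pos_cone" if r: "0 \<le> r" "r < s0" for r
    proof (rule ccontr)
      assume "?y r \<notin> pos_cone"
      then have "r \<in> A" using r s0 by (simp add: A_def)
      then have "s0 \<le> r" unfolding s0_def using \<open>bdd_below A\<close> by (rule cInf_lower)
      then show False using r by simp
    qed
    \<comment> \<open>A lower bound for the root of the determinant before the exit time, hence by closedness of the
      hypograph also at the exit time.\<close>
    define \<delta> where "\<delta> = exp ((logdet y - \<bar>\<theta>\<bar>) / jrank)"
    have low: "(\<delta>, ?y r) \<in> rtdet_cone" if r: "0 \<le> r" "r < s0" for r
    proof -
      have "logdet (?y r) = logdet y + r * \<theta>"
        using logdet_along_flow[OF c, of r \<theta> y] before r by (cases "r = 0") (auto simp: flow_0)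
      moreover have "\<bar>r * \<theta>\<bar> \<le> \<bar>\<theta>\<bar>"
        using r s0 mult_right_mono[of r 1 "\<bar>\<theta>\<bar>"] by (simp add: abs_mult)
      ultimately have "(logdet y - \<bar>\<theta>\<bar>) / jrank \<le> logdet (?y r) / jrank"
        by (intro divide_right_mono) auto
      then show ?thesis
        using before[OF r] pos_cone_subset by (simp add: rtdet_cone_iff rtdet_eq_exp \<delta>_def)
    qed
    have "closed ((\<lambda>r. (\<delta>, ?y r)) -` rtdet_cone)"
      by (intro closed_vimage rtdet_cone_closed continuous_on_Pair continuous_on_const cont)
    then have "closure {0..<s0} \<subseteq> (\<lambda>r. (\<delta>, ?y r)) -` rtdet_cone"
      using low by (intro closure_minimal) auto
    moreover have "s0 \<in> closure {0..<s0}" using s0pos by simp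
    ultimately have "(\<delta>, ?y s0) \<in> rtdet_cone" by blast
    then have "?y s0 \<in> cone_of_squares" "\<delta> \<le> rtdet (?y s0)" by (auto simp: rtdet_cone_iff)
    moreover have "\<delta> > 0" by (simp add: \<delta>_def)
    ultimately show False using rtdet_boundary[of "?y s0"] s0(3) by simp
  qed
  show "flow c \<theta> y \<in> pos_cone" using all[of 1] by simp
  show "logdet (flow c \<theta> y) = logdet y + \<theta>"
    using logdet_along_flow[OF c, of 1 \<theta> y] all by simp
qed

lemma flow_frame:
  assumes C: "jordan_frame C" "a \<in> C" "c \<in> C"
  shows "flow a \<theta> c = (if c = a then exp \<theta> *\<^sub>R c else c)"
proof (cases "c = a")
  case True
  then have "a \<odot> c = c" using frame_facts(3)[OF C(1,2)] by simp
  then have "flow a \<theta> c = exp \<theta> *\<^sub>R c"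
    by (subst euclidean_eq_iff) (simp add: flow_def inner_simps)
  then show ?thesis using True by simp
next
  case False
  then have "a \<odot> c = 0" using frame_facts(5)[OF C(1,2,3)] by simp
  then show ?thesis using False by (simp add: flow_def J_simps)
qed

text \<open>
The flows of the members of a frame of \<open>x\<close>, run for the times \<open>ln (l c)\<close>, rescale the members of the
frame one after the other and so move \<open>e\<close> to \<open>x\<close>.
\<close>

lemma transport_from_unit:
  assumes x: "x \<in> pos_cone"
  obtains g where "linear g" "surj g" "g e = x"
    "\<And>y. y \<in> pos_cone \<Longrightarrow> g y \<in> pos_cone \<and> logdet (g y) = logdet x + logdet y"
proof -
  obtain C l where C: "spectral_decomposition x C l" by (rule spectral_decomposition_exists)
  note Cf = spectral_frame[OF C]
  have l: "l c > 0" if "c \<in> C" for c using pos_cone_spectral[OF C] x that by blast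
  have "D \<subseteq> C \<Longrightarrow> \<exists>g. linear g \<and> surj g \<and> g e = (\<Sum>c\<in>C. (if c \<in> D then l c else 1) *\<^sub>R c) \<and>
      (\<forall>y\<in>pos_cone. g y \<in> pos_cone \<and> logdet (g y) = (\<Sum>c\<in>D. ln (l c)) + logdet y)" if "finite D" for D
    using that
  proof (induction D)
    case empty
    show ?case
      by (intro exI[of _ "\<lambda>y. y"]) (simp add: linear_id[unfolded id_def] frame_facts(6)[OF Cf])
  next
    case (insert a D)
    then obtain g where g: "linear g" "surj g" "g e = (\<Sum>c\<in>C. (if c \<in> D then l c else 1) *\<^sub>R c)"
      "\<And>y. y \<in> pos_cone \<Longrightarrow> g y \<in> pos_cone \<and> logdet (g y) = (\<Sum>c\<in>D. ln (l c)) + logdet y" by auto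
    have a: "a \<in> C" "primitive_idempotent a" "a \<odot> a = a"
      using insert.prems frame_facts[OF Cf] by auto
    let ?f = "flow a (ln (l a))"
    have "surj ?f" by (rule surjI[of _ "flow a (- ln (l a))"]) (rule flow_inverse[OF a(3)])
    then have s: "surj (?f \<circ> g)" using g(2) by (rule comp_surj[rotated])
    have "(?f \<circ> g) e = (\<Sum>c\<in>C. (if c \<in> insert a D then l c else 1) *\<^sub>R c)"
      unfolding comp_def g(3) linear_sum[OF flow_linear]
    proof (intro sum.cong refl)
      fix c assume c: "c \<in> C"
      show "?f ((if c \<in> D then l c else 1) *\<^sub>R c) = (if c \<in> insert a D then l c else 1) *\<^sub>R c"
        using insert.hyps l[OF c] by (auto simp: linear_scale[OF flow_linear] flow_frame[OF Cf a(1) c])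
    qed
    moreover have "linear (?f \<circ> g)" by (rule linear_compose[OF g(1) flow_linear])
    moreover have "(?f \<circ> g) y \<in> pos_cone \<and> logdet ((?f \<circ> g) y) = (\<Sum>c\<in>insert a D. ln (l c)) + logdet y"
      if "y \<in> pos_cone" for y
      using g(4)[OF that] flow_pos_cone[OF a(2)] insert.hyps by simp
    ultimately show ?case using s by blast
  qed
  from this[OF frame_facts(1)[OF Cf] subset_refl] obtain g where
    g: "linear g" "surj g" "g e = (\<Sum>c\<in>C. (if c \<in> C then l c else 1) *\<^sub>R c)"
      "\<And>y. y \<in> pos_cone \<Longrightarrow> g y \<in> pos_cone \<and> logdet (g y) = (\<Sum>c\<in>C. ln (l c)) + logdet y" by blast
  have "g e = x" unfolding g(3) by (subst spectral_sum_eq[OF C]) (intro sum.cong, auto)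
  then show ?thesis using that[of g] g logdet_spectral[OF C x] by simp
qed

text \<open>
Hyperbolicity of the determinant in every direction \<open>p\<close>. Pulling the line back to the identity element
reduces it to \<open>e + t q\<close>, whose eigenvalues are \<open>1 + t \<mu> b\<close> for the eigenvalues \<open>\<mu> b\<close> of \<open>q\<close>.
\<close>

lemma logdet_along_line:
  assumes x: "x \<in> pos_cone"
  obtains B :: "'v set" and \<mu> :: "'v \<Rightarrow> real" where "finite B" "card B = jrank"
    "\<forall>t. (\<forall>b\<in>B. 1 + t * \<mu> b > 0) \<longrightarrow>
      x + t *\<^sub>R p \<in> pos_cone \<and> logdet (x + t *\<^sub>R p) = logdet x + (\<Sum>b\<in>B. ln (1 + t * \<mu> b))"
proof -
  obtain g where g: "linear g" "surj g" "g e = x"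
    "\<And>y. y \<in> pos_cone \<Longrightarrow> g y \<in> pos_cone \<and> logdet (g y) = logdet x + logdet y"
    using transport_from_unit[OF x] by blast
  obtain q where q: "p = g q" using g(2) by (metis surjD)
  obtain B \<mu> where B: "spectral_decomposition q B \<mu>" by (rule spectral_decomposition_exists)
  note Bf = spectral_frame[OF B]
  show ?thesis
  proof (rule that[of B \<mu>])
    show "finite B" by (rule frame_facts(1)[OF Bf])
    show "card B = jrank" using jrank_eq_card[OF Bf] by simp
    have "x + t *\<^sub>R p \<in> pos_cone \<and> logdet (x + t *\<^sub>R p) = logdet x + (\<Sum>b\<in>B. ln (1 + t * \<mu> b))"
      if t: "\<forall>b\<in>B. 1 + t * \<mu> b > 0" for t
    proof -
      have S: "spectral_decomposition (e + t *\<^sub>R q) B (\<lambda>b. 1 + t * \<mu> b)"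
      using spectral_shift[OF spectral_scale[OF B, of t], of 1] by (simp add: add.commute)
    then have P: "e + t *\<^sub>R q \<in> pos_cone" using t by (simp add: pos_cone_spectral[OF S])
    have "g (e + t *\<^sub>R q) = x + t *\<^sub>R p"
      using g(1) by (simp add: linear_add linear_scale g(3) q)
    with g(4)[OF P] show ?thesis
      by (simp add: logdet_spectral[OF S P])
    qed
    then show "\<forall>t. (\<forall>b\<in>B. 1 + t * \<mu> b > 0) \<longrightarrow>
      x + t *\<^sub>R p \<in> pos_cone \<and> logdet (x + t *\<^sub>R p) = logdet x + (\<Sum>b\<in>B. ln (1 + t * \<mu> b))" by blast
  qed
qed

end

section \<open>Self-concordance along a line\<close>

lemma powr_three_halves: "x \<ge> 0 \<Longrightarrow> x powr (3 / 2) = sqrt x ^ 3" for x :: real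
proof (cases "x = 0")
  case False
  assume "x \<ge> 0"
  with False have x: "x > 0" by simp
  have "sqrt x ^ 3 = (x powr (1 / 2)) powr 3"
    using x by (simp add: powr_half_sqrt powr_numeral)
  then show ?thesis by (simp add: powr_powr)
qed simp

text \<open>
The difference of the two sides factors as \<open>(N - s)\<^sup>2 (2 N + s)\<close> with \<open>s = a + b\<close> and \<open>N\<close> the square root. The
bound is attained, for example at \<open>a = b = 1\<close> and \<open>K = 2\<close>.
\<close>

lemma compatible_sum_bound:
  fixes a b K :: real
  assumes "a \<ge> 0" "b \<ge> 0" "K \<ge> 0"
  shows "2 * a ^ 3 + 3 * K * (a + b) + 2 * b ^ 3 \<le> 2 * sqrt (a\<^sup>2 + b\<^sup>2 + K) ^ 3"
proof -
  define N where "N = sqrt (a\<^sup>2 + b\<^sup>2 + K)"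
  have N: "N \<ge> 0" "N\<^sup>2 = a\<^sup>2 + b\<^sup>2 + K" using assms by (simp_all add: N_def)
  have "2 * N ^ 3 - (2 * a ^ 3 + 3 * K * (a + b) + 2 * b ^ 3) = (N - (a + b))\<^sup>2 * (2 * N + (a + b))"
  proof -
    have K: "K = N\<^sup>2 - a\<^sup>2 - b\<^sup>2" using N by simp
    show ?thesis unfolding K by (simp add: power2_eq_square power3_eq_cube algebra_simps)
  qed
  also have "\<dots> \<ge> 0" using N assms by simp
  finally show ?thesis by (simp add: N_def)
qed

text \<open>
Here \<open>A\<close> is the logarithmic derivative of the gap between the root of the determinant and \<open>u\<close>, \<open>\<kappa>\<close> is the
quotient of that root by the gap, and \<open>m k\<close> are the moments of the numbers \<open>\<mu> b\<close>. With the variance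
\<open>s = m 2 - (m 1)\<^sup>2\<close> and \<open>D\<^sup>2 = \<Sum> (\<mu> b)\<^sup>2\<close>, the third-order term \<open>m 1 ^ 3 - 3 m 1 m 2 + 2 m 3\<close> is the mean of
\<open>(\<mu> b - m 1)\<^sup>2 (2 \<mu> b + m 1)\<close> and hence at most \<open>3 D s\<close> in absolute value. This is the compatibility of the root of the
determinant with the logarithmic barrier in the sense of Nesterov and Nemirovskii.
\<close>

lemma self_concordance_inequality:
  fixes \<mu> :: "'b \<Rightarrow> real" and A \<kappa> :: real
  assumes B: "finite B" "B \<noteq> {}" and \<kappa>: "\<kappa> \<ge> 0"
  defines "m k \<equiv> (\<Sum>b\<in>B. \<mu> b ^ k) / card B"
  shows "\<bar>- 2 * A ^ 3 + 3 * A * (\<kappa> * ((m 1)\<^sup>2 - m 2)) - \<kappa> * (m 1 ^ 3 - 3 * m 1 * m 2 + 2 * m 3) - 2 * (\<Sum>b\<in>B. \<mu> b ^ 3)\<bar>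
    \<le> 2 * (A\<^sup>2 - \<kappa> * ((m 1)\<^sup>2 - m 2) + (\<Sum>b\<in>B. \<mu> b ^ 2)) powr (3 / 2)"
proof -
  define d where "d = real (card B)"
  have d: "d > 0" using B by (simp add: d_def card_gt_0_iff)
  define D where "D = sqrt (\<Sum>b\<in>B. \<mu> b ^ 2)"
  have D0: "D \<ge> 0" and D2: "D\<^sup>2 = (\<Sum>b\<in>B. \<mu> b ^ 2)" by (simp_all add: D_def sum_nonneg)
  have \<mu>D: "\<bar>\<mu> b\<bar> \<le> D" if "b \<in> B" for b
  proof -
    have "\<mu> b ^ 2 \<le> D\<^sup>2" unfolding D2 using that B(1) by (intro member_le_sum) auto
    then show ?thesis using D0 by (metis abs_le_square_iff abs_of_nonneg)
  qed
  have mD: "\<bar>m 1\<bar> \<le> D"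
  proof -
    have "\<bar>\<Sum>b\<in>B. \<mu> b\<bar> \<le> (\<Sum>b\<in>B. D)"
      by (rule order_trans[OF sum_abs sum_mono]) (rule \<mu>D)
    also have "\<dots> = d * D" by (simp add: d_def)
    finally show ?thesis using d by (simp add: m_def d_def[symmetric] abs_divide divide_le_eq mult.commute)
  qed
  define s where "s = m 2 - (m 1)\<^sup>2"
  define W where "W = m 1 ^ 3 - 3 * m 1 * m 2 + 2 * m 3"
  have sums: "(\<Sum>b\<in>B. \<mu> b) = d * m 1" "(\<Sum>b\<in>B. \<mu> b ^ 2) = d * m 2" "(\<Sum>b\<in>B. \<mu> b ^ 3) = d * m 3"
    using d by (simp_all add: m_def d_def)
  have s_eq: "d * s = (\<Sum>b\<in>B. (\<mu> b - m 1)\<^sup>2)"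
  proof -
    have "(\<Sum>b\<in>B. (\<mu> b - m 1)\<^sup>2) = (\<Sum>b\<in>B. \<mu> b ^ 2 - 2 * m 1 * \<mu> b + (m 1)\<^sup>2)"
      by (intro sum.cong) (auto simp: power2_eq_square algebra_simps)
    also have "\<dots> = d * m 2 - 2 * m 1 * (d * m 1) + d * (m 1)\<^sup>2"
      by (simp add: sum.distrib sum_subtractf sums d_def flip: sum_distrib_left)
    also have "\<dots> = d * s" by (simp add: s_def power2_eq_square algebra_simps)
    finally show ?thesis by simp
  qed
  have W_eq: "d * W = (\<Sum>b\<in>B. (\<mu> b - m 1)\<^sup>2 * (2 * \<mu> b + m 1))"
  proof -
    have "(\<Sum>b\<in>B. (\<mu> b - m 1)\<^sup>2 * (2 * \<mu> b + m 1))
      = (\<Sum>b\<in>B. 2 * \<mu> b ^ 3 - 3 * m 1 * \<mu> b ^ 2 + m 1 ^ 3)"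
      by (intro sum.cong) (auto simp: power2_eq_square power3_eq_cube algebra_simps)
    also have "\<dots> = 2 * (d * m 3) - 3 * m 1 * (d * m 2) + d * m 1 ^ 3"
      by (simp add: sum.distrib sum_subtractf sums d_def flip: sum_distrib_left)
    also have "\<dots> = d * W" by (simp add: W_def algebra_simps)
    finally show ?thesis by simp
  qed
  have s0: "s \<ge> 0"
  proof -
    have "d * s \<ge> 0" unfolding s_eq by (simp add: sum_nonneg)
    then show ?thesis using d by (simp add: zero_le_mult_iff)
  qed
  have W_le: "\<bar>W\<bar> \<le> 3 * D * s"
  proof -
    have "\<bar>d * W\<bar> \<le> (\<Sum>b\<in>B. (\<mu> b - m 1)\<^sup>2 * (3 * D))"
      unfolding W_eq
    proof (rule order_trans[OF sum_abs sum_mono])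
      fix b assume b: "b \<in> B"
      have "\<bar>2 * \<mu> b + m 1\<bar> \<le> 3 * D" using \<mu>D[OF b] mD by linarith
      then show "\<bar>(\<mu> b - m 1)\<^sup>2 * (2 * \<mu> b + m 1)\<bar> \<le> (\<mu> b - m 1)\<^sup>2 * (3 * D)"
        by (simp add: abs_mult mult_left_mono)
    qed
    also have "\<dots> = d * (3 * D * s)" by (simp add: s_eq flip: sum_distrib_right)
    finally show ?thesis using d by (simp add: abs_mult)
  qed
  have cube: "\<bar>\<Sum>b\<in>B. \<mu> b ^ 3\<bar> \<le> D ^ 3"
  proof -
    have "\<bar>\<Sum>b\<in>B. \<mu> b ^ 3\<bar> \<le> (\<Sum>b\<in>B. D * \<mu> b ^ 2)"
    proof (rule order_trans[OF sum_abs sum_mono])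
      fix b assume b: "b \<in> B"
      have "\<bar>\<mu> b ^ 3\<bar> = \<bar>\<mu> b\<bar> * \<mu> b ^ 2" by (simp add: power2_eq_square power3_eq_cube abs_mult)
      also have "\<dots> \<le> D * \<mu> b ^ 2" using \<mu>D[OF b] by (intro mult_right_mono) auto
      finally show "\<bar>\<mu> b ^ 3\<bar> \<le> D * \<mu> b ^ 2" .
    qed
    also have "\<dots> = D * D\<^sup>2" by (simp add: D2 sum_distrib_left)
    also have "\<dots> = D ^ 3" by (simp add: power2_eq_square power3_eq_cube)
    finally show ?thesis .
  qed
  define K where "K = \<kappa> * s"
  have K0: "K \<ge> 0" using \<kappa> s0 by (simp add: K_def)
  have \<kappa>W: "\<bar>\<kappa> * W\<bar> \<le> 3 * K * D"
    using mult_left_mono[OF W_le \<kappa>] \<kappa> by (simp add: K_def abs_mult mult_ac)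
  have "- 2 * A ^ 3 + 3 * A * (\<kappa> * ((m 1)\<^sup>2 - m 2)) - \<kappa> * (m 1 ^ 3 - 3 * m 1 * m 2 + 2 * m 3) - 2 * (\<Sum>b\<in>B. \<mu> b ^ 3)
    = - 2 * A ^ 3 - 3 * K * A - \<kappa> * W - 2 * (\<Sum>b\<in>B. \<mu> b ^ 3)"
    by (simp add: K_def s_def W_def algebra_simps)
  also have "\<bar>\<dots>\<bar> \<le> 2 * \<bar>A\<bar> ^ 3 + 3 * K * (\<bar>A\<bar> + D) + 2 * D ^ 3"
  proof -
    have "\<bar>A ^ 3\<bar> = \<bar>A\<bar> ^ 3" "\<bar>3 * K * A\<bar> = 3 * K * \<bar>A\<bar>" using K0 by (simp_all add: power_abs abs_mult)
    then show ?thesis using \<kappa>W cube unfolding distrib_left by linarith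
  qed
  also have "\<dots> \<le> 2 * sqrt (\<bar>A\<bar>\<^sup>2 + D\<^sup>2 + K) ^ 3"
    by (rule compatible_sum_bound[OF abs_ge_zero D0 K0])
  also have "\<dots> = 2 * (\<bar>A\<bar>\<^sup>2 + D\<^sup>2 + K) powr (3 / 2)"
    using K0 by (subst powr_three_halves) auto
  also have "\<bar>A\<bar>\<^sup>2 + D\<^sup>2 + K = A\<^sup>2 - \<kappa> * ((m 1)\<^sup>2 - m 2) + (\<Sum>b\<in>B. \<mu> b ^ 2)"
    by (simp add: D2 K_def s_def algebra_simps)
  finally show ?thesis .
qed

definition power_sum :: "'b set \<Rightarrow> ('b \<Rightarrow> real) \<Rightarrow> nat \<Rightarrow> real \<Rightarrow> real" where
  "power_sum B \<mu> k t = (\<Sum>b\<in>B. (\<mu> b / (1 + t * \<mu> b)) ^ k)"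

lemma log_sum_derivative:
  assumes "finite B" "\<And>b. b \<in> B \<Longrightarrow> 1 + t * \<mu> b > 0"
  shows "((\<lambda>t. \<Sum>b\<in>B. ln (1 + t * \<mu> b)) has_real_derivative power_sum B \<mu> 1 t) (at t)"
  unfolding power_sum_def
proof (rule DERIV_sum)
  fix b assume "b \<in> B"
  from assms(2)[OF this]
  show "((\<lambda>t. ln (1 + t * \<mu> b)) has_real_derivative (\<mu> b / (1 + t * \<mu> b)) ^ 1) (at t)"
    by (auto intro!: derivative_eq_intros)
qed

lemma power_sum_derivative:
  assumes "finite B" "\<And>b. b \<in> B \<Longrightarrow> 1 + t * \<mu> b > 0"
  shows "(power_sum B \<mu> (Suc k) has_real_derivative - real (Suc k) * power_sum B \<mu> (Suc (Suc k)) t) (at t)"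
  unfolding power_sum_def[abs_def] sum_distrib_left
proof (rule DERIV_sum)
  fix b assume "b \<in> B"
  note pos = assms(2)[OF this]
  have "((\<lambda>t. \<mu> b / (1 + t * \<mu> b)) has_real_derivative - ((\<mu> b / (1 + t * \<mu> b)) ^ 2)) (at t)"
    using pos by (auto intro!: derivative_eq_intros simp: power2_eq_square)
  moreover have "real (Suc k) * (- (r\<^sup>2) * r ^ (Suc k - Suc 0)) = - real (Suc k) * r ^ Suc (Suc k)" for r :: real
    by (simp add: power2_eq_square algebra_simps)
  ultimately show "((\<lambda>t. (\<mu> b / (1 + t * \<mu> b)) ^ Suc k) has_real_derivative
      - real (Suc k) * (\<mu> b / (1 + t * \<mu> b)) ^ Suc (Suc k)) (at t)"
    by (rule DERIV_cong[OF DERIV_power])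
qed

text \<open>
For \<open>k \<le> 3\<close> this is the \<open>k\<close>-th derivative of \<open>G \<Prod> (1 + t \<mu> b)\<^sup>1\<^sup>/\<^sup>d - (u + t s)\<close>, the gap of the barrier
along a line, expressed by the means of the power sums, as long as all factors \<open>1 + t \<mu> b\<close> are positive.
\<close>

definition line_gap :: "'b set \<Rightarrow> ('b \<Rightarrow> real) \<Rightarrow> real \<Rightarrow> real \<Rightarrow> real \<Rightarrow> nat \<Rightarrow> real \<Rightarrow> real" where
  "line_gap B \<mu> G u s k t =
    (let d = real (card B); \<psi> = G * exp ((\<Sum>b\<in>B. ln (1 + t * \<mu> b)) / d);
       S = (\<lambda>k. power_sum B \<mu> k t / d)
     in if k = 0 then \<psi> - (u + t * s)
        else if k = 1 then \<psi> * S 1 - s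
        else if k = 2 then \<psi> * ((S 1)\<^sup>2 - S 2)
        else \<psi> * (S 1 ^ 3 - 3 * S 1 * S 2 + 2 * S 3))"

lemma line_gap_derivative:
  assumes B: "finite B" "B \<noteq> {}" "\<And>b. b \<in> B \<Longrightarrow> 1 + t * \<mu> b > 0" and k: "k < 3"
  shows "(line_gap B \<mu> G u s k has_real_derivative line_gap B \<mu> G u s (Suc k) t) (at t)"
proof -
  define d where "d = real (card B)"
  have d: "d \<noteq> 0" using B by (simp add: d_def card_gt_0_iff)
  define \<psi> where "\<psi> t = G * exp ((\<Sum>b\<in>B. ln (1 + t * \<mu> b)) / d)" for t
  define S where "S k t = power_sum B \<mu> k t / d" for k t
  have \<psi>: "(\<psi> has_real_derivative \<psi> t * S 1 t) (at t)"
  proof -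
    define \<phi> where "\<phi> t = (\<Sum>b\<in>B. ln (1 + t * \<mu> b))" for t
    define P where "P = power_sum B \<mu> 1 t"
    have "(\<phi> has_real_derivative P) (at t)"
      unfolding \<phi>_def P_def by (rule log_sum_derivative[OF B(1,3)])
    then have "((\<lambda>t. G * exp (\<phi> t / d)) has_real_derivative G * exp (\<phi> t / d) * (P / d)) (at t)"
      using d by (auto intro!: derivative_eq_intros)
    then show ?thesis unfolding \<psi>_def S_def \<phi>_def P_def .
  qed
  have S1: "(S 1 has_real_derivative - S 2 t) (at t)"
    using DERIV_cdivide[OF power_sum_derivative[OF B(1,3), where k = 0], where c = d]
    unfolding S_def[abs_def] by (simp add: numeral_2_eq_2)
  have S2: "(S 2 has_real_derivative - 2 * S 3 t) (at t)"
    using DERIV_cdivide[OF power_sum_derivative[OF B(1,3), where k = 1], where c = d]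
    unfolding S_def[abs_def] by (simp add: numeral_2_eq_2 numeral_3_eq_3)
  have d1: "((\<lambda>t. \<psi> t * f t - s) has_real_derivative \<psi> t * ((f t)\<^sup>2 - a)) (at t)"
    if "(\<psi> has_real_derivative \<psi> t * f t) (at t)" "(f has_real_derivative - a) (at t)" for f a
    by (auto intro!: derivative_eq_intros that simp: power2_eq_square algebra_simps)
  have d2: "((\<lambda>t. \<psi> t * ((f t)\<^sup>2 - g t)) has_real_derivative
        \<psi> t * (f t ^ 3 - 3 * f t * g t + 2 * a)) (at t)"
    if "(\<psi> has_real_derivative \<psi> t * f t) (at t)" "(f has_real_derivative - g t) (at t)"
      "(g has_real_derivative - 2 * a) (at t)" for f g a
    by (auto intro!: derivative_eq_intros that simp: power2_eq_square power3_eq_cube algebra_simps)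
  consider "k = 0" | "k = 1" | "k = 2" using k by linarith
  then show ?thesis
  proof cases
    case 1
    have "((\<lambda>t. \<psi> t - (u + t * s)) has_real_derivative \<psi> t * S 1 t - s) (at t)"
      by (auto intro!: derivative_eq_intros \<psi>)
    then show ?thesis using 1 by (simp add: line_gap_def[abs_def] Let_def \<psi>_def S_def d_def)
  next
    case 2
    then show ?thesis using d1[OF \<psi> S1] by (simp add: line_gap_def[abs_def] Let_def \<psi>_def S_def d_def)
  next
    case 3
    then show ?thesis using d2[OF \<psi> S1 S2] by (simp add: line_gap_def[abs_def] Let_def \<psi>_def S_def d_def)
  qed
qed

text \<open>
For \<open>k \<le> 3\<close> this is the \<open>k\<close>-th derivative of \<open>- ln v - L\<close>, where \<open>v k\<close> and \<open>L k\<close> are the \<open>k\<close>-th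
derivatives of \<open>v\<close> and \<open>L\<close> and \<open>v\<close> is positive.
\<close>

definition line_barrier :: "(nat \<Rightarrow> real \<Rightarrow> real) \<Rightarrow> (nat \<Rightarrow> real \<Rightarrow> real) \<Rightarrow> nat \<Rightarrow> real \<Rightarrow> real" where
  "line_barrier v L k t =
    (if k = 0 then - ln (v 0 t) - L 0 t
     else if k = 1 then - (v 1 t / v 0 t) - L 1 t
     else if k = 2 then (v 1 t / v 0 t)\<^sup>2 - v 2 t / v 0 t - L 2 t
     else - 2 * (v 1 t / v 0 t) ^ 3 + 3 * (v 1 t / v 0 t) * (v 2 t / v 0 t) - v 3 t / v 0 t - L 3 t)"

lemma line_barrier_derivative:
  assumes v: "\<And>k. k < 3 \<Longrightarrow> (v k has_real_derivative v (Suc k) t) (at t)"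
    and L: "\<And>k. k < 3 \<Longrightarrow> (L k has_real_derivative L (Suc k) t) (at t)"
    and pos: "v 0 t > 0" and k: "k < 3"
  shows "(line_barrier v L k has_real_derivative line_barrier v L (Suc k) t) (at t)"
proof -
  have v0: "(v 0 has_real_derivative v 1 t) (at t)" and v1: "(v 1 has_real_derivative v 2 t) (at t)"
    and v2: "(v 2 has_real_derivative v 3 t) (at t)"
    and L0: "(L 0 has_real_derivative L 1 t) (at t)" and L1: "(L 1 has_real_derivative L 2 t) (at t)"
    and L2: "(L 2 has_real_derivative L 3 t) (at t)"
    using v[of 0] v[of 1] v[of 2] L[of 0] L[of 1] L[of 2] by (simp_all add: numeral_2_eq_2 numeral_3_eq_3)
  have d0: "((\<lambda>t. - ln (v 0 t) - L 0 t) has_real_derivative - (a / v 0 t) - l) (at t)"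
    if "(v 0 has_real_derivative a) (at t)" "(L 0 has_real_derivative l) (at t)" for a l
    using pos by (auto intro!: derivative_eq_intros that)
  have d1: "((\<lambda>t. - (f t / v 0 t) - g t) has_real_derivative (f t / v 0 t)\<^sup>2 - a / v 0 t - l) (at t)"
    if "(v 0 has_real_derivative f t) (at t)" "(f has_real_derivative a) (at t)" "(g has_real_derivative l) (at t)" for f g a l
    using pos by (auto intro!: derivative_eq_intros that simp: power2_eq_square field_simps)
  have d2: "((\<lambda>t. (f t / v 0 t)\<^sup>2 - h t / v 0 t - g t) has_real_derivative
        - 2 * (f t / v 0 t) ^ 3 + 3 * (f t / v 0 t) * (h t / v 0 t) - a / v 0 t - l) (at t)"
    if "(v 0 has_real_derivative f t) (at t)" "(f has_real_derivative h t) (at t)"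
      "(h has_real_derivative a) (at t)" "(g has_real_derivative l) (at t)" for f g h a l
    using pos by (auto intro!: derivative_eq_intros that simp: power2_eq_square power3_eq_cube field_simps)
  consider "k = 0" | "k = 1" | "k = 2" using k by linarith
  then show ?thesis
  proof cases
    case 1
    then show ?thesis using d0[OF v0 L0] by (simp add: line_barrier_def[abs_def])
  next
    case 2
    then show ?thesis using d1[OF v0 v1 L1] by (simp add: line_barrier_def[abs_def] numeral_2_eq_2)
  next
    case 3
    then show ?thesis using d2[OF v0 v1 v2 L2] by (simp add: line_barrier_def[abs_def] numeral_2_eq_2 numeral_3_eq_3)
  qed
qed

context trace_form
begin

lemma rtdet_barrier_self_concordant:
  assumes z: "z \<in> interior rtdet_cone"
  shows "\<bar>nabla 3 rtdet_barrier z p\<bar> \<le> 2 * nabla 2 rtdet_barrier z p powr (3 / 2)"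
proof -
  obtain u x where ux: "z = (u, x)" "x \<in> pos_cone" "u < rtdet x"
    using z by (auto simp: interior_rtdet_cone)
  obtain s q where p: "p = (s, q)" by (cases p)
  obtain B :: "'v set" and \<mu> where B: "finite B" "card B = jrank" and
    line: "\<forall>t. (\<forall>b\<in>B. 1 + t * \<mu> b > 0) \<longrightarrow>
      x + t *\<^sub>R q \<in> pos_cone \<and> logdet (x + t *\<^sub>R q) = logdet x + (\<Sum>b\<in>B. ln (1 + t * \<mu> b))"
    by (rule logdet_along_line[OF ux(2), of q]) (rule that)
  have Bne: "B \<noteq> {}" using B jrank_pos by auto
  define v where "v = line_gap B \<mu> (rtdet x) u s"
  define L where "L k t = (if k = 0 then logdet x + (\<Sum>b\<in>B. ln (1 + t * \<mu> b))
    else if k = 1 then power_sum B \<mu> 1 t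
    else if k = 2 then - power_sum B \<mu> 2 t else 2 * power_sum B \<mu> 3 t)" for k :: nat and t
  define \<eta> where "\<eta> = line_barrier v L"
  have L_der: "(L k has_real_derivative L (Suc k) t) (at t)"
    if t: "\<And>b. b \<in> B \<Longrightarrow> 1 + t * \<mu> b > 0" and k: "k < 3" for k t
  proof -
    consider "k = 0" | "k = 1" | "k = 2" using k by linarith
    then show ?thesis
    proof cases
      case 1
      then show ?thesis
        using DERIV_add[OF DERIV_const log_sum_derivative[OF B(1) t]] by (simp add: L_def[abs_def])
    next
      case 2
      then show ?thesis
        using power_sum_derivative[OF B(1) t, where k = 0] by (simp add: L_def[abs_def] numeral_2_eq_2)
    next
      case 3
      then show ?thesis
        using DERIV_minus[OF power_sum_derivative[OF B(1) t, where k = 1]]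
        by (simp add: L_def[abs_def] numeral_2_eq_2 numeral_3_eq_3)
    qed
  qed
  have "\<forall>\<^sub>F t in at 0. z + t *\<^sub>R p \<in> interior rtdet_cone \<and> (\<forall>b\<in>B. 1 + t * \<mu> b > 0)"
  proof (intro eventually_conj eventually_ball_finite[OF B(1)] ballI)
    have "((\<lambda>t::real. z + t *\<^sub>R p) \<longlongrightarrow> z + 0 *\<^sub>R p) (at 0)" by (intro tendsto_intros)
    then show "\<forall>\<^sub>F t in at (0::real). z + t *\<^sub>R p \<in> interior rtdet_cone"
      using z by (intro topological_tendstoD[OF _ open_interior]) auto
    show "\<forall>\<^sub>F t in at 0. 1 + t * \<mu> b > 0" for b
    proof (rule order_tendstoD(1))
      show "((\<lambda>t. 1 + t * \<mu> b) \<longlongrightarrow> 1 + 0 * \<mu> b) (at 0)" by (intro tendsto_intros)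
    qed simp
  qed
  then obtain \<epsilon> where \<epsilon>: "\<epsilon> > 0" "\<And>t. t \<noteq> 0 \<Longrightarrow> \<bar>t\<bar> < \<epsilon> \<Longrightarrow>
      z + t *\<^sub>R p \<in> interior rtdet_cone \<and> (\<forall>b\<in>B. 1 + t * \<mu> b > 0)"
    unfolding eventually_at by (auto simp: dist_real_def)
  have inside: "z + t *\<^sub>R p \<in> interior rtdet_cone" "\<And>b. b \<in> B \<Longrightarrow> 1 + t * \<mu> b > 0" if "\<bar>t\<bar> < \<epsilon>" for t
    using \<epsilon>(2)[OF _ that] z by (cases "t = 0"; auto)+
  have rt: "rtdet (x + t *\<^sub>R q) = rtdet x * exp ((\<Sum>b\<in>B. ln (1 + t * \<mu> b)) / card B)" if "\<bar>t\<bar> < \<epsilon>" for t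
    using line[rule_format, of t] inside(2)[OF that] by (simp add: rtdet_eq_exp ux(2) B(2) exp_add add_divide_distrib)
  have v0: "v 0 t = rtdet (x + t *\<^sub>R q) - (u + t * s)" if "\<bar>t\<bar> < \<epsilon>" for t
    using rt[OF that] by (simp add: v_def line_gap_def Let_def)
  have v0_pos: "v 0 t > 0" if "\<bar>t\<bar> < \<epsilon>" for t
    using inside(1)[OF that] by (simp add: v0[OF that] ux p interior_rtdet_cone)
  have nab: "nabla k rtdet_barrier (z + 0 *\<^sub>R p) p = \<eta> k 0" if "k \<le> 3" for k
  proof (rule nabla_along_line[OF rtdet_barrier_smooth inside(1) _ _ that])
    show "\<eta> 0 t = rtdet_barrier (z + t *\<^sub>R p)" if "\<bar>t\<bar> < \<epsilon>" for t
      using line[rule_format, of t] inside(2)[OF that]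
      by (simp add: \<eta>_def line_barrier_def v0[OF that] L_def ux p rtdet_barrier_eq)
    show "(\<eta> k has_real_derivative \<eta> (Suc k) t) (at t)" if "k < 3" "\<bar>t\<bar> < \<epsilon>" for k t
      unfolding \<eta>_def
    proof (rule line_barrier_derivative[of v t L, OF _ _ v0_pos[OF that(2)] that(1)])
      show "(v k has_real_derivative v (Suc k) t) (at t)" if "k < 3" for k
        unfolding v_def using inside(2)[OF \<open>\<bar>t\<bar> < \<epsilon>\<close>] that by (intro line_gap_derivative[OF B(1) Bne]) auto
      show "(L k has_real_derivative L (Suc k) t) (at t)" if "k < 3" for k
        using inside(2)[OF \<open>\<bar>t\<bar> < \<epsilon>\<close>] that by (intro L_der) auto
    qed
  qed (use \<epsilon> in auto)
  define \<kappa> where "\<kappa> = rtdet x / v 0 0"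
  define A where "A = v 1 0 / v 0 0"
  have v00: "v 0 0 > 0" using v0_pos[of 0] \<epsilon>(1) by simp
  have \<kappa>: "\<kappa> \<ge> 0" using v00 rtdet_nonneg by (simp add: \<kappa>_def)
  define m where "m k = (\<Sum>b\<in>B. \<mu> b ^ k) / card B" for k
  have v2: "v 2 0 / v 0 0 = \<kappa> * ((m 1)\<^sup>2 - m 2)"
    and v3: "v 3 0 / v 0 0 = \<kappa> * (m 1 ^ 3 - 3 * m 1 * m 2 + 2 * m 3)"
    unfolding \<kappa>_def m_def by (simp_all add: v_def[THEN fun_cong, THEN fun_cong, of 2] v_def[THEN fun_cong, THEN fun_cong, of 3]
        line_gap_def[of _ _ _ _ _ 2] line_gap_def[of _ _ _ _ _ 3] Let_def power_sum_def)
  have n2: "nabla 2 rtdet_barrier z p = A\<^sup>2 - \<kappa> * ((m 1)\<^sup>2 - m 2) + (\<Sum>b\<in>B. \<mu> b ^ 2)"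
    using nab[of 2] by (simp add: \<eta>_def line_barrier_def v2 A_def L_def power_sum_def)
  have n3: "nabla 3 rtdet_barrier z p = - 2 * A ^ 3 + 3 * A * (\<kappa> * ((m 1)\<^sup>2 - m 2))
      - \<kappa> * (m 1 ^ 3 - 3 * m 1 * m 2 + 2 * m 3) - 2 * (\<Sum>b\<in>B. \<mu> b ^ 3)"
    using nab[of 3] by (simp add: \<eta>_def line_barrier_def v2 v3 A_def L_def power_sum_def)
  show ?thesis
    unfolding n2 n3 m_def by (rule self_concordance_inequality[OF B(1) Bne \<kappa>])
qed

end

theorem proposition7p1:
  fixes jprod :: "'v::euclidean_space \<Rightarrow> 'v \<Rightarrow> 'v" and e :: 'v
  assumes "euclidean_jordan_algebra jprod e"
  shows "proper_cone (euclidean_jordan_algebra.rtdet_cone jprod e) \<and>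
    LHSCB (1 + real (euclidean_jordan_algebra.jrank jprod e))
      (euclidean_jordan_algebra.rtdet_cone jprod e)
      (euclidean_jordan_algebra.rtdet_barrier jprod e)"
proof -
  obtain ip :: "'v \<Rightarrow> 'v \<Rightarrow> real" where ip: "bilinear ip" "\<forall>a b. ip a b = ip b a"
    "\<forall>a. a \<noteq> 0 \<longrightarrow> ip a a > 0" "\<forall>a b c. ip (jprod a b) c = ip b (jprod a c)"
    using euclidean_jordan_algebra.euclidean[OF assms] by blast
  have "associative_form jprod e ip"
    by (intro associative_form.intro assms associative_form_axioms.intro) (use ip in auto)
  then obtain T where "trace_form jprod e T"
    using associative_form.trace_form_exists by blast
  then interpret trace_form jprod e T .
  show ?thesis
    unfolding LHSCB_def
    by (intro conjI allI ballI impI rtdet_cone_proper rtdet_barrier_smooth rtdet_barrier_convex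
        rtdet_barrier_homogeneous rtdet_barrier_self_concordant rtdet_barrier_blows_up) auto
qed

end
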